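(* Let $W$ be a pointed Frölicher space and let $i:A\hookrightarrow X$ be a cofibration in the category of pointed Frölicher spaces, with basepoint $x_0\in A\subseteq X$. Let $j:X\to\mathbf T_i$, $x\mapsto[x]$, be the inclusion into the flattened mapping cone and $k:\mathbf T_i\to\Sigma A$ the map collapsing $j(X)$ to a point followed by the canonical isomorphism $\mathbf T_i/X\cong\Sigma A$. Then the sequence of pointed sets $$\cdots\to[\Sigma^{n+1}A,W]\xrightarrow{(\Sigma^nk)^*}[\Sigma^n\mathbf T_i,W]\xrightarrow{(\Sigma^nj)^*}[\Sigma^nX,W]\xrightarrow{(\Sigma^ni)^*}[\Sigma^nA,W]\xrightarrow{(\Sigma^{n-1}k)^*}\cdots\to[\Sigma A,W]\xrightarrow{k^*}[\mathbf T_i,W]\xrightarrow{j^*}[X,W]\xrightarrow{i^*}[A,W]$$ is exact.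
   Context: A Frölicher space is a triple $(X,\mathcal C_X,\mathcal F_X)$ with $\mathcal C_X\subseteq X^{\mathbb R}$, $\mathcal F_X\subseteq\mathbb R^X$, such that $\mathcal F_X=\{f\mid f\circ c\in C^\infty(\mathbb R,\mathbb R)\ \forall c\in\mathcal C_X\}$ and $\mathcal C_X=\{c\mid f\circ c\in C^\infty(\mathbb R,\mathbb R)\ \forall f\in\mathcal F_X\}$. Smooth maps: $g\circ\varphi\in\mathcal F_X$ for all $g\in\mathcal F_Y$. Subspaces carry the initial structure, products the structure generated by $f\circ\pi_i$, coproducts, quotients and pushouts the final structure. $I$ is $[0,1]$ with the subspace structure from $\mathbb R$; $\mathbf I$ is $[0,1]$ with the structure generated by those structure functions of $I$ that are constant on $[0,\epsilon)$ and on $(1-\epsilon,1]$ for some $0<\epsilon<1/4$. Braking function: for $0<\epsilon<\frac12$, $\alpha_\epsilon:\mathbb R\to\mathbb R$ smooth, $=0$ on $(-\infty,\epsilon]$, strictly increasing with values in $(0,1)$ on $(\epsilon,1-\epsilon)$, $=1$ on $[1-\epsilon,\infty)$. A smooth map $i:A\to X$ is a smooth cofibration if for every $Z$, smooth $f:X\to Z$ and smooth $G:I\times A\to Z$ with $G(0,a)=f(i(a))$, there exist $\epsilon$, a braking function $\alpha_\epsilon$ and a smooth $F:I\times X\to Z$ with $F(0,x)=f(x)$ and $F(t,i(a))=G(\alpha_\epsilon(t),a)$ (in the pointed category all maps and homotopies preserve basepoints). For smooth $f:X\to Y$, the flattened mapping cylinder $\mathbf I_f$ is the quotient of $(\mathbf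 I\times X)\sqcup Y$ by $(1,x)\sim f(x)$, elements $[t,x]$, $[y]$; the pointed flattened mapping cone $\mathbf T_f$ is the quotient of $\mathbf I_f$ collapsing $(\{0\}\times X)\cup(\mathbf I\times\{x_0\})$ to its basepoint. The reduced flattened suspension is $\Sigma A=(\mathbf I/\{0,1\})\wedge A$ with $0$ the basepoint of $\mathbf I$; for a pointed smooth map $g$, $\Sigma g=1\wedge g$, and $\Sigma^n$ denotes $n$-fold iteration. For pointed $X,W$, $[X,W]$ is the set of basepoint-preserving smooth maps modulo pointed smooth homotopy (smooth $H:I\times X\to W$ with $H(t,x_0)=w_0$), pointed by the class of the constant map; $g^*$ is precomposition. Exactness at each term means the image of the incoming map equals the preimage of the basepoint under the outgoing map. *)

theory Defs
  imports Complex_Main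
begin

section \<open>Smooth real functions and Froelicher spaces\<close>

text \<open>C-infinity functions R to R: there is a sequence of successive derivatives.\<close>
definition smooth_rr :: "(real \<Rightarrow> real) \<Rightarrow> bool" where
  "smooth_rr f \<longleftrightarrow> (\<exists>D. D 0 = f \<and> (\<forall>n x. (D n has_real_derivative D (Suc n) x) (at x)))"

text \<open>A Froelicher space with explicit carrier set; structure functions are functions on the
  ambient type whose values off the carrier are irrelevant.\<close>
record 'a frol =
  carr :: "'a set"
  crv :: "(real \<Rightarrow> 'a) set"
  fns :: "('a \<Rightarrow> real) set"

definition frolicher :: "'a frol \<Rightarrow> bool" where
  "frolicher S \<longleftrightarrow>
     fns S = {f. \<forall>c\<in>crv S. smooth_rr (f \<circ> c)} \<and>
     crv S = {c. range c \<subseteq> carr S \<and> (\<forall>f\<in>fns S. smooth_rr (f \<circ> c))}"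

definition smooth_map :: "'a frol \<Rightarrow> 'b frol \<Rightarrow> ('a \<Rightarrow> 'b) \<Rightarrow> bool" where
  "smooth_map S T \<phi> \<longleftrightarrow> (\<forall>x\<in>carr S. \<phi> x \<in> carr T) \<and> (\<forall>g\<in>fns T. g \<circ> \<phi> \<in> fns S)"

text \<open>Structure generated by a set of functions (initial type structures).\<close>
definition gen_fns :: "'a set \<Rightarrow> ('a \<Rightarrow> real) set \<Rightarrow> 'a frol" where
  "gen_fns X F0 =
    (let C = {c. range c \<subseteq> X \<and> (\<forall>f\<in>F0. smooth_rr (f \<circ> c))}
     in \<lparr>carr = X, crv = C, fns = {f. \<forall>c\<in>C. smooth_rr (f \<circ> c)}\<rparr>)"

text \<open>Structure generated by a set of curves (final structures).\<close>
definition gen_crv :: "'a set \<Rightarrow> (real \<Rightarrow> 'a) set \<Rightarrow> 'a frol" where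
  "gen_crv X C0 =
    (let F = {f. \<forall>c\<in>C0. smooth_rr (f \<circ> c)};
         C = {c. range c \<subseteq> X \<and> (\<forall>f\<in>F. smooth_rr (f \<circ> c))}
     in \<lparr>carr = X, crv = C, fns = {f. \<forall>c\<in>C. smooth_rr (f \<circ> c)}\<rparr>)"

definition subspace :: "'a frol \<Rightarrow> 'a set \<Rightarrow> 'a frol" where
  "subspace S Y = gen_fns Y (fns S)"

definition prodsp :: "'a frol \<Rightarrow> 'b frol \<Rightarrow> ('a \<times> 'b) frol" where
  "prodsp S T = gen_fns (carr S \<times> carr T) ({f \<circ> fst | f. f \<in> fns S} \<union> {g \<circ> snd | g. g \<in> fns T})"

text \<open>The real line (standard structure, generated by the identity) and the intervals.\<close>
definition realsp :: "real frol" where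
  "realsp = gen_fns UNIV {id}"

definition Isp :: "real frol" where
  "Isp = subspace realsp {0..1}"

definition boldI :: "real frol" where
  "boldI = gen_fns {0..1}
     {f \<in> fns Isp. \<exists>\<epsilon>. 0 < \<epsilon> \<and> \<epsilon> < 1/4 \<and>
          (\<forall>s. 0 \<le> s \<and> s < \<epsilon> \<longrightarrow> f s = f 0) \<and> (\<forall>s. 1 - \<epsilon> < s \<and> s \<le> 1 \<longrightarrow> f s = f 1)}"

section \<open>Pointed maps, homotopies, homotopy sets, exactness\<close>

definition psmooth :: "'a frol \<times> 'a \<Rightarrow> 'b frol \<times> 'b \<Rightarrow> ('a \<Rightarrow> 'b) \<Rightarrow> bool" where
  "psmooth S T \<phi> \<longleftrightarrow> smooth_map (fst S) (fst T) \<phi> \<and> \<phi> (snd S) = snd T"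

definition phtpy :: "'a frol \<times> 'a \<Rightarrow> 'b frol \<times> 'b \<Rightarrow> ('a \<Rightarrow> 'b) \<Rightarrow> ('a \<Rightarrow> 'b) \<Rightarrow> bool" where
  "phtpy S T f g \<longleftrightarrow> (\<exists>H. smooth_map (prodsp Isp (fst S)) (fst T) H \<and>
      (\<forall>x\<in>carr (fst S). H (0, x) = f x \<and> H (1, x) = g x) \<and>
      (\<forall>t\<in>{0..1}. H (t, snd S) = snd T))"

text \<open>Pointed smooth homotopy, as an equivalence relation on pointed smooth maps
  (equivalence closure, to match "modulo pointed smooth homotopy").\<close>
definition hrel :: "'a frol \<times> 'a \<Rightarrow> 'b frol \<times> 'b \<Rightarrow> (('a \<Rightarrow> 'b) \<times> ('a \<Rightarrow> 'b)) set" where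
  "hrel S T =
    (let M = {f. psmooth S T f}; R = {(f, g). f \<in> M \<and> g \<in> M \<and> phtpy S T f g}
     in (R \<union> R\<inverse>)\<^sup>* \<inter> (M \<times> M))"

text \<open>The pointed set [S,T] and its basepoint.\<close>
definition hset :: "'a frol \<times> 'a \<Rightarrow> 'b frol \<times> 'b \<Rightarrow> ('a \<Rightarrow> 'b) set set" where
  "hset S T = {f. psmooth S T f} // hrel S T"

definition hbase :: "'a frol \<times> 'a \<Rightarrow> 'b frol \<times> 'b \<Rightarrow> ('a \<Rightarrow> 'b) set" where
  "hbase S T = hrel S T `` {\<lambda>_. snd T}"

text \<open>Precomposition g^* : [Y,W] -> [S,W] for g : S -> Y.\<close>
definition pull :: "'b frol \<times> 'b \<Rightarrow> 'a frol \<times> 'a \<Rightarrow> ('a \<Rightarrow> 'c) \<Rightarrow> ('c \<Rightarrow> 'b) set \<Rightarrow> ('a \<Rightarrow> 'b) set" where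
  "pull W S g C = hrel S W `` {(SOME f. f \<in> C) \<circ> g}"

text \<open>Exactness of [Y,W] --g^*--> [X,W] --h^*--> [V,W] at [X,W], where h : V -> X, g : X -> Y.\<close>
definition exact_at ::
  "'w frol \<times> 'w \<Rightarrow> 'a frol \<times> 'a \<Rightarrow> 'b frol \<times> 'b \<Rightarrow> 'c frol \<times> 'c \<Rightarrow> ('a \<Rightarrow> 'b) \<Rightarrow> ('b \<Rightarrow> 'c) \<Rightarrow> bool" where
  "exact_at W V X Y h g \<longleftrightarrow>
     pull W X g ` hset Y W = {C \<in> hset X W. pull W V h C = hbase V W}"

section \<open>Cofibrations\<close>

definition braking :: "real \<Rightarrow> (real \<Rightarrow> real) \<Rightarrow> bool" where
  "braking \<epsilon> \<alpha> \<longleftrightarrow> 0 < \<epsilon> \<and> \<epsilon> < 1/2 \<and> smooth_rr \<alpha> \<and>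
     (\<forall>t. t \<le> \<epsilon> \<longrightarrow> \<alpha> t = 0) \<and>
     strict_mono_on {\<epsilon><..<1-\<epsilon>} \<alpha> \<and> (\<forall>t\<in>{\<epsilon><..<1-\<epsilon>}. 0 < \<alpha> t \<and> \<alpha> t < 1) \<and>
     (\<forall>t. 1 - \<epsilon> \<le> t \<longrightarrow> \<alpha> t = 1)"

text \<open>Pointed homotopy extension property of the inclusion A into X (base point x0)
  with respect to one pointed target (Z, z0).\<close>
definition pcofib_wrt :: "'a frol \<Rightarrow> 'a frol \<Rightarrow> 'a \<Rightarrow> 'z frol \<Rightarrow> 'z \<Rightarrow> bool" where
  "pcofib_wrt A X x0 Z z0 \<longleftrightarrow>
    (\<forall>f G. psmooth (X, x0) (Z, z0) f \<and> smooth_map (prodsp Isp A) Z G \<and>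
        (\<forall>a\<in>carr A. G (0, a) = f a) \<and> (\<forall>t\<in>{0..1}. G (t, x0) = z0)
      \<longrightarrow> (\<exists>\<epsilon> \<alpha> F. braking \<epsilon> \<alpha> \<and> smooth_map (prodsp Isp X) Z F \<and>
             (\<forall>x\<in>carr X. F (0, x) = f x) \<and>
             (\<forall>t\<in>{0..1}. \<forall>a\<in>carr A. F (t, a) = G (\<alpha> t, a)) \<and>
             (\<forall>t\<in>{0..1}. F (t, x0) = z0)))"

section \<open>A universe of points for iterated constructions\<close>

datatype 'a fpt = Pt 'a | Re real | Pr "'a fpt" "'a fpt" | InL "'a fpt" | InR "'a fpt"

definition pfst :: "'a fpt \<Rightarrow> 'a fpt" where
  "pfst z = (case z of Pr a b \<Rightarrow> a | _ \<Rightarrow> undefined)"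
definition psnd :: "'a fpt \<Rightarrow> 'a fpt" where
  "psnd z = (case z of Pr a b \<Rightarrow> b | _ \<Rightarrow> undefined)"

text \<open>Isomorphic copy of a space inside the universe.\<close>
definition liftsp :: "'a frol \<Rightarrow> 'a fpt frol" where
  "liftsp S = gen_crv (Pt ` carr S) {Pt \<circ> c | c. c \<in> crv S}"

definition Ifpt :: "'a fpt frol" where
  "Ifpt = gen_crv (Re ` {0..1}) {Re \<circ> c | c. c \<in> crv boldI}"

definition fprod :: "'a fpt frol \<Rightarrow> 'a fpt frol \<Rightarrow> 'a fpt frol" where
  "fprod S T = gen_fns {Pr a b | a b. a \<in> carr S \<and> b \<in> carr T}
      ({f \<circ> pfst | f. f \<in> fns S} \<union> {g \<circ> psnd | g. g \<in> fns T})"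

definition fcoprod :: "'a fpt frol \<Rightarrow> 'a fpt frol \<Rightarrow> 'a fpt frol" where
  "fcoprod S T = gen_crv (InL ` carr S \<union> InR ` carr T)
      ({InL \<circ> c | c. c \<in> crv S} \<union> {InR \<circ> c | c. c \<in> crv T})"

text \<open>Quotient by the equivalence relation generated by R: each class is represented by a
  canonically chosen element; the quotient map is qrep S R.\<close>
definition qrep :: "'a frol \<Rightarrow> ('a \<times> 'a) set \<Rightarrow> 'a \<Rightarrow> 'a" where
  "qrep S R x = (SOME y. y \<in> carr S \<and> (x, y) \<in> (R \<union> R\<inverse>)\<^sup>*)"

definition quot :: "'a frol \<Rightarrow> ('a \<times> 'a) set \<Rightarrow> 'a frol" where
  "quot S R = gen_crv (qrep S R ` carr S) {qrep S R \<circ> c | c. c \<in> crv S}"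

section \<open>Reduced flattened suspension\<close>

text \<open>The circle bold-I/{0,1}, pointed by the class of 0.\<close>
definition circ_rel :: "('a fpt \<times> 'a fpt) set" where
  "circ_rel = {(Re 0, Re 1)}"
definition circsp :: "'a fpt frol" where
  "circsp = quot Ifpt circ_rel"
definition circ_q :: "'a fpt \<Rightarrow> 'a fpt" where
  "circ_q = qrep Ifpt circ_rel"
definition circ_pt :: "'a fpt" where
  "circ_pt = circ_q (Re 0)"

text \<open>Smash product (bold-I/{0,1}) ^ B = product modulo the wedge.\<close>
definition wedge_rel :: "'a fpt frol \<times> 'a fpt \<Rightarrow> ('a fpt \<times> 'a fpt) set" where
  "wedge_rel B = (let Wg = {Pr circ_pt b | b. b \<in> carr (fst B)} \<union> {Pr p (snd B) | p. p \<in> carr circsp}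
                  in Wg \<times> Wg)"

definition susp_q :: "'a fpt frol \<times> 'a fpt \<Rightarrow> 'a fpt \<Rightarrow> 'a fpt" where
  "susp_q B = qrep (fprod circsp (fst B)) (wedge_rel B)"

definition susp :: "'a fpt frol \<times> 'a fpt \<Rightarrow> 'a fpt frol \<times> 'a fpt" where
  "susp B = (quot (fprod circsp (fst B)) (wedge_rel B), susp_q B (Pr circ_pt (snd B)))"

text \<open>Sigma g = 1 ^ g, for g : B -> C.\<close>
definition susp_map :: "'a fpt frol \<times> 'a fpt \<Rightarrow> ('a fpt \<Rightarrow> 'a fpt) \<Rightarrow> 'a fpt \<Rightarrow> 'a fpt" where
  "susp_map C g = (\<lambda>z. susp_q C (Pr (pfst z) (g (psnd z))))"

definition susp_n :: "nat \<Rightarrow> 'a fpt frol \<times> 'a fpt \<Rightarrow> 'a fpt frol \<times> 'a fpt" where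
  "susp_n n B = (susp ^^ n) B"

text \<open>Sigma^n g for g : B -> C (depends on the target C).\<close>
primrec susp_map_n :: "nat \<Rightarrow> 'a fpt frol \<times> 'a fpt \<Rightarrow> ('a fpt \<Rightarrow> 'a fpt) \<Rightarrow> 'a fpt \<Rightarrow> 'a fpt" where
  "susp_map_n 0 C g = g"
| "susp_map_n (Suc n) C g = susp_map (susp_n n C) (susp_map_n n C g)"

section \<open>Flattened mapping cone of the inclusion A into X\<close>

definition cyl_pre :: "'a frol \<Rightarrow> 'a frol \<Rightarrow> 'a fpt frol" where
  "cyl_pre A X = fcoprod (fprod Ifpt (liftsp A)) (liftsp X)"

definition cyl_rel :: "'a frol \<Rightarrow> ('a fpt \<times> 'a fpt) set" where
  "cyl_rel A = {(InL (Pr (Re 1) (Pt a)), InR (Pt a)) | a. a \<in> carr A}"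

definition cyl :: "'a frol \<Rightarrow> 'a frol \<Rightarrow> 'a fpt frol" where
  "cyl A X = quot (cyl_pre A X) (cyl_rel A)"

definition cyl_q :: "'a frol \<Rightarrow> 'a frol \<Rightarrow> 'a fpt \<Rightarrow> 'a fpt" where
  "cyl_q A X = qrep (cyl_pre A X) (cyl_rel A)"

definition cone_coll :: "'a frol \<Rightarrow> 'a frol \<Rightarrow> 'a \<Rightarrow> 'a fpt set" where
  "cone_coll A X x0 = cyl_q A X ` ({InL (Pr (Re 0) (Pt a)) | a. a \<in> carr A} \<union>
                                    {InL (Pr (Re t) (Pt x0)) | t. t \<in> {0..1}})"

definition cone_q :: "'a frol \<Rightarrow> 'a frol \<Rightarrow> 'a \<Rightarrow> 'a fpt \<Rightarrow> 'a fpt" where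
  "cone_q A X x0 = qrep (cyl A X) (cone_coll A X x0 \<times> cone_coll A X x0)"

text \<open>The pointed flattened mapping cone T_i.\<close>
definition cone :: "'a frol \<Rightarrow> 'a frol \<Rightarrow> 'a \<Rightarrow> 'a fpt frol \<times> 'a fpt" where
  "cone A X x0 = (quot (cyl A X) (cone_coll A X x0 \<times> cone_coll A X x0),
                  cone_q A X x0 (cyl_q A X (InL (Pr (Re 0) (Pt x0)))))"

text \<open>j : X -> T_i, x |-> [x].\<close>
definition cone_j :: "'a frol \<Rightarrow> 'a frol \<Rightarrow> 'a \<Rightarrow> 'a fpt \<Rightarrow> 'a fpt" where
  "cone_j A X x0 z = cone_q A X x0 (cyl_q A X (InR z))"

text \<open>k : T_i -> Sigma A: [t,a] |-> [t,a], [x] |-> basepoint (collapse X, then T_i/X = Sigma A).\<close>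
definition cone_k :: "'a frol \<Rightarrow> 'a \<Rightarrow> 'a fpt \<Rightarrow> 'a fpt" where
  "cone_k A x0 z = (case z of
      InL (Pr p a) \<Rightarrow> susp_q (liftsp A, Pt x0) (Pr (circ_q p) a)
    | _ \<Rightarrow> snd (susp (liftsp A, Pt x0)))"

end

(* For n = 0 exactness is shown by explicit homotopies on the mapping cone and on the suspension; the
   case of n-fold suspensions is the case n = 0 with the target replaced by its n-fold loop space. Both
   need that products preserve quotients, that is, cartesian closedness, which rests on the theorem of
   Lawvere, Schanuel and Zame: a curve in the space of smooth functions on which every smooth functional
   is smooth is jointly smooth. Smoothness is measured by finite differences: a function is smooth iff
   its m-th differences with step d are O(d^m) locally uniformly. A special-curve argument and
   polarization give such bounds for the mixed differences of a function that is smooth along curves,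
   and a gliding hump transfers them to weakly smooth curves. *)

theory Submission
  imports Defs
begin

section \<open>Smooth functions of one real variable\<close>

text \<open>A curve in a quotient need not lift, even locally, to the space it comes from: the final
  structure only says how test functions behave along it. So a homotopy on I x Q, with Q a quotient,
  cannot be checked along lifted curves directly. What the final structure does give is that
  \<open>\<lambda>v. \<Phi> (\<lambda>u. g (K (p u) (c v)))\<close> is smooth for every functional
  \<Phi> that takes smooth families to smooth functions; removing \<Phi> is the analytic task.
  Differences fit it because they are finite linear combinations of values: absolutely summable
  series of difference quotients in u are admissible functionals, and bounds on differences pass to
  limits and sums. Composing with a step that is constant near both ends repairs this and changes
  maps only up to homotopy.\<close>

definition der :: "(real \<Rightarrow> real) \<Rightarrow> real \<Rightarrow> real" where
  "der f x = (SOME d. (f has_real_derivative d) (at x))"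

lemma der_eq: "(f has_real_derivative d) (at x) \<Longrightarrow> der f x = d"
  unfolding der_def by (rule some_equality) (auto intro: DERIV_unique)

lemma der_eqI: "(\<And>x. (f has_real_derivative f' x) (at x)) \<Longrightarrow> der f = f'"
  using der_eq by blast

text \<open>The smooth functions are the largest class of differentiable functions that contains its
  derivatives. Naming such a class avoids writing down the sequence of derivatives;
  \<open>der\<close> supplies it.\<close>

lemma smooth_coinduct:
  assumes "P f" and step: "\<And>g. P g \<Longrightarrow> \<exists>g'. (\<forall>x. (g has_real_derivative g' x) (at x)) \<and> P g'"
  shows "smooth_rr f"
proof -
  have st: "P (der g) \<and> (\<forall>x. (g has_real_derivative der g x) (at x))" if "P g" for g
    using step[OF that] der_eqI by metis
  have "P ((der ^^ n) f)" for n by (induction n) (use \<open>P f\<close> st in auto)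
  then show ?thesis unfolding smooth_rr_def using st
    by (intro exI[of _ "\<lambda>n. (der ^^ n) f"]) auto
qed

lemma smooth_der:
  assumes "smooth_rr f"
  shows "(f has_real_derivative der f x) (at x)" "smooth_rr (der f)"
proof -
  obtain D where D: "D 0 = f" "\<And>n x. (D n has_real_derivative D (Suc n) x) (at x)"
    using assms unfolding smooth_rr_def by blast
  have d: "der f = D 1" using D der_eqI[of f "D 1"] by fastforce
  show "(f has_real_derivative der f x) (at x)" using D d by fastforce
  show "smooth_rr (der f)" unfolding smooth_rr_def d
    by (intro exI[of _ "\<lambda>n. D (Suc n)"]) (use D in auto)
qed

lemma smoothI:
  assumes "\<And>x. (f has_real_derivative f' x) (at x)" "smooth_rr f'"
  shows "smooth_rr f"
  by (rule smooth_coinduct[where P = "\<lambda>g. smooth_rr g \<or> g = f"]) (use assms smooth_der in blast)+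

lemma smooth_der_n: "smooth_rr f \<Longrightarrow> smooth_rr ((der ^^ n) f)"
  by (induction n) (auto intro: smooth_der)

lemma smooth_cont: "smooth_rr f \<Longrightarrow> isCont f x"
  using smooth_der DERIV_isCont by blast

text \<open>Existence of n derivatives with the order explicit: the product, chain and quotient
  rules express a derivative through the given functions and their derivatives, which an induction
  on the order can exploit.\<close>

primrec ck :: "nat \<Rightarrow> (real \<Rightarrow> real) \<Rightarrow> bool" where
  "ck 0 f = True"
| "ck (Suc n) f = (\<exists>f'. (\<forall>x. (f has_real_derivative f' x) (at x)) \<and> ck n f')"

lemma ck_der: "ck (Suc n) f \<Longrightarrow> (f has_real_derivative der f x) (at x) \<and> ck n (der f)"
  using der_eqI by (metis ck.simps(2))

lemma smooth_iff_ck: "smooth_rr f \<longleftrightarrow> (\<forall>n. ck n f)"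
proof
  show "smooth_rr f \<Longrightarrow> \<forall>n. ck n f"
  proof
    fix n show "smooth_rr f \<Longrightarrow> ck n f"
    proof (induction n arbitrary: f)
      case (Suc n)
      then show ?case using smooth_der[OF Suc.prems] by (auto intro!: exI[of _ "der f"])
    qed simp
  qed
  show "\<forall>n. ck n f \<Longrightarrow> smooth_rr f"
    by (rule smooth_coinduct[where P = "\<lambda>g. \<forall>n. ck n g"]) (use ck_der in blast)+
qed

lemma ck_Suc: "ck (Suc n) f \<Longrightarrow> ck n f"
proof (induction n arbitrary: f)
  case (Suc n)
  then show ?case by (metis ck.simps(2))
qed simp

lemma ck_const: "ck n (\<lambda>x. c)"
  by (induction n arbitrary: c) (auto intro!: derivative_eq_intros exI[of _ "\<lambda>x. 0"])

lemma ck_add: "ck n f \<Longrightarrow> ck n g \<Longrightarrow> ck n (\<lambda>x. f x + g x)"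
proof (induction n arbitrary: f g)
  case (Suc n)
  then obtain f' g' where
    "\<And>x. (f has_real_derivative f' x) (at x)" "ck n f'"
    "\<And>x. (g has_real_derivative g' x) (at x)" "ck n g'" by auto
  with Suc.IH[of f' g'] show ?case
    by (auto intro!: exI[of _ "\<lambda>x. f' x + g' x"] derivative_eq_intros)
qed simp

lemma ck_mult: "ck n f \<Longrightarrow> ck n g \<Longrightarrow> ck n (\<lambda>x. f x * g x)"
proof (induction n arbitrary: f g)
  case (Suc n)
  then obtain f' g' where d:
    "\<And>x. (f has_real_derivative f' x) (at x)" "ck n f'"
    "\<And>x. (g has_real_derivative g' x) (at x)" "ck n g'" by auto
  have "ck n (\<lambda>x. f' x * g x + g' x * f x)"
    by (intro ck_add Suc.IH d ck_Suc[OF Suc.prems(1)] ck_Suc[OF Suc.prems(2)])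
  with d show ?case
    by (auto intro!: exI[of _ "\<lambda>x. f' x * g x + g' x * f x"] derivative_eq_intros)
qed simp

lemma ck_comp: "ck n f \<Longrightarrow> ck n g \<Longrightarrow> ck n (\<lambda>x. f (g x))"
proof (induction n arbitrary: f g)
  case (Suc n)
  then obtain f' g' where d:
    "\<And>x. (f has_real_derivative f' x) (at x)" "ck n f'"
    "\<And>x. (g has_real_derivative g' x) (at x)" "ck n g'" by auto
  have "ck n (\<lambda>x. f' (g x) * g' x)"
    by (rule ck_mult[OF Suc.IH[OF d(2) ck_Suc[OF Suc.prems(2)]] d(4)])
  with d show ?case
    using DERIV_chain2[of f _ g] by (auto intro!: exI[of _ "\<lambda>x. f' (g x) * g' x"])
qed simp

lemma ck_inverse: "(\<And>x. f x \<noteq> 0) \<Longrightarrow> ck n f \<Longrightarrow> ck n (\<lambda>x. inverse (f x))"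
proof (induction n arbitrary: f)
  case (Suc n)
  then obtain f' where d: "\<And>x. (f has_real_derivative f' x) (at x)" "ck n f'" by auto
  have "ck n (\<lambda>x. -1 * (inverse (f x) * (f' x * inverse (f x))))"
    by (intro ck_mult Suc.IH ck_const d ck_Suc[OF Suc.prems(2)] Suc.prems)
  with d Suc.prems show ?case
    by (auto intro!: exI[of _ "\<lambda>x. -1 * (inverse (f x) * (f' x * inverse (f x)))"]
          derivative_eq_intros)
qed simp

named_theorems smooth_intros

lemma smooth_const [smooth_intros]: "smooth_rr (\<lambda>x. c)"
  by (simp add: smooth_iff_ck ck_const)

lemma smooth_id [smooth_intros]: "smooth_rr (\<lambda>x. x)"
  by (rule smoothI[where f' = "\<lambda>x. 1"]) (auto intro: smooth_const)

lemma smooth_add [smooth_intros]: "smooth_rr f \<Longrightarrow> smooth_rr g \<Longrightarrow> smooth_rr (\<lambda>x. f x + g x)"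
  by (simp add: smooth_iff_ck ck_add)

lemma smooth_mult [smooth_intros]: "smooth_rr f \<Longrightarrow> smooth_rr g \<Longrightarrow> smooth_rr (\<lambda>x. f x * g x)"
  by (simp add: smooth_iff_ck ck_mult)

lemma smooth_comp: "smooth_rr f \<Longrightarrow> smooth_rr g \<Longrightarrow> smooth_rr (\<lambda>x. f (g x))"
  by (simp add: smooth_iff_ck ck_comp)

lemma smooth_minus [smooth_intros]: "smooth_rr f \<Longrightarrow> smooth_rr (\<lambda>x. - f x)"
  using smooth_mult[OF smooth_const[of "-1"], of f] by simp

lemma smooth_diff [smooth_intros]: "smooth_rr f \<Longrightarrow> smooth_rr g \<Longrightarrow> smooth_rr (\<lambda>x. f x - g x)"
  using smooth_add[OF _ smooth_minus, of f g] by simp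

lemma smooth_divide [smooth_intros]:
  "smooth_rr f \<Longrightarrow> smooth_rr g \<Longrightarrow> (\<And>x. g x \<noteq> 0) \<Longrightarrow> smooth_rr (\<lambda>x. f x / g x)"
  by (simp add: smooth_iff_ck divide_inverse ck_mult ck_inverse)

text \<open>Being locally equal to smooth functions passes to the derivative, since a derivative
  depends on the germ only; so this is a class for \<open>smooth_coinduct\<close>.\<close>

lemma smooth_local:
  assumes "\<And>x. \<exists>g d. d > 0 \<and> smooth_rr g \<and> (\<forall>y. \<bar>y - x\<bar> < d \<longrightarrow> f y = g y)"
  shows "smooth_rr f"
proof (rule smooth_coinduct[where P =
      "\<lambda>f. \<forall>x. \<exists>g d. d > 0 \<and> smooth_rr g \<and> (\<forall>y. \<bar>y - x\<bar> < d \<longrightarrow> f y = g y)"])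
  fix f :: "real \<Rightarrow> real"
  assume *: "\<forall>x. \<exists>g d. d > 0 \<and> smooth_rr g \<and> (\<forall>y. \<bar>y - x\<bar> < d \<longrightarrow> f y = g y)"
  have loc: "(f has_real_derivative der g y) (at y)"
    if "d > 0" "smooth_rr g" "\<forall>y. \<bar>y - x\<bar> < d \<longrightarrow> f y = g y" "\<bar>y - x\<bar> < d" for g d x y
  proof -
    have "y \<in> {x - d<..<x + d}" using that(4) by (simp add: abs_less_iff)
    then have "eventually (\<lambda>z. z \<in> {x - d<..<x + d}) (nhds y)"
      by (intro eventually_nhds_in_open) auto
    then have "eventually (\<lambda>z. f z = g z) (nhds y)"
    proof eventually_elim
      case (elim z)
      then have "\<bar>z - x\<bar> < d" by (simp add: abs_less_iff)
      then show ?case using that(3) by blast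
    qed
    then show ?thesis
      using smooth_der(1)[OF that(2), of y] DERIV_cong_ev[OF refl] by blast
  qed
  have "\<exists>g d. d > 0 \<and> smooth_rr g \<and> (\<forall>y. \<bar>y - x\<bar> < d \<longrightarrow> der f y = g y)" for x
  proof -
    obtain g d where g: "d > 0" "smooth_rr g" "\<forall>y. \<bar>y - x\<bar> < d \<longrightarrow> f y = g y" using * by blast
    have "der f y = der g y" if "\<bar>y - x\<bar> < d" for y
      using loc[OF g that] der_eq by blast
    then show ?thesis using g smooth_der(2) by blast
  qed
  moreover have "(f has_real_derivative der f x) (at x)" for x
  proof -
    obtain g d where g: "d > 0" "smooth_rr g" "\<forall>y. \<bar>y - x\<bar> < d \<longrightarrow> f y = g y" using * by blast
    have "(f has_real_derivative der g x) (at x)" using loc[OF g, of x] g(1) by simp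
    then show ?thesis using der_eq by metis
  qed
  ultimately show "\<exists>g'. (\<forall>x. (f has_real_derivative g' x) (at x)) \<and>
      (\<forall>x. \<exists>g d. d > 0 \<and> smooth_rr g \<and> (\<forall>y. \<bar>y - x\<bar> < d \<longrightarrow> g' y = g y))" by blast
qed (use assms in blast)

section \<open>Flat exponentials and smooth steps\<close>

definition flat_exp :: "nat \<Rightarrow> real \<Rightarrow> real" where
  "flat_exp k x = (if x \<le> 0 then 0 else exp (- (1 / x)) / x ^ k)"

lemma exp_lower: "(y::real) \<ge> 0 \<Longrightarrow> y ^ k / fact k \<le> exp y"
proof -
  assume y: "y \<ge> 0"
  have s: "summable (\<lambda>n. y ^ n /\<^sub>R fact n)" by (rule summable_exp_generic)
  have "(\<Sum>n\<in>{k}. y ^ n /\<^sub>R fact n) \<le> (\<Sum>n. y ^ n /\<^sub>R fact n)"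
    by (rule sum_le_suminf[OF s]) (use y in auto)
  then show ?thesis by (simp add: exp_def divide_inverse mult.commute)
qed

text \<open>One term of the exponential series at 1/x, of degree k + 2, beats the pole x^-k and
  leaves x^2, which makes the difference quotient at 0 tend to 0.\<close>

lemma flat_exp_bound: "x > 0 \<Longrightarrow> flat_exp k x \<le> fact (k + 2) * x\<^sup>2"
proof -
  assume x: "x > 0"
  have "(1/x) ^ (k + 2) / fact (k+2) \<le> exp (1/x)" by (rule exp_lower) (use x in auto)
  then have "exp (- (1/x)) \<le> fact (k+2) * x ^ (k+2)"
    using x by (simp add: exp_minus power_one_over field_simps del: fact_Suc power_Suc add_2_eq_Suc')
  then show ?thesis using x
    by (simp add: flat_exp_def field_simps power_add power2_eq_square del: fact_Suc add_2_eq_Suc')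
qed

text \<open>Allowing every power of x in the denominator makes the family closed under
  differentiation up to linear combinations, so one induction treats all its members.\<close>

lemma DERIV_flat_exp:
  "(flat_exp k has_real_derivative flat_exp (k + 2) x - k * flat_exp (k + 1) x) (at x)"
proof -
  consider "x < 0" | "x > 0" | "x = 0" by linarith
  then show ?thesis
  proof cases
    case 1
    have "eventually (\<lambda>z. z \<in> {..<0}) (nhds x)" by (rule eventually_nhds_in_open) (use 1 in auto)
    then have "eventually (\<lambda>z. flat_exp k z = 0) (nhds x)"
      by eventually_elim (auto simp: flat_exp_def)
    then have "(flat_exp k has_real_derivative 0) (at x)" by (subst DERIV_cong_ev) auto
    then show ?thesis using 1 by (simp add: flat_exp_def)
  next
    case 2
    have "eventually (\<lambda>z. z \<in> {0<..}) (nhds x)" by (rule eventually_nhds_in_open) (use 2 in auto)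
    then have ev: "eventually (\<lambda>z. flat_exp k z = exp (- (1 / z)) * inverse z ^ k) (nhds x)"
      by eventually_elim (auto simp: flat_exp_def divide_inverse power_inverse)
    have "((\<lambda>z. exp (- (1 / z)) * inverse z ^ k) has_real_derivative
        exp (- (1 / x)) * (1 / x\<^sup>2) * inverse x ^ k
        + (real k * inverse x ^ (k - 1) * (- (inverse x * inverse x))) * exp (- (1 / x))) (at x)"
      using 2 by (auto intro!: derivative_eq_intros simp: power2_eq_square divide_inverse)
    moreover have "exp (- (1 / x)) * (1 / x\<^sup>2) * inverse x ^ k
        + (real k * inverse x ^ (k - 1) * (- (inverse x * inverse x))) * exp (- (1 / x))
      = flat_exp (k + 2) x - k * flat_exp (k + 1) x"
      using 2 by (cases k) (auto simp: flat_exp_def field_simps power2_eq_square)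
    ultimately show ?thesis using ev by (subst DERIV_cong_ev) auto
  next
    case 3
    have "((\<lambda>h. (flat_exp k (0 + h) - flat_exp k 0) / h) \<longlongrightarrow> 0) (at 0)"
    proof (rule tendsto_0_le[where K = 1])
      have "norm ((flat_exp k (0 + h) - flat_exp k 0) / h) \<le> fact (k + 2) * \<bar>h\<bar>" for h
      proof (cases "h > 0")
        case True
        then have "0 \<le> flat_exp k h" by (simp add: flat_exp_def)
        with True flat_exp_bound[OF True, of k] show ?thesis
          by (simp add: flat_exp_def[of k 0] field_simps power2_eq_square)
      next
        case False
        then have "flat_exp k h = 0" by (simp add: flat_exp_def)
        moreover have "0 \<le> fact (k + 2) * \<bar>h\<bar>" by (intro mult_nonneg_nonneg) auto
        ultimately show ?thesis
          by (simp add: flat_exp_def[of k 0] del: fact_Suc add_2_eq_Suc')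
      qed
      then show "\<forall>\<^sub>F h in at 0. norm ((flat_exp k (0 + h) - flat_exp k 0) / h)
          \<le> norm (fact (k + 2) * \<bar>h\<bar> :: real) * 1"
        by (auto simp: abs_mult)
      show "((\<lambda>h. fact (k + 2) * \<bar>h\<bar> :: real) \<longlongrightarrow> 0) (at 0)"
        by (rule tendsto_eq_intros | simp)+
    qed
    then show ?thesis unfolding DERIV_def 3 by (simp add: flat_exp_def)
  qed
qed

lemma ck_flat_exp: "ck n (flat_exp k)"
proof (induction n arbitrary: k)
  case (Suc n)
  have "ck n (\<lambda>x. flat_exp (k + 2) x + (- real k) * flat_exp (k + 1) x)"
    by (intro ck_add ck_mult ck_const Suc.IH)
  with DERIV_flat_exp[of k] show ?case
    by (auto intro!: exI[of _ "\<lambda>x. flat_exp (k + 2) x - real k * flat_exp (k + 1) x"])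
qed simp

definition smooth_step :: "real \<Rightarrow> real \<Rightarrow> real \<Rightarrow> real" where
  "smooth_step a b t = flat_exp 0 (t - a) / (flat_exp 0 (t - a) + flat_exp 0 (b - t))"

lemma flat_exp0: "flat_exp 0 x \<ge> 0" "flat_exp 0 x = 0 \<longleftrightarrow> x \<le> 0"
  by (auto simp: flat_exp_def)

lemma smooth_smooth_step: "a < b \<Longrightarrow> smooth_rr (smooth_step a b)"
proof -
  assume ab: "a < b"
  have e: "smooth_rr (flat_exp 0)" by (simp add: smooth_iff_ck ck_flat_exp)
  \<comment> \<open>As a < b, one of \<open>t - a\<close> and \<open>b - t\<close> is
    positive.\<close>
  have "flat_exp 0 (t - a) + flat_exp 0 (b - t) \<noteq> 0" for t
    using flat_exp0[of "t-a"] flat_exp0[of "b-t"] ab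
    by (smt (verit, ccfv_SIG))
  then show ?thesis unfolding smooth_step_def
    by (intro smooth_intros smooth_comp[OF e]) auto
qed

lemma smooth_step_range: "0 \<le> smooth_step a b t" "smooth_step a b t \<le> 1"
proof -
  have *: "0 \<le> x / (x + y) \<and> x / (x + y) \<le> 1" if "0 \<le> x" "0 \<le> y" for x y :: real
    using that by (cases "x + y = 0") (auto simp: divide_simps)
  show "0 \<le> smooth_step a b t" "smooth_step a b t \<le> 1"
    unfolding smooth_step_def using *[OF flat_exp0(1) flat_exp0(1)] by auto
qed

lemma smooth_step_0: "t \<le> a \<Longrightarrow> smooth_step a b t = 0"
  using flat_exp0(2)[of "t - a"] by (simp add: smooth_step_def)

lemma smooth_step_1: "a < b \<Longrightarrow> b \<le> t \<Longrightarrow> smooth_step a b t = 1"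
  using flat_exp0(2)[of "b - t"] flat_exp0(2)[of "t - a"] by (simp add: smooth_step_def)

section \<open>Smoothness by finite differences\<close>

definition fd :: "real \<Rightarrow> (real \<Rightarrow> real) \<Rightarrow> real \<Rightarrow> real" where
  "fd d f x = f (x + d) - f x"

lemma fd_pow_Suc: "(fd d ^^ Suc m) f = (fd d ^^ m) (fd d f)"
  by (simp add: funpow_swap1)

lemma fd_pow_Suc_apply: "(fd d ^^ Suc m) f x = (fd d ^^ m) f (x + d) - (fd d ^^ m) f x"
  by (simp add: fd_def)

lemma fd_commute: "fd a (fd b f) = fd b (fd a f)"
  by (auto simp: fd_def algebra_simps)

lemma fd_pow_commute: "(fd a ^^ m) (fd b f) = fd b ((fd a ^^ m) f)"
  by (induction m) (auto simp: fd_commute)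

lemma fd_pow_add: "(fd d ^^ m) (\<lambda>x. f x + g x) x = (fd d ^^ m) f x + (fd d ^^ m) g x"
  by (induction m arbitrary: x) (auto simp: fd_def)

lemma fd_pow_scale: "(fd d ^^ m) (\<lambda>x. c * f x) x = c * (fd d ^^ m) f x"
  by (induction m arbitrary: x) (auto simp: fd_def algebra_simps)

lemma fd_pow_stretch: "(fd d ^^ m) (\<lambda>x. f (l * x + c)) x = (fd (l * d) ^^ m) f (l * x + c)"
proof (induction m arbitrary: x)
  case (Suc m)
  show ?case unfolding fd_pow_Suc_apply Suc by (simp add: algebra_simps)
qed simp

lemma fd_pow_tendsto:
  assumes "\<And>x. ((\<lambda>n. g n x) \<longlongrightarrow> f x) F"
  shows "((\<lambda>n. (fd d ^^ m) (g n) x) \<longlongrightarrow> (fd d ^^ m) f x) F"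
proof (induction m arbitrary: x)
  case (Suc m)
  show ?case unfolding fd_pow_Suc_apply by (intro tendsto_diff Suc)
qed (simp add: assms)

lemma fd_pow_sums:
  assumes "\<And>x. (\<lambda>n. g n x) sums f x"
  shows "(\<lambda>n. (fd d ^^ m) (g n) x) sums (fd d ^^ m) f x"
proof (induction m arbitrary: x)
  case (Suc m)
  show ?case unfolding fd_pow_Suc_apply by (intro sums_diff Suc)
qed (simp add: assms)

lemma fd_pow_bounded_family:
  assumes "\<And>x. \<exists>B. \<forall>j\<in>J. \<bar>g j x\<bar> \<le> (B::real)"
  shows "\<exists>B. \<forall>j\<in>J. \<bar>(fd d ^^ m) (g j) x\<bar> \<le> B"
proof (induction m arbitrary: x)
  case (Suc m)
  obtain B1 B2 where B: "\<forall>j\<in>J. \<bar>(fd d ^^ m) (g j) (x + d)\<bar> \<le> B1" "\<forall>j\<in>J. \<bar>(fd d ^^ m) (g j) x\<bar> \<le> B2"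
    using Suc by meson
  have "\<forall>j\<in>J. \<bar>(fd d ^^ Suc m) (g j) x\<bar> \<le> B1 + B2"
    unfolding fd_pow_Suc_apply
  proof
    fix j assume "j \<in> J"
    with B show "\<bar>(fd d ^^ m) (g j) (x + d) - (fd d ^^ m) (g j) x\<bar> \<le> B1 + B2"
      by (meson abs_triangle_ineq4 add_mono order_trans)
  qed
  then show ?case by blast
qed (use assms in simp)

text \<open>Each further difference moves the base point by the step, so the induction needs a base
  point \<open>x + c * d\<close> that depends on the step.\<close>

lemma fd_pow_isCont_step:
  assumes "\<And>x. isCont f x"
  shows "isCont (\<lambda>d. (fd d ^^ m) f (x + c * d)) d"
proof (induction m arbitrary: c)
  case 0
  show ?case by simp (intro isCont_o2[OF _ assms] continuous_intros)
next
  case (Suc m)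
  have "isCont (\<lambda>d. (fd d ^^ m) f (x + (c + 1) * d) - (fd d ^^ m) f (x + c * d)) d"
    by (intro continuous_diff Suc)
  then show ?case unfolding fd_pow_Suc_apply by (simp add: algebra_simps)
qed

lemma fd_telescope: "fd (real N * d) f x = (\<Sum>i<N. fd d f (x + real i * d))"
proof (induction N)
  case (Suc N)
  have "fd (real (Suc N) * d) f x = fd (real N * d) f x + fd d f (x + real N * d)"
    by (simp add: fd_def algebra_simps)
  then show ?case using Suc by simp
qed (simp add: fd_def)

text \<open>A difference with step N d is a sum of N differences with step d; doing this m times
  gives N^m terms, all evaluated between x and x + m N d.\<close>

lemma fd_pow_refine:
  assumes "\<And>y. x \<le> y \<Longrightarrow> y \<le> x + real m * real N * d \<Longrightarrow> \<bar>(fd d ^^ m) f y\<bar> \<le> B" and "d \<ge> 0"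
  shows "\<bar>(fd (real N * d) ^^ m) f x\<bar> \<le> real N ^ m * B"
  using assms(1)
proof (induction m arbitrary: f x B)
  case (Suc m)
  have "\<bar>(fd (real N * d) ^^ m) (fd (real N * d) f) x\<bar> \<le> real N ^ m * (real N * B)"
  proof (rule Suc.IH)
    fix y assume y: "x \<le> y" "y \<le> x + real m * real N * d"
    have "(fd d ^^ m) (fd (real N * d) f) y = (\<Sum>i<N. (fd d ^^ Suc m) f (y + real i * d))"
      unfolding fd_pow_commute fd_telescope by simp
    also have "\<bar>\<dots>\<bar> \<le> (\<Sum>i<N. B)"
    proof (rule order.trans[OF sum_abs], rule sum_mono)
      fix i assume "i \<in> {..<N}"
      then have "real i * d \<le> real N * d" using \<open>d \<ge> 0\<close> by (intro mult_right_mono) auto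
      moreover have "0 \<le> real i * d" using \<open>d \<ge> 0\<close> by simp
      ultimately show "\<bar>(fd d ^^ Suc m) f (y + real i * d)\<bar> \<le> B"
        using y by (intro Suc.prems) (auto simp: algebra_simps)
    qed
    finally show "\<bar>(fd d ^^ m) (fd (real N * d) f) y\<bar> \<le> real N * B" by simp
  qed
  then show ?case unfolding fd_pow_Suc by (simp add: mult.assoc mult.left_commute)
qed (use assms(1) in auto)

lemma smooth_shift: "smooth_rr f \<Longrightarrow> smooth_rr (\<lambda>x. f (x + c))"
  by (rule smooth_comp[of f]) (auto intro: smooth_intros)

lemma smooth_fd: "smooth_rr f \<Longrightarrow> smooth_rr (fd d f)"
  unfolding fd_def by (rule smooth_diff[OF smooth_shift])

lemma der_fd: "smooth_rr f \<Longrightarrow> der (fd d f) = fd d (der f)"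
  unfolding fd_def
  by (rule der_eqI) (intro DERIV_diff DERIV_shift[THEN iffD1] smooth_der(1))

lemma der_n_fd: "smooth_rr f \<Longrightarrow> (der ^^ n) (fd d f) = fd d ((der ^^ n) f)"
  by (induction n) (auto simp: der_fd smooth_der_n)

text \<open>Induction on m with the mean value theorem for a single difference; it works because
  \<open>der\<close> commutes with differences. Each use moves z by at most d.\<close>

lemma fd_mvt:
  assumes "smooth_rr f" "d \<ge> 0"
  shows "\<exists>z. x \<le> z \<and> z \<le> x + real m * d \<and> (fd d ^^ m) f x = d ^ m * (der ^^ m) f z"
  using assms(1)
proof (induction m arbitrary: f)
  case (Suc m)
  obtain z where z: "x \<le> z" "z \<le> x + real m * d"
      "(fd d ^^ m) (fd d f) x = d ^ m * fd d ((der ^^ m) f) z"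
    using Suc.IH[OF smooth_fd[OF Suc.prems]] der_n_fd[OF Suc.prems] by metis
  have "\<exists>w. z \<le> w \<and> w \<le> z + d \<and> fd d ((der ^^ m) f) z = d * (der ^^ Suc m) f w"
  proof (cases "d = 0")
    case False
    with \<open>d \<ge> 0\<close> have "z < z + d" by simp
    from MVT2[OF this, of "(der ^^ m) f" "der ((der ^^ m) f)"]
    show ?thesis using smooth_der(1)[OF smooth_der_n[OF Suc.prems]]
      by (auto simp: fd_def intro: less_imp_le)
  qed (auto simp: fd_def)
  then obtain w where "z \<le> w" "w \<le> z + d" "fd d ((der ^^ m) f) z = d * (der ^^ Suc m) f w" by blast
  with z show ?case unfolding fd_pow_Suc by (intro exI[of _ w]) (auto simp: algebra_simps)
qed auto

lemma smooth_bounded: "smooth_rr f \<Longrightarrow> \<exists>C. \<forall>x. \<bar>x\<bar> \<le> R \<longrightarrow> \<bar>f x\<bar> \<le> C"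
proof -
  assume f: "smooth_rr f"
  show ?thesis
  proof (cases "R \<ge> 0")
    case True
    have "\<exists>M. \<forall>x. -R \<le> x \<and> x \<le> R \<longrightarrow> \<bar>f x\<bar> \<le> M"
      by (rule isCont_bounded) (use True smooth_cont[OF f] in \<open>auto intro!: continuous_intros\<close>)
    then obtain M where "\<forall>x. -R \<le> x \<and> x \<le> R \<longrightarrow> \<bar>f x\<bar> \<le> M" ..
    then show ?thesis by (intro exI[of _ M]) (auto simp: abs_le_iff)
  qed auto
qed

section \<open>Bounded difference quotients imply smoothness\<close>

definition bfd :: "(real \<Rightarrow> real) \<Rightarrow> bool" where
  "bfd f \<longleftrightarrow> (\<forall>m R. \<exists>C. \<forall>x d. \<bar>x\<bar> \<le> R \<and> 0 < d \<and> d \<le> 1 \<longrightarrow> \<bar>(fd d ^^ m) f x\<bar> \<le> C * d ^ m)"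

lemma smooth_bfd: "smooth_rr f \<Longrightarrow> bfd f"
  unfolding bfd_def
proof (intro allI)
  fix m R assume f: "smooth_rr f"
  obtain C where C: "\<And>x. \<bar>x\<bar> \<le> R + real m \<Longrightarrow> \<bar>(der ^^ m) f x\<bar> \<le> C"
    using smooth_bounded[OF smooth_der_n[OF f]] by meson
  have "\<bar>(fd d ^^ m) f x\<bar> \<le> C * d ^ m" if that': "\<bar>x\<bar> \<le> R" "0 < d" "d \<le> 1" for x d
  proof -
    obtain z where z: "x \<le> z" "z \<le> x + real m * d" "(fd d ^^ m) f x = d ^ m * (der ^^ m) f z"
      using fd_mvt[OF f less_imp_le[OF that'(2)], of x m] by blast
    have "real m * d \<le> real m * 1" using that' by (intro mult_left_mono) auto
    then have "\<bar>z\<bar> \<le> R + real m" using that' z by linarith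
    from mult_left_mono[OF C[OF this], of "d ^ m"] show ?thesis
      using that' z by (simp add: abs_mult mult.commute)
  qed
  then show "\<exists>C. \<forall>x d. \<bar>x\<bar> \<le> R \<and> 0 < d \<and> d \<le> 1 \<longrightarrow> \<bar>(fd d ^^ m) f x\<bar> \<le> C * d ^ m" by blast
qed

text \<open>Neighbouring increments on the grid differ by a second difference, so the i-th one
  differs from the first by at most i C e^2; summing over N increments gives N^2 C e^2.\<close>

lemma fd_slope:
  fixes f :: "real \<Rightarrow> real"
  assumes C: "\<And>y. x \<le> y \<Longrightarrow> y \<le> x + real N * e \<Longrightarrow> \<bar>fd e (fd e f) y\<bar> \<le> C * e\<^sup>2" and e: "e > 0"
  shows "\<bar>fd (real N * e) f x - real N * fd e f x\<bar> \<le> C * (real N * e)\<^sup>2"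
proof -
  have C0: "C \<ge> 0"
  proof -
    have "0 \<le> C * e\<^sup>2" using C[of x] e by (meson abs_ge_zero add_increasing2 mult_nonneg_nonneg
       of_nat_0_le_iff order_refl order_trans less_imp_le)
    then show ?thesis using e by (simp add: zero_le_mult_iff)
  qed
  have s: "\<bar>fd e f (x + real i * e) - fd e f x\<bar> \<le> real i * (C * e\<^sup>2)" if "i \<le> N" for i
    using that
  proof (induction i)
    case (Suc i)
    have "\<bar>fd e (fd e f) (x + real i * e)\<bar> \<le> C * e\<^sup>2"
      using Suc.prems e by (intro C) (auto intro!: mult_right_mono)
    moreover have "fd e (fd e f) (x + real i * e) = fd e f (x + real (Suc i) * e) - fd e f (x + real i * e)"
      by (simp add: fd_def algebra_simps)
    ultimately show ?case using Suc by (simp add: algebra_simps abs_le_iff)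
  qed simp
  have "fd (real N * e) f x - real N * fd e f x = (\<Sum>i<N. fd e f (x + real i * e) - fd e f x)"
    unfolding fd_telescope by (simp add: sum_subtractf)
  also have "\<bar>\<dots>\<bar> \<le> (\<Sum>i<N. real N * (C * e\<^sup>2))"
  proof (rule order.trans[OF sum_abs], rule sum_mono)
    fix i assume "i \<in> {..<N}"
    then have "real i * (C * e\<^sup>2) \<le> real N * (C * e\<^sup>2)" using C0 by (intro mult_right_mono) auto
    with s[of i] \<open>i \<in> {..<N}\<close> show "\<bar>fd e f (x + real i * e) - fd e f x\<bar> \<le> real N * (C * e\<^sup>2)" by simp
  qed
  finally show ?thesis by (simp add: power2_eq_square algebra_simps)
qed

lemma quotient_bound:
  fixes a b :: real assumes "\<bar>a - n * b\<bar> \<le> C * (n * e)\<^sup>2" "n > 0" "e > 0"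
  shows "\<bar>a / (n * e) - b / e\<bar> \<le> C * (n * e)"
proof -
  have "a / (n * e) - b / e = (a - n * b) / (n * e)" using assms by (simp add: field_simps)
  then have "\<bar>a / (n * e) - b / e\<bar> = \<bar>a - n * b\<bar> / (n * e)" using assms by (simp add: abs_divide)
  also have "\<dots> \<le> C * (n * e)\<^sup>2 / (n * e)" using assms by (intro divide_right_mono) auto
  finally show ?thesis using assms by (simp add: power2_eq_square)
qed

text \<open>Second differences make the quotients with steps e and N e differ by O(N e), so the
  dyadic ones converge to some D. A general step d is compared with a multiple of a tiny dyadic
  step, and first differences bound the error of that rounding. Negative steps follow from a second
  difference centred at x.\<close>

lemma bfd_differentiable:
  assumes "bfd f"
  shows "\<exists>D. (f has_real_derivative D) (at x)"
proof -
  obtain L where L: "\<And>y d. \<bar>y\<bar> \<le> \<bar>x\<bar> + 2 \<Longrightarrow> 0 < d \<Longrightarrow> d \<le> 1 \<Longrightarrow> \<bar>fd d f y\<bar> \<le> L * d"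
    using assms[unfolded bfd_def, rule_format, of "\<bar>x\<bar> + 2" 1] by auto
  obtain C where C: "\<And>y d. \<bar>y\<bar> \<le> \<bar>x\<bar> + 2 \<Longrightarrow> 0 < d \<Longrightarrow> d \<le> 1 \<Longrightarrow> \<bar>fd d (fd d f) y\<bar> \<le> C * d\<^sup>2"
    using assms[unfolded bfd_def, rule_format, of "\<bar>x\<bar> + 2" 2] by (auto simp: numeral_2_eq_2)
  have C0: "0 \<le> C" using order.trans[OF abs_ge_zero C[of x 1]] by simp
  have L0: "0 \<le> L" using order.trans[OF abs_ge_zero L[of x 1]] by simp
  define q where "q d = fd d f x / d" for d
  have ql: "\<bar>q (real N * e) - q e\<bar> \<le> C * (real N * e)" if "N > 0" "e > 0" "real N * e \<le> 1" for N e
  proof -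
    have "e \<le> real N * e" using that by simp
    then have "e \<le> 1" using that by linarith
    then have "\<bar>fd (real N * e) f x - real N * fd e f x\<bar> \<le> C * (real N * e)\<^sup>2"
      using that by (intro fd_slope C) auto
    then show ?thesis unfolding q_def using that by (intro quotient_bound) auto
  qed
  have cau: "\<bar>q ((1/2) ^ n) - q ((1/2) ^ m)\<bar> \<le> C * (1/2) ^ n" if "n \<le> m" for n m
  proof -
    have "real (2 ^ (m - n)) * (1/2) ^ m = (1/2 :: real) ^ n"
      using that power_add[of "1/2::real" "m - n" n] power_add[of "2::real" "m - n" n]
      by (simp add: field_simps)
    with ql[of "2 ^ (m - n)" "(1/2) ^ m"] show ?thesis by (simp add: power_le_one)
  qed
  have "Cauchy (\<lambda>n. q ((1/2) ^ n))"
  proof (rule metric_CauchyI)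
    fix e :: real assume "e > 0"
    have "(\<lambda>n. C * (1/2) ^ n) \<longlonglongrightarrow> C * 0" by (intro tendsto_intros LIMSEQ_power_zero) auto
    then obtain M where M: "\<And>n. n \<ge> M \<Longrightarrow> \<bar>C * (1/2) ^ n\<bar> < e / 2"
      using LIMSEQ_D[of "\<lambda>n. C * (1/2) ^ n" 0 "e/2"] \<open>e > 0\<close> by auto
    have "dist (q ((1/2) ^ m)) (q ((1/2) ^ n)) < e" if "m \<ge> M" "n \<ge> M" for m n
      using cau[of M m] cau[of M n] M[of M] that unfolding dist_real_def by linarith
    then show "\<exists>M. \<forall>m\<ge>M. \<forall>n\<ge>M. dist (q ((1/2) ^ m)) (q ((1/2) ^ n)) < e" by blast
  qed
  then obtain D where D: "(\<lambda>n. q ((1/2) ^ n)) \<longlonglongrightarrow> D"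
    using Cauchy_convergent convergent_def by blast
  have qD: "\<bar>q d - D\<bar> \<le> C * d" if d: "0 < d" "d \<le> 1" for d
  proof -
    have "\<bar>q d - q e\<bar> \<le> C * d + 2 * L * e / d" if e: "0 < e" "e < d" for e
    proof -
      \<comment> \<open>\<open>N * e\<close> rounds d down to a multiple of e. The Lipschitz
        constant L pays for the remainder, which is below e, and the resulting term 2 L e / d
        disappears as e tends to 0.\<close>
      define N where "N = nat \<lfloor>d / e\<rfloor>"
      have N: "real N \<le> d / e" "d / e < real N + 1" "N > 0"
        unfolding N_def using e d by (auto simp: le_floor_iff floor_less_iff nat_less_iff of_nat_nat)
      define d' where "d' = real N * e"
      have d': "d' \<le> d" "d < d' + e" "d' > 0" using N e by (auto simp: d'_def field_simps)
      have 1: "\<bar>q d' - q e\<bar> \<le> C * d"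
        using ql[of N e] N e d d' C0 mult_left_mono[OF d'(1) C0] by (simp add: d'_def)
      have 2: "\<bar>q d - q d'\<bar> \<le> 2 * L * e / d"
      proof (cases "d = d'")
        case False
        with d' have lt: "d' < d" by simp
        have "\<bar>fd (d - d') f (x + d')\<bar> \<le> L * (d - d')"
          by (rule L) (use d d' lt in auto)
        also have "\<dots> \<le> L * e" using d' L0 by (intro mult_left_mono) auto
        finally have a: "\<bar>fd d f x - fd d' f x\<bar> \<le> L * e" by (simp add: fd_def)
        have b: "\<bar>fd d' f x\<bar> \<le> L * d'" by (rule L) (use d d' in auto)
        have "\<bar>(d' - d) * fd d' f x\<bar> \<le> e * (L * d')"
          unfolding abs_mult by (rule mult_mono) (use b d' e lt L0 in auto)
        moreover have "\<bar>d' * (fd d f x - fd d' f x)\<bar> \<le> d' * (L * e)"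
          unfolding abs_mult using a d' by (auto intro!: mult_mono)
        moreover have "d' * fd d f x - d * fd d' f x
            = d' * (fd d f x - fd d' f x) + (d' - d) * fd d' f x" by (simp add: algebra_simps)
        ultimately have "\<bar>d' * fd d f x - d * fd d' f x\<bar> \<le> 2 * L * e * d'"
          by (simp add: algebra_simps)
        moreover have "q d - q d' = (d' * fd d f x - d * fd d' f x) / (d * d')"
          using d d' by (simp add: q_def field_simps)
        ultimately have "\<bar>q d - q d'\<bar> \<le> 2 * L * e * d' / (d * d')"
          using divide_right_mono[of "\<bar>d' * fd d f x - d * fd d' f x\<bar>" "2 * L * e * d'" "d * d'"] d d'
          by (simp only: abs_divide abs_of_pos[of "d * d'"] mult_pos_pos) simp
        then show ?thesis using d d' by simp
      qed (use L0 e d in simp)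
      from 1 2 show ?thesis by linarith
    qed note ineq = this
    have pz: "(\<lambda>n. (1/2::real) ^ n) \<longlonglongrightarrow> 0" by (rule LIMSEQ_power_zero) simp
    have "eventually (\<lambda>n. (1/2::real) ^ n < d) sequentially"
      using order_tendstoD(2)[OF pz d(1)] .
    then have "eventually (\<lambda>n. \<bar>q d - q ((1/2) ^ n)\<bar> \<le> C * d + 2 * L * (1/2) ^ n / d) sequentially"
      by eventually_elim (auto intro: ineq)
    moreover have "(\<lambda>n. \<bar>q d - q ((1/2) ^ n)\<bar>) \<longlonglongrightarrow> \<bar>q d - D\<bar>" by (intro tendsto_intros D)
    moreover have "(\<lambda>n. C * d + 2 * L * (1/2) ^ n / d) \<longlonglongrightarrow> C * d + 2 * L * 0 / d"
      by (intro tendsto_intros pz) (use d in auto)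
    ultimately show ?thesis
      using tendsto_le[OF sequentially_bot] by fastforce
  qed
  \<comment> \<open>The factor 2: one C |h| for the limit of the right quotients, one for passing
    from the right to the left quotient.\<close>
  have main: "\<bar>(f (x + h) - f x) / h - D\<bar> \<le> 2 * C * \<bar>h\<bar>" if h: "h \<noteq> 0" "\<bar>h\<bar> \<le> 1" for h
  proof (cases "h > 0")
    case True
    then show ?thesis using qD[of h] h mult_nonneg_nonneg[OF C0, of h] by (simp add: q_def fd_def)
  next
    case False
    define d where "d = - h"
    have d: "0 < d" "d \<le> 1" using False h by (auto simp: d_def)
    have "\<bar>fd d (fd d f) (x - d)\<bar> \<le> C * d\<^sup>2" by (rule C) (use d in auto)
    then have "\<bar>(f (x + d) - f x) - (f x - f (x - d))\<bar> / d \<le> C * d\<^sup>2 / d"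
      using d by (intro divide_right_mono) (auto simp: fd_def)
    then have "\<bar>((f (x + d) - f x) - (f x - f (x - d))) / d\<bar> \<le> C * d"
      using d by (simp add: abs_divide power2_eq_square)
    then have "\<bar>q d - (f x - f (x - d)) / d\<bar> \<le> C * d"
      by (simp add: q_def fd_def diff_divide_distrib add_divide_distrib)
    moreover have "(f (x + h) - f x) / h = (f x - f (x - d)) / d"
      using d by (simp add: d_def field_simps)
    ultimately show ?thesis using qD[OF d] d by (simp add: d_def abs_le_iff)
  qed
  have "((\<lambda>h. (f (x + h) - f x) / h - D) \<longlongrightarrow> 0) (at 0)"
  proof (rule tendsto_0_le[where K = 1])
    show "((\<lambda>h. 2 * C * \<bar>h\<bar>) \<longlongrightarrow> 0) (at 0)" by (rule tendsto_eq_intros | simp)+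
    have "eventually (\<lambda>h. h \<noteq> 0 \<and> \<bar>h\<bar> \<le> (1::real)) (at 0)"
      unfolding eventually_at by (auto intro!: exI[of _ 1])
    then show "\<forall>\<^sub>F h in at 0. norm ((f (x + h) - f x) / h - D) \<le> norm (2 * C * \<bar>h\<bar>) * 1"
      by eventually_elim (use main C0 in \<open>auto simp: abs_mult\<close>)
  qed
  from LIM_zero_cancel[OF this] show ?thesis unfolding DERIV_def by (rule exI)
qed

text \<open>The difference quotients of f with step e / (n + 1) tend to the derivative. As this step
  divides e, \<open>fd_pow_refine\<close> bounds their m-th differences with step e by differences
  of f of order m + 1, and the bound C e^m survives the limit.\<close>

lemma bfd_smooth: "bfd f \<Longrightarrow> smooth_rr f"
proof (rule smooth_coinduct[where P = bfd])
  fix f assume f: "bfd f"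
  have d: "(f has_real_derivative der f x) (at x)" for x
    using bfd_differentiable[OF f] der_eq by metis
  have "bfd (der f)" unfolding bfd_def
  proof (intro allI)
    fix m R
    obtain C where C: "\<And>y d. \<bar>y\<bar> \<le> R + real m \<Longrightarrow> 0 < d \<Longrightarrow> d \<le> 1 \<Longrightarrow> \<bar>(fd d ^^ Suc m) f y\<bar> \<le> C * d ^ Suc m"
      using f[unfolded bfd_def, rule_format, of "R + real m" "Suc m"] by blast
    have "\<bar>(fd e ^^ m) (der f) x\<bar> \<le> C * e ^ m" if x: "\<bar>x\<bar> \<le> R" "0 < e" "e \<le> 1" for x e
    proof -
      define \<eta> where "\<eta> n = e / real (Suc n)" for n
      have \<eta>: "0 < \<eta> n" "\<eta> n \<le> 1" "real (Suc n) * \<eta> n = e" for n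
        using x by (auto simp: \<eta>_def divide_le_eq)
      have "\<bar>(fd e ^^ m) (\<lambda>y. fd (\<eta> n) f y / \<eta> n) x\<bar> \<le> C * e ^ m" for n
      proof -
        have "\<bar>(fd (real (Suc n) * \<eta> n) ^^ m) (fd (\<eta> n) f) x\<bar> \<le> real (Suc n) ^ m * (C * \<eta> n ^ Suc m)"
        proof (rule fd_pow_refine)
          fix y assume y: "x \<le> y" "y \<le> x + real m * real (Suc n) * \<eta> n"
          have "real m * real (Suc n) * \<eta> n \<le> real m * 1"
            unfolding mult.assoc \<eta> by (intro mult_left_mono x) auto
          then have "\<bar>y\<bar> \<le> R + real m" using x y by linarith
          from C[OF this \<eta>(1,2)] show "\<bar>(fd (\<eta> n) ^^ m) (fd (\<eta> n) f) y\<bar> \<le> C * \<eta> n ^ Suc m"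
            unfolding fd_pow_Suc .
        qed (use \<eta>(1)[of n] in simp)
        also have "real (Suc n) ^ m * (C * \<eta> n ^ Suc m) = C * (real (Suc n) * \<eta> n) ^ m * \<eta> n"
          by (simp add: power_mult_distrib algebra_simps del: of_nat_Suc)
        finally have "\<bar>(fd e ^^ m) (fd (\<eta> n) f) x\<bar> \<le> C * e ^ m * \<eta> n" unfolding \<eta> .
        then have "\<bar>(fd e ^^ m) (fd (\<eta> n) f) x\<bar> / \<eta> n \<le> C * e ^ m"
          using \<eta>(1)[of n] by (simp add: divide_le_eq)
        moreover have "(fd e ^^ m) (\<lambda>y. fd (\<eta> n) f y / \<eta> n) x = (fd e ^^ m) (fd (\<eta> n) f) x / \<eta> n"
          using fd_pow_scale[of m e "1 / \<eta> n"] by simp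
        ultimately show ?thesis using \<eta>(1)[of n] by (simp add: abs_divide)
      qed
      moreover have "(\<lambda>n. \<bar>(fd e ^^ m) (\<lambda>y. fd (\<eta> n) f y / \<eta> n) x\<bar>) \<longlonglongrightarrow> \<bar>(fd e ^^ m) (der f) x\<bar>"
      proof (intro tendsto_rabs fd_pow_tendsto)
        fix y
        have "filterlim \<eta> (at 0) sequentially"
        proof (rule filterlim_atI)
          have "(\<lambda>n. e * (1 / real (Suc n))) \<longlonglongrightarrow> e * 0"
            by (intro tendsto_intros LIMSEQ_Suc lim_1_over_n)
          then show "\<eta> \<longlonglongrightarrow> 0" by (simp add: \<eta>_def[abs_def])
          show "\<forall>\<^sub>F n in sequentially. \<eta> n \<noteq> 0" using \<eta>(1) by (auto intro!: always_eventually less_imp_neq[symmetric])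
        qed
        from filterlim_compose[OF d[of y, unfolded DERIV_def] this]
        show "(\<lambda>n. fd (\<eta> n) f y / \<eta> n) \<longlonglongrightarrow> der f y" by (simp add: fd_def)
      qed
      ultimately show ?thesis by (intro LIMSEQ_le_const2) auto
    qed
    then show "\<exists>C. \<forall>x d. \<bar>x\<bar> \<le> R \<and> 0 < d \<and> d \<le> 1 \<longrightarrow> \<bar>(fd d ^^ m) (der f) x\<bar> \<le> C * d ^ m" by blast
  qed
  with d show "\<exists>g'. (\<forall>x. (f has_real_derivative g' x) (at x)) \<and> bfd g'" by blast
qed

text \<open>Difference bounds that are uniform in n are inherited by sums with absolutely summable
  weights; this replaces termwise differentiation.\<close>

lemma smooth_series:
  assumes a: "summable (\<lambda>n. \<bar>a n\<bar>)"
    and G: "\<And>j R. \<exists>C. \<forall>n v e. \<bar>v\<bar> \<le> R \<and> 0 < e \<and> e \<le> 1 \<longrightarrow> \<bar>(fd e ^^ j) (G n) v\<bar> \<le> C * e ^ j"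
  shows "(\<lambda>n. a n * G n v) sums (\<Sum>n. a n * G n v)" "smooth_rr (\<lambda>v. \<Sum>n. a n * G n v)"
proof -
  have sb: "summable (\<lambda>n. \<bar>a n * b n\<bar>) \<and> \<bar>\<Sum>n. a n * b n\<bar> \<le> (\<Sum>n. \<bar>a n\<bar>) * B"
    if "\<And>n. \<bar>b n\<bar> \<le> B" for b B
  proof -
    have le: "\<bar>a n * b n\<bar> \<le> \<bar>a n\<bar> * B" for n using that by (simp add: abs_mult mult_left_mono)
    have s: "summable (\<lambda>n. \<bar>a n\<bar> * B)" using a by (rule summable_mult2)
    have s2: "summable (\<lambda>n. \<bar>a n * b n\<bar>)"
      by (rule summable_comparison_test'[OF s, of 0]) (use le in auto)
    have "\<bar>\<Sum>n. a n * b n\<bar> \<le> (\<Sum>n. \<bar>a n * b n\<bar>)" by (rule summable_rabs[OF s2])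
    also have "\<dots> \<le> (\<Sum>n. \<bar>a n\<bar> * B)" by (rule suminf_le[OF le s2 s])
    also have "\<dots> = (\<Sum>n. \<bar>a n\<bar>) * B" using suminf_mult2[OF a] by simp
    finally show ?thesis using s2 by simp
  qed
  have sums: "(\<lambda>n. a n * G n v) sums (\<Sum>n. a n * G n v)" for v
  proof -
    obtain C where C: "\<forall>n w e. \<bar>w\<bar> \<le> \<bar>v\<bar> \<and> 0 < e \<and> e \<le> 1 \<longrightarrow> \<bar>(fd e ^^ 0) (G n) w\<bar> \<le> C * e ^ 0"
      using G[of "\<bar>v\<bar>" 0] by auto
    have "\<bar>G n v\<bar> \<le> C" for n using C[rule_format, of v 1 n] by simp
    then show ?thesis using sb[of "\<lambda>n. G n v" C] summable_rabs_cancel summable_sums by metis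
  qed
  then show "(\<lambda>n. a n * G n v) sums (\<Sum>n. a n * G n v)" .
  show "smooth_rr (\<lambda>v. \<Sum>n. a n * G n v)"
  proof (rule bfd_smooth, unfold bfd_def, intro allI)
    fix j R
    obtain C where C: "\<And>n v e. \<bar>v\<bar> \<le> R \<Longrightarrow> 0 < e \<Longrightarrow> e \<le> 1 \<Longrightarrow> \<bar>(fd e ^^ j) (G n) v\<bar> \<le> C * e ^ j"
      using G[of R j] by blast
    have "\<bar>(fd e ^^ j) (\<lambda>v. \<Sum>n. a n * G n v) x\<bar> \<le> (\<Sum>n. \<bar>a n\<bar>) * C * e ^ j"
      if "\<bar>x\<bar> \<le> R" "0 < e" "e \<le> 1" for x e
    proof -
      have "(\<lambda>n. (fd e ^^ j) (\<lambda>v. a n * G n v) x) sums (fd e ^^ j) (\<lambda>v. \<Sum>n. a n * G n v) x"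
        by (rule fd_pow_sums) (rule sums)
      then have "(fd e ^^ j) (\<lambda>v. \<Sum>n. a n * G n v) x = (\<Sum>n. a n * (fd e ^^ j) (G n) x)"
        unfolding fd_pow_scale by (simp add: sums_iff)
      then show ?thesis using sb[of "\<lambda>n. (fd e ^^ j) (G n) x"] C[OF that] by (simp add: mult.assoc)
    qed
    then show "\<exists>C. \<forall>x d. \<bar>x\<bar> \<le> R \<and> 0 < d \<and> d \<le> 1 \<longrightarrow> \<bar>(fd d ^^ j) (\<lambda>v. \<Sum>n. a n * G n v) x\<bar> \<le> C * d ^ j"
      by blast
  qed
qed

section \<open>Functions that are smooth along curves\<close>

text \<open>Smoothness in the plane as Froelicher spaces see it, tested along smooth plane curves.
  By Boman's theorem this is ordinary smoothness, but only difference bounds are extracted from it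
  here.\<close>

definition nice :: "(real \<Rightarrow> real \<Rightarrow> real) \<Rightarrow> bool" where
  "nice k \<longleftrightarrow> (\<forall>s t. smooth_rr s \<longrightarrow> smooth_rr t \<longrightarrow> smooth_rr (\<lambda>r. k (s r) (t r)))"

lemma der_n_local:
  assumes "smooth_rr f" "smooth_rr g" "\<And>y. \<bar>y - x\<bar> < d \<Longrightarrow> f y = g y" "\<bar>y - x\<bar> < d"
  shows "(der ^^ n) f y = (der ^^ n) g y"
  using assms
proof (induction n arbitrary: f g y)
  case (Suc n)
  have "der f y = der g y" if y: "\<bar>y - x\<bar> < d" for y
  proof -
    have "y \<in> {x - d<..<x + d}" using y by (simp add: abs_less_iff)
    then have "eventually (\<lambda>z. z \<in> {x - d<..<x + d}) (nhds y)"
      by (intro eventually_nhds_in_open) auto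
    then have "eventually (\<lambda>z. f z = g z) (nhds y)"
    proof eventually_elim
      case (elim z)
      then have "\<bar>z - x\<bar> < d" by (simp add: abs_less_iff)
      then show ?case by (rule Suc.prems(3))
    qed
    then have "(f has_real_derivative der g y) (at y)"
      using smooth_der(1)[OF Suc.prems(2), of y] DERIV_cong_ev[OF refl] by blast
    then show ?thesis by (rule der_eq)
  qed
  from Suc.IH[OF smooth_der(2)[OF Suc.prems(1)] smooth_der(2)[OF Suc.prems(2)] this Suc.prems(4)]
  show ?case by (simp add: funpow_swap1)
qed simp

lemma smooth_affine: "smooth_rr f \<Longrightarrow> smooth_rr (\<lambda>x. f (c * x + b))"
  by (rule smooth_comp[of f], assumption, intro smooth_intros)

lemma der_n_affine:
  assumes "smooth_rr f"
  shows "(der ^^ n) (\<lambda>x. f (c * x + b)) = (\<lambda>x. c ^ n * (der ^^ n) f (c * x + b))"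
proof (induction n)
  case (Suc n)
  have "((\<lambda>x. c ^ n * (der ^^ n) f (c * x + b)) has_real_derivative c ^ Suc n * (der ^^ Suc n) f (c * x + b)) (at x)" for x
  proof -
    have "((\<lambda>x. (der ^^ n) f (c * x + b)) has_real_derivative der ((der ^^ n) f) (c * x + b) * c) (at x)"
      by (rule DERIV_chain2[OF smooth_der(1)[OF smooth_der_n[OF assms]]])
         (auto intro!: derivative_eq_intros)
    from DERIV_cmult[OF this, of "c ^ n"] show ?thesis by (simp add: mult_ac)
  qed
  then show ?case using Suc der_eqI by simp
qed simp

text \<open>The bound covers all x and all steps, also those above 1: rescaling a narrow bump
  enlarges the step by an unbounded factor.\<close>

lemma compact_support_fd_bound:
  assumes f: "smooth_rr f" and z: "\<And>x. \<bar>x\<bar> \<ge> 1 \<Longrightarrow> f x = 0"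
  shows "\<exists>C\<ge>0. \<forall>x d. d > 0 \<longrightarrow> \<bar>(fd d ^^ j) f x\<bar> \<le> C * d ^ j"
proof -
  obtain C where C: "\<And>x. \<bar>x\<bar> \<le> 1 \<Longrightarrow> \<bar>(der ^^ j) f x\<bar> \<le> C" using smooth_bounded[OF smooth_der_n[OF f]] by meson
  have C0: "0 \<le> C" using order.trans[OF abs_ge_zero C[of 0]] by simp
  have z0: "(der ^^ n) (\<lambda>x. 0) y = 0" for n y
  proof -
    have "(der ^^ n) (\<lambda>x. 0) = (\<lambda>x. 0)" by (induction n) (auto intro!: der_eqI)
    then show ?thesis by simp
  qed
  have "\<bar>(der ^^ j) f x\<bar> \<le> C" for x
  proof (cases "\<bar>x\<bar> \<le> 1")
    case False
    have "(der ^^ j) f x = (der ^^ j) (\<lambda>x. 0) x"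
      by (rule der_n_local[OF f smooth_const, of x "\<bar>x\<bar> - 1"]) (use False z in auto)
    then show ?thesis using C0 z0 by simp
  qed (use C in auto)
  note bd = this
  have "\<bar>(fd d ^^ j) f x\<bar> \<le> C * d ^ j" if d: "d > 0" for x d
  proof -
    obtain w where "(fd d ^^ j) f x = d ^ j * (der ^^ j) f w" using fd_mvt[OF f less_imp_le[OF d], of x j] by blast
    then show ?thesis using mult_left_mono[OF bd[of w], of "d ^ j"] d by (simp add: abs_mult mult.commute)
  qed
  with C0 show ?thesis by blast
qed

section \<open>Special curves\<close>

definition bump :: "real \<Rightarrow> real" where
  "bump x = smooth_step (-1) (-1/2) x * (1 - smooth_step (1/2) 1 x)"

lemma smooth_bump: "smooth_rr bump"
  unfolding bump_def by (intro smooth_intros smooth_smooth_step) auto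

lemma bump_0: "\<bar>x\<bar> \<ge> 1 \<Longrightarrow> bump x = 0"
  by (cases "x \<le> -1") (auto simp: bump_def smooth_step_0 smooth_step_1)

lemma bump_1: "\<bar>x\<bar> \<le> 1/2 \<Longrightarrow> bump x = 1"
  by (auto simp: bump_def smooth_step_0 smooth_step_1)

text \<open>Fast enough that the rescaled bumps below, whose \<open>j\<close>-th derivatives grow like \<open>2 ^ ((n + 3) * j)\<close>,
  still sum up to a smooth curve.\<close>
definition sc_rate :: "nat \<Rightarrow> real" where "sc_rate n = 1 / (2 ^ (n + 3)) ^ n"

lemma sc_rate_pos: "sc_rate n > 0" by (simp add: sc_rate_def)

text \<open>The n-th bump is centred at 2^-n and has radius 2^-(n+3), so near 2^-n all other bumps
  vanish.\<close>

lemma special_curve_separated: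
  fixes m n :: nat and r :: real
  assumes "m \<noteq> n" "\<bar>r\<bar> < (1/2) ^ (n + 4)"
  shows "\<bar>2 ^ (m + 3) * ((1/2) ^ n + r - (1/2) ^ m)\<bar> \<ge> 1"
proof (cases "m < n")
  case True
  have "(1/2::real) ^ n \<le> (1/2) ^ (m + 1)" by (rule power_decreasing) (use True in auto)
  moreover have "(1/2::real) ^ (n + 4) \<le> (1/2) ^ (m + 5)" by (rule power_decreasing) (use True in auto)
  ultimately have "(1/2) ^ m - ((1/2) ^ n + r) \<ge> (1/2) ^ (m + 3)" using assms(2) by (simp add: power_add power_one_over)
  then have "2 ^ (m + 3) * ((1/2) ^ m - ((1/2) ^ n + r)) \<ge> 2 ^ (m + 3) * (1/2) ^ (m + 3)" by (intro mult_left_mono) auto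
  then show ?thesis by (simp add: power_one_over algebra_simps)
next
  case False
  have "(1/2::real) ^ m \<le> (1/2) ^ (n + 1)" by (rule power_decreasing) (use False assms in auto)
  then have "(1/2) ^ n + r - (1/2) ^ m \<ge> (1/2) ^ (n + 3)" using assms(2) by (simp add: power_add power_one_over)
  moreover have "(1/2::real) ^ (m + 3) \<le> (1/2) ^ (n + 3)" by (rule power_decreasing) (use False in auto)
  ultimately have "(1/2) ^ (m + 3) \<le> (1/2) ^ n + r - (1/2) ^ m" by linarith
  then have "2 ^ (m + 3) * ((1/2) ^ n + r - (1/2) ^ m) \<ge> 2 ^ (m + 3) * (1/2) ^ (m + 3)" by (intro mult_left_mono) auto
  then show ?thesis by (simp add: power_one_over)
qed

text \<open>The special curve lemma: a sequence that converges fast enough lies on a smooth curve,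
  at the times 2^-n, here with prescribed velocities too. Near 2^-n the curve is affine, so
  derivatives of any order along it are directional derivatives up to a power of
  \<open>sc_rate n\<close>.\<close>

lemma special_curve:
  assumes u: "\<And>n. \<bar>u n - u0\<bar> \<le> sc_rate n" and x: "\<And>n. \<bar>x n\<bar> \<le> 1"
  shows "\<exists>s. smooth_rr s \<and> (\<forall>n r. \<bar>r\<bar> < (1/2) ^ (n + 4) \<longrightarrow> s ((1/2) ^ n + r) = u n + sc_rate n * r * x n)"
proof -
  define l :: "nat \<Rightarrow> real" where "l n = 2 ^ (n + 3)" for n
  have l1: "l n \<ge> 1" "l n > 0" for n by (auto simp: l_def)
  have le: "l n ^ n * sc_rate n = 1" for n by (simp add: sc_rate_def l_def)
  define xi :: "real \<Rightarrow> real" where "xi z = z * bump z" for z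
  have sxi: "smooth_rr xi" unfolding xi_def by (intro smooth_intros smooth_bump)
  \<comment> \<open>The factor 2^n cancels the weight (1/2)^n of the series below. The weights make
    \<open>smooth_series\<close> applicable, and the fast decay has to beat this factor too.\<close>
  define G where "G n z = 2 ^ n * ((u n - u0) * bump (l n * z + - (l n * (1/2) ^ n))
      + (sc_rate n * x n / l n) * xi (l n * z + - (l n * (1/2) ^ n)))" for n z
  have bounds: "\<exists>C. \<forall>n v e. \<bar>v\<bar> \<le> R \<and> 0 < e \<and> e \<le> 1 \<longrightarrow> \<bar>(fd e ^^ j) (G n) v\<bar> \<le> C * e ^ j" for j and R :: real
  proof -
    obtain C1 where C1: "C1 \<ge> 0" "\<And>x d. d > 0 \<Longrightarrow> \<bar>(fd d ^^ j) bump x\<bar> \<le> C1 * d ^ j"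
      using compact_support_fd_bound[OF smooth_bump bump_0] by blast
    obtain C2 where C2: "C2 \<ge> 0" "\<And>x d. d > 0 \<Longrightarrow> \<bar>(fd d ^^ j) xi x\<bar> \<le> C2 * d ^ j"
      using compact_support_fd_bound[OF sxi, of j] bump_0 by (auto simp: xi_def)
    have "\<bar>(fd e ^^ j) (G n) v\<bar> \<le> l j ^ Suc j * (C1 + C2) * e ^ j" if e: "0 < e" for n v e
    proof -
      let ?w = "l n * v + - (l n * (1/2) ^ n)"
      have eq: "(fd e ^^ j) (G n) v = 2 ^ n * ((u n - u0) * (fd (l n * e) ^^ j) bump ?w
          + (sc_rate n * x n / l n) * (fd (l n * e) ^^ j) xi ?w)"
        unfolding G_def fd_pow_scale fd_pow_add fd_pow_stretch ..
      have p: "l n * e > 0" using e l1 by simp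
      have a: "\<bar>(u n - u0) * (fd (l n * e) ^^ j) bump ?w\<bar> \<le> sc_rate n * (C1 * (l n * e) ^ j)"
        unfolding abs_mult using sc_rate_pos[of n] by (intro mult_mono u C1 p) auto
      have "\<bar>sc_rate n * x n / l n\<bar> \<le> sc_rate n * 1 / 1"
        unfolding abs_divide abs_mult using x[of n] sc_rate_pos[of n] l1[of n] by (intro frac_le mult_mono) auto
      then have b: "\<bar>(sc_rate n * x n / l n) * (fd (l n * e) ^^ j) xi ?w\<bar> \<le> sc_rate n * (C2 * (l n * e) ^ j)"
        unfolding abs_mult[of "sc_rate n * x n / l n"] using sc_rate_pos[of n] by (intro mult_mono C2 p) auto
      have "\<bar>(fd e ^^ j) (G n) v\<bar> \<le> 2 ^ n * (sc_rate n * (C1 * (l n * e) ^ j) + sc_rate n * (C2 * (l n * e) ^ j))"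
        unfolding eq abs_mult[of "2 ^ n"] using order.trans[OF abs_triangle_ineq add_mono[OF a b]] by simp
      also have "\<dots> = (2 ^ n * l n ^ j * sc_rate n) * ((C1 + C2) * e ^ j)" by (simp add: power_mult_distrib algebra_simps)
      \<comment> \<open>Since \<open>2 ^ n \<le> l n\<close>, the first factor is at most
        \<open>l n ^ Suc j / l n ^ n\<close>: at most 1 for n > j, and bounded by the monotonicity
        of l for n \<le> j.\<close>
      also have "\<dots> \<le> l j ^ Suc j * ((C1 + C2) * e ^ j)"
      proof (rule mult_right_mono)
        have "2 ^ n * l n ^ j * sc_rate n \<le> l n * l n ^ j * sc_rate n"
          using sc_rate_pos[of n] by (intro mult_right_mono) (auto simp: l_def power_add)
        also have "\<dots> \<le> l j ^ Suc j"
        proof (cases "n \<le> j")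
          case True
          then have "l n \<le> l j" unfolding l_def by (intro power_increasing) auto
          then have "l n ^ Suc j \<le> l j ^ Suc j" using l1[of n] by (intro power_mono) auto
          moreover have "sc_rate n \<le> 1" unfolding sc_rate_def by (simp add: divide_le_eq)
          ultimately have "l n ^ Suc j * sc_rate n \<le> l j ^ Suc j * 1"
            using l1[of j] sc_rate_pos[of n] by (intro mult_mono) auto
          then show ?thesis by simp
        next
          case False
          have "l n ^ Suc j * sc_rate n \<le> l n ^ n * sc_rate n"
            using False l1[of n] sc_rate_pos[of n] by (intro mult_right_mono power_increasing) auto
          also have "\<dots> \<le> l j ^ Suc j" unfolding le using l1(1)[of j] by (rule one_le_power)
          finally show ?thesis by simp
        qed
        finally show "2 ^ n * l n ^ j * sc_rate n \<le> l j ^ Suc j" .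
      qed (use C1 C2 e in auto)
      finally show ?thesis by (simp add: mult.assoc)
    qed
    then show ?thesis by blast
  qed
  have "summable (\<lambda>n. \<bar>(1/2::real) ^ n\<bar>)" by (simp add: summable_geometric)
  note ser = smooth_series[OF this bounds]
  define s where "s z = u0 + (\<Sum>n. (1/2) ^ n * G n z)" for z
  have "smooth_rr s" unfolding s_def by (intro smooth_add smooth_const ser)
  moreover have "s ((1/2) ^ n + r) = u n + sc_rate n * r * x n" if r: "\<bar>r\<bar> < (1/2) ^ (n + 4)" for n r
  proof -
    have o: "G m ((1/2) ^ n + r) = 0" if "m \<noteq> n" for m
    proof -
      have "\<bar>l m * ((1/2) ^ n + r) + - (l m * (1/2) ^ m)\<bar> \<ge> 1"
        using special_curve_separated[OF that r] by (simp add: l_def algebra_simps)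
      then show ?thesis by (simp add: G_def xi_def bump_0)
    qed
    \<comment> \<open>The argument stays where \<open>bump\<close> equals 1, which makes the curve
      affine there.\<close>
    have lr: "\<bar>l n * r\<bar> \<le> 1/2"
    proof -
      have "\<bar>l n * r\<bar> \<le> 2 ^ (n + 3) * (1/2) ^ (n + 4)"
        unfolding abs_mult l_def using r by (intro mult_mono) auto
      then show ?thesis by (simp add: power_add power_one_over)
    qed
    have arg: "l n * ((1/2) ^ n + r) + - (l n * (1/2) ^ n) = l n * r" by (simp add: algebra_simps)
    have "(\<Sum>m. (1/2) ^ m * G m ((1/2) ^ n + r)) = (\<Sum>m\<in>{n}. (1/2) ^ m * G m ((1/2) ^ n + r))"
      by (rule suminf_finite) (use o in auto)
    also have "\<dots> = (u n - u0) + sc_rate n * x n / l n * (l n * r)"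
      by (simp only: sum.insert_remove finite.emptyI sum.empty Diff_empty empty_Diff G_def arg xi_def bump_1[OF lr])
        (simp add: power_one_over)
    finally show ?thesis using l1(2)[of n] by (simp add: s_def)
  qed
  ultimately show ?thesis by blast
qed

section \<open>Directional derivatives of functions smooth along curves\<close>

definition dder :: "(real \<Rightarrow> real \<Rightarrow> real) \<Rightarrow> nat \<Rightarrow> real \<Rightarrow> real \<Rightarrow> real \<Rightarrow> real \<Rightarrow> real" where
  "dder k M u v x y = (der ^^ M) (\<lambda>r. k (u + r * x) (v + r * y)) 0"

lemma nice_line: "nice k \<Longrightarrow> smooth_rr (\<lambda>r. k (u + r * x) (v + r * y))"
proof -
  have "smooth_rr (\<lambda>r. c + r * d)" for c d by (intro smooth_intros)
  moreover assume "nice k"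
  ultimately show ?thesis unfolding nice_def by simp
qed

text \<open>Points where the directional derivatives are too large could be chosen converging fast
  to \<open>(u0, v0)\<close>. A special curve through them, moving in the bad directions, turns them
  into large M-th derivatives of one smooth function on a bounded interval.\<close>

lemma dder_local_bound:
  assumes k: "nice k"
  shows "\<exists>\<rho>>0. \<exists>C. \<forall>u v x y. \<bar>u - u0\<bar> < \<rho> \<and> \<bar>v - v0\<bar> < \<rho> \<and> \<bar>x\<bar> \<le> 1 \<and> \<bar>y\<bar> \<le> 1 \<longrightarrow> \<bar>dder k M u v x y\<bar> \<le> C"
proof (rule ccontr)
  assume "\<not> ?thesis"
  \<comment> \<open>The curve passes the n-th point at a speed scaled by \<open>sc_rate n\<close>,
    which scales the M-th derivative by \<open>sc_rate n ^ M\<close>; the threshold compensates for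
    it.\<close>
  then have "\<exists>u v x y. \<bar>u - u0\<bar> < sc_rate n \<and> \<bar>v - v0\<bar> < sc_rate n \<and> \<bar>x\<bar> \<le> 1 \<and> \<bar>y\<bar> \<le> 1 \<and>
      \<bar>dder k M u v x y\<bar> > real n / sc_rate n ^ M" for n
  proof -
    have "\<not> (\<forall>u v x y. \<bar>u - u0\<bar> < sc_rate n \<and> \<bar>v - v0\<bar> < sc_rate n \<and> \<bar>x\<bar> \<le> 1 \<and> \<bar>y\<bar> \<le> 1 \<longrightarrow>
      \<bar>dder k M u v x y\<bar> \<le> real n / sc_rate n ^ M)"
      using \<open>\<not> _\<close> sc_rate_pos[of n] by blast
    then show ?thesis by (simp add: not_le conj_assoc)
  qed
  then obtain u v x y where uv: "\<And>n. \<bar>u n - u0\<bar> < sc_rate n" "\<And>n. \<bar>v n - v0\<bar> < sc_rate n"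
      "\<And>n. \<bar>x n\<bar> \<le> 1" "\<And>n. \<bar>y n\<bar> \<le> 1" "\<And>n. \<bar>dder k M (u n) (v n) (x n) (y n)\<bar> > real n / sc_rate n ^ M"
    by metis
  obtain s where s: "smooth_rr s" "\<And>n r. \<bar>r\<bar> < (1/2) ^ (n + 4) \<Longrightarrow> s ((1/2) ^ n + r) = u n + sc_rate n * r * x n"
    using special_curve[of u u0 x] uv less_imp_le by metis
  obtain t where t: "smooth_rr t" "\<And>n r. \<bar>r\<bar> < (1/2) ^ (n + 4) \<Longrightarrow> t ((1/2) ^ n + r) = v n + sc_rate n * r * y n"
    using special_curve[of v v0 y] uv less_imp_le by metis
  define g where "g r = k (s r) (t r)" for r
  have g: "smooth_rr g" using k s(1) t(1) unfolding g_def nice_def by blast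
  have val: "(der ^^ M) g ((1/2) ^ n) = sc_rate n ^ M * dder k M (u n) (v n) (x n) (y n)" for n
  proof -
    define h where "h r = k (u n + r * x n) (v n + r * y n)" for r
    have h: "smooth_rr h" unfolding h_def by (rule nice_line[OF k])
    have "(der ^^ M) (\<lambda>r. g (1 * r + (1/2) ^ n)) 0 = (der ^^ M) (\<lambda>r. h (sc_rate n * r + 0)) 0"
    proof (rule der_n_local[OF smooth_affine[OF g] smooth_affine[OF h], of 0 "(1/2) ^ (n + 4)"])
      fix r :: real assume "\<bar>r - 0\<bar> < (1/2) ^ (n + 4)"
      then show "g (1 * r + (1/2) ^ n) = h (sc_rate n * r + 0)"
        using s(2)[of r n] t(2)[of r n] by (simp add: g_def h_def add.commute mult.commute)
    qed simp
    then show ?thesis unfolding der_n_affine[OF g] der_n_affine[OF h] by (simp add: dder_def h_def[abs_def])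
  qed
  obtain B where B: "\<And>r. \<bar>r\<bar> \<le> 1 \<Longrightarrow> \<bar>(der ^^ M) g r\<bar> \<le> B"
    using smooth_bounded[OF smooth_der_n[OF g]] by meson
  obtain n :: nat where n: "real n > B" using reals_Archimedean2 by blast
  have "real n < sc_rate n ^ M * \<bar>dder k M (u n) (v n) (x n) (y n)\<bar>"
    using uv(5)[of n] sc_rate_pos[of n] by (simp add: divide_less_eq mult.commute)
  also have "\<dots> = \<bar>(der ^^ M) g ((1/2) ^ n)\<bar>" unfolding val using sc_rate_pos[of n] by (simp add: abs_mult)
  also have "\<dots> \<le> B" by (rule B) (simp add: power_le_one)
  finally show False using n by simp
qed

lemma bounded_subseq:
  fixes x :: "nat \<Rightarrow> real" assumes "\<And>n. \<bar>x n\<bar> \<le> R"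
  shows "\<exists>f l. strict_mono f \<and> (\<lambda>n. x (f n)) \<longlonglongrightarrow> l"
proof -
  obtain f where f: "strict_mono f" "monoseq (\<lambda>n. x (f n))" using seq_monosub by blast
  have "Bseq (\<lambda>n. x (f n))" by (rule BseqI'[of _ R]) (use assms in auto)
  from Bseq_monoseq_convergent[OF this f(2)] show ?thesis using f(1) unfolding convergent_def by blast
qed

text \<open>Sequential compactness of the square turns the local bounds into a single one.\<close>

lemma dder_bound:
  assumes k: "nice k"
  shows "\<exists>C. \<forall>u v x y. \<bar>u\<bar> \<le> R \<and> \<bar>v\<bar> \<le> R \<and> \<bar>x\<bar> \<le> 1 \<and> \<bar>y\<bar> \<le> 1 \<longrightarrow> \<bar>dder k M u v x y\<bar> \<le> C"
proof (rule ccontr)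
  assume "\<not> ?thesis"
  then have "\<exists>u v x y. \<bar>u\<bar> \<le> R \<and> \<bar>v\<bar> \<le> R \<and> \<bar>x\<bar> \<le> 1 \<and> \<bar>y\<bar> \<le> 1 \<and> \<bar>dder k M u v x y\<bar> > real n" for n :: nat
  proof -
    have "\<not> (\<forall>u v x y. \<bar>u\<bar> \<le> R \<and> \<bar>v\<bar> \<le> R \<and> \<bar>x\<bar> \<le> 1 \<and> \<bar>y\<bar> \<le> 1 \<longrightarrow> \<bar>dder k M u v x y\<bar> \<le> real n)"
      using \<open>\<not> _\<close> by blast
    then show ?thesis by (simp add: not_le conj_assoc)
  qed
  then obtain u v x y where uv: "\<And>n. \<bar>u n\<bar> \<le> R" "\<And>n. \<bar>v n\<bar> \<le> R"
      "\<And>n. \<bar>x n\<bar> \<le> 1" "\<And>n. \<bar>y n\<bar> \<le> 1" "\<And>n. \<bar>dder k M (u n) (v n) (x n) (y n)\<bar> > real n" by metis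
  obtain f u0 where f: "strict_mono f" "(\<lambda>n. u (f n)) \<longlonglongrightarrow> u0" using bounded_subseq[of u R, OF uv(1)] by blast
  obtain g v0 where g: "strict_mono g" "(\<lambda>n. v (f (g n))) \<longlonglongrightarrow> v0"
    using bounded_subseq[of "\<lambda>n. v (f n)" R] uv(2) by blast
  have ug: "(\<lambda>n. u (f (g n))) \<longlonglongrightarrow> u0" using LIMSEQ_subseq_LIMSEQ[OF f(2) g(1)] by (simp add: o_def)
  obtain \<rho> C where C: "\<rho> > 0" "\<And>u v x y. \<bar>u - u0\<bar> < \<rho> \<Longrightarrow> \<bar>v - v0\<bar> < \<rho> \<Longrightarrow> \<bar>x\<bar> \<le> 1 \<Longrightarrow> \<bar>y\<bar> \<le> 1 \<Longrightarrow> \<bar>dder k M u v x y\<bar> \<le> C"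
    using dder_local_bound[OF k] by meson
  have ev: "eventually (\<lambda>n. dist (u (f (g n))) u0 < \<rho>) sequentially" "eventually (\<lambda>n. dist (v (f (g n))) v0 < \<rho>) sequentially"
    using tendstoD[OF ug C(1)] tendstoD[OF g(2) C(1)] by auto
  obtain N where N: "real N > C" using reals_Archimedean2 by blast
  from ev have "eventually (\<lambda>n. False) sequentially" using eventually_ge_at_top[of N]
  proof eventually_elim
    case (elim n)
    have "\<bar>dder k M (u (f (g n))) (v (f (g n))) (x (f (g n))) (y (f (g n)))\<bar> \<le> C"
      by (rule C) (use elim uv in \<open>auto simp: dist_real_def\<close>)
    moreover have "n \<le> f (g n)" using seq_suble[OF f(1)] seq_suble[OF g(1)] by (meson order_trans)
    ultimately show False using uv(5)[of "f (g n)"] N elim(3) by linarith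
  qed
  then show False by simp
qed

text \<open>A direction with entries at most d is d times one with entries at most 1, so step 1
  becomes step d and the mean value theorem yields d^M. The bound D is arbitrary because
  polarization produces directions longer than 1.\<close>

lemma nice_line_fd_bound:
  assumes k: "nice k"
  shows "\<exists>C\<ge>0. \<forall>u v x y d. \<bar>u\<bar> \<le> R \<and> \<bar>v\<bar> \<le> R \<and> \<bar>x\<bar> \<le> d \<and> \<bar>y\<bar> \<le> d \<and> 0 < d \<and> d \<le> D \<longrightarrow>
     \<bar>(fd 1 ^^ M) (\<lambda>r. k (u + r * x) (v + r * y)) 0\<bar> \<le> C * d ^ M"
proof -
  obtain C where C: "\<And>u v x y. \<bar>u\<bar> \<le> R + real M * D \<Longrightarrow> \<bar>v\<bar> \<le> R + real M * D \<Longrightarrow> \<bar>x\<bar> \<le> 1 \<Longrightarrow> \<bar>y\<bar> \<le> 1 \<Longrightarrow> \<bar>dder k M u v x y\<bar> \<le> C"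
    using dder_bound[OF k] by meson
  have "\<bar>(fd 1 ^^ M) (\<lambda>r. k (u + r * x) (v + r * y)) 0\<bar> \<le> max C 0 * d ^ M"
    if H: "\<bar>u\<bar> \<le> R" "\<bar>v\<bar> \<le> R" "\<bar>x\<bar> \<le> d" "\<bar>y\<bar> \<le> d" "0 < d" "d \<le> D" for u v x y d
  proof -
    define p where "p r = k (u + r * (x / d)) (v + r * (y / d))" for r
    have p: "smooth_rr p" unfolding p_def by (rule nice_line[OF k])
    have "(fd 1 ^^ M) (\<lambda>r. k (u + r * x) (v + r * y)) 0 = (fd 1 ^^ M) (\<lambda>r. p (d * r + 0)) 0"
      using H by (simp add: p_def)
    also have "\<dots> = (fd d ^^ M) p 0" unfolding fd_pow_stretch by simp
    finally have 1: "(fd 1 ^^ M) (\<lambda>r. k (u + r * x) (v + r * y)) 0 = (fd d ^^ M) p 0" .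
    obtain z where z: "0 \<le> z" "z \<le> real M * d" "(fd d ^^ M) p 0 = d ^ M * (der ^^ M) p z"
      using fd_mvt[OF p less_imp_le[OF H(5)], of 0 M] by auto
    have "(der ^^ M) p z = (der ^^ M) (\<lambda>r. p (1 * r + z)) 0" unfolding der_n_affine[OF p] by simp
    also have "\<dots> = dder k M (u + z * (x / d)) (v + z * (y / d)) (x / d) (y / d)"
      by (simp add: dder_def p_def algebra_simps add_divide_distrib)
    also have "\<bar>\<dots>\<bar> \<le> C"
    proof (rule C)
      have zD: "z \<le> real M * D" using z(2) mult_left_mono[OF H(6), of "real M"] by simp
      have xd: "\<bar>x / d\<bar> \<le> 1" "\<bar>y / d\<bar> \<le> 1" using H by (auto simp: abs_divide)
      then show "\<bar>x / d\<bar> \<le> 1" "\<bar>y / d\<bar> \<le> 1" by auto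
      have "\<bar>z * (x / d)\<bar> \<le> z * 1" "\<bar>z * (y / d)\<bar> \<le> z * 1"
        unfolding abs_mult abs_of_nonneg[OF z(1)] by (rule mult_left_mono[OF xd(1) z(1)], rule mult_left_mono[OF xd(2) z(1)])
      then show "\<bar>u + z * (x / d)\<bar> \<le> R + real M * D" "\<bar>v + z * (y / d)\<bar> \<le> R + real M * D"
        using H zD by linarith+
    qed
    finally have "\<bar>(der ^^ M) p z\<bar> \<le> max C 0" by simp
    from mult_left_mono[OF this, of "d ^ M"] show ?thesis unfolding 1 z(3) using H by (simp add: abs_mult mult.commute)
  qed
  then show ?thesis by (intro exI[of _ "max C 0"]) auto
qed

section \<open>Weakly smooth curves of functions\<close>

lemma sum_Pow_insert:
  assumes "finite B" "a \<notin> B"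
  shows "sum f (Pow (insert a B)) = (\<Sum>S\<in>Pow B. f S + f (insert a S))"
proof -
  have d: "Pow B \<inter> insert a ` Pow B = {}" using assms by auto
  have i: "inj_on (insert a) (Pow B)" using assms unfolding inj_on_def by (metis Pow_iff insert_ident subsetD)
  have "sum f (Pow (insert a B)) = sum f (Pow B) + sum f (insert a ` Pow B)"
    unfolding Pow_insert using assms d by (intro sum.union_disjoint) auto
  also have "sum f (insert a ` Pow B) = (\<Sum>S\<in>Pow B. f (insert a S))" by (simp add: sum.reindex[OF i])
  finally show ?thesis by (simp add: sum.distrib)
qed

lemma fd_pow_sum: "(fd d ^^ m) (\<lambda>x. \<Sum>i\<in>A. c i * f i x) x = (\<Sum>i\<in>A. c i * (fd d ^^ m) (f i) x)"
proof (induction m arbitrary: x)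
  case (Suc m)
  show ?case unfolding fd_pow_Suc_apply Suc by (simp add: sum_subtractf right_diff_distrib)
qed simp

text \<open>In the expansion of the M-th difference only the value at x survives.\<close>

lemma fd_pow_vanish:
  assumes "\<And>l. 1 \<le> l \<Longrightarrow> l \<le> M \<Longrightarrow> Q (x + real l) = 0"
  shows "(fd 1 ^^ M) Q x = (-1) ^ M * Q x"
  using assms
proof (induction M arbitrary: x)
  case (Suc M)
  have "(fd 1 ^^ M) Q (x + 1) = (-1) ^ M * Q (x + 1)"
    using Suc.prems[of "Suc _"] by (intro Suc.IH) (auto simp: add.assoc)
  moreover have "Q (x + 1) = 0" using Suc.prems[of 1] by simp
  moreover have "(fd 1 ^^ M) Q x = (-1) ^ M * Q x" using Suc.prems by (intro Suc.IH) auto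
  ultimately show ?case unfolding fd_pow_Suc_apply by simp
qed simp

text \<open>The signed sum over the corners of a box is a mixed difference. Letting the edge \<open>h i\<close> shrink
  like \<open>1 - r / i\<close>, the signed sum vanishes at \<open>r = 1, \<dots>, M\<close>, since then the \<open>r\<close>-th edge has length 0;
  so its \<open>M\<close>-th difference in \<open>r\<close>, a sum of differences along lines, is the mixed difference up to sign.\<close>
definition corner_sum :: "(real \<Rightarrow> real \<Rightarrow> real) \<Rightarrow> (nat \<Rightarrow> real) \<Rightarrow> (nat \<Rightarrow> real) \<Rightarrow> nat \<Rightarrow> real \<Rightarrow> real \<Rightarrow> real" where
  "corner_sum k hx hy M u v = (\<Sum>S\<in>Pow {1..M}. (-1) ^ card S * k (u + sum hx S) (v + sum hy S))"

lemma corner_sum_Suc: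
  "corner_sum k hx hy (Suc M) u v = corner_sum k hx hy M u v - corner_sum k hx hy M (u + hx (Suc M)) (v + hy (Suc M))"
proof -
  have "{1..Suc M} = insert (Suc M) {1..M}" by auto
  then have "corner_sum k hx hy (Suc M) u v = (\<Sum>S\<in>Pow {1..M}. (-1) ^ card S * k (u + sum hx S) (v + sum hy S)
     + (-1) ^ card (insert (Suc M) S) * k (u + sum hx (insert (Suc M) S)) (v + sum hy (insert (Suc M) S)))"
    unfolding corner_sum_def by (simp only:) (rule sum_Pow_insert, auto)
  also have "\<dots> = (\<Sum>S\<in>Pow {1..M}. (-1) ^ card S * k (u + sum hx S) (v + sum hy S)
     - (-1) ^ card S * k (u + hx (Suc M) + sum hx S) (v + hy (Suc M) + sum hy S))"
  proof (rule sum.cong[OF refl])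
    fix S assume S: "S \<in> Pow {1..M}"
    then have "finite S" "Suc M \<notin> S" using finite_subset[of S "{1..M}"] by auto
    then show "(-1) ^ card S * k (u + sum hx S) (v + sum hy S)
     + (-1) ^ card (insert (Suc M) S) * k (u + sum hx (insert (Suc M) S)) (v + sum hy (insert (Suc M) S))
     = (-1) ^ card S * k (u + sum hx S) (v + sum hy S)
     - (-1) ^ card S * k (u + hx (Suc M) + sum hx S) (v + hy (Suc M) + sum hy S)" by (simp add: add.assoc)
  qed
  finally show ?thesis by (simp add: corner_sum_def sum_subtractf)
qed

lemma corner_sum_polarize:
  "corner_sum k hx hy M u v = (-1) ^ M * (\<Sum>S\<in>Pow {1..M}. (-1) ^ card S *
     (fd 1 ^^ M) (\<lambda>r. k (u + sum hx S + r * (- (\<Sum>i\<in>S. hx i / real i)))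
                     (v + sum hy S + r * (- (\<Sum>i\<in>S. hy i / real i)))) 0)"
proof -
  define E where "E S r = k (u + sum hx S + r * (- (\<Sum>i\<in>S. hx i / real i)))
                     (v + sum hy S + r * (- (\<Sum>i\<in>S. hy i / real i)))" for S r
  define Q where "Q r = (\<Sum>S\<in>Pow {1..M}. (-1) ^ card S * E S r)" for r
  have "Q (0 + real l) = 0" if l: "1 \<le> l" "l \<le> M" for l
  proof -
    have A: "{1..M} = insert l ({1..M} - {l})" using l by auto
    have "Q (real l) = (\<Sum>S\<in>Pow ({1..M} - {l}). (-1) ^ card S * E S (real l) + (-1) ^ card (insert l S) * E (insert l S) (real l))"
      unfolding Q_def by (subst A, rule sum_Pow_insert) auto
    also have "\<dots> = (\<Sum>S\<in>Pow ({1..M} - {l}). 0)"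
    proof (rule sum.cong[OF refl])
      fix S assume S: "S \<in> Pow ({1..M} - {l})"
      then have f: "finite S" "l \<notin> S" using finite_subset[of S "{1..M}"] by auto
      have "E (insert l S) (real l) = E S (real l)" unfolding E_def using f l
        by (simp add: algebra_simps)
      then show "(-1) ^ card S * E S (real l) + (-1) ^ card (insert l S) * E (insert l S) (real l) = 0"
        using f by simp
    qed
    finally show ?thesis by simp
  qed
  from fd_pow_vanish[of M Q 0, OF this] have "(fd 1 ^^ M) Q 0 = (-1) ^ M * Q 0" by simp
  moreover have "(fd 1 ^^ M) Q 0 = (\<Sum>S\<in>Pow {1..M}. (-1) ^ card S * (fd 1 ^^ M) (E S) 0)"
    unfolding Q_def by (rule fd_pow_sum)
  moreover have "Q 0 = corner_sum k hx hy M u v" by (simp add: Q_def E_def corner_sum_def)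
  moreover have "(-1) ^ M * ((-1) ^ M * x) = (x::real)" for x
    by (simp add: mult.assoc[symmetric] power_add[symmetric] mult_2[symmetric])
  ultimately show ?thesis unfolding E_def by metis
qed

section \<open>Mixed differences in two variables\<close>

definition mfd :: "nat \<Rightarrow> real \<Rightarrow> nat \<Rightarrow> real \<Rightarrow> (real \<Rightarrow> real \<Rightarrow> real) \<Rightarrow> real \<Rightarrow> real \<Rightarrow> real" where
  "mfd m d j e k u v = (fd e ^^ j) (\<lambda>v. (fd d ^^ m) (\<lambda>u. k u v) u) v"

lemma mfd_Suc1: "mfd (Suc m) d j e k u v = mfd m d j e k (u + d) v - mfd m d j e k u v"
  unfolding mfd_def
proof (induction j arbitrary: v)
  case (Suc j)
  show ?case unfolding fd_pow_Suc_apply[where d = e] Suc by simp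
qed (simp add: fd_def)

lemma mfd_Suc2: "mfd m d (Suc j) e k u v = mfd m d j e k u (v + e) - mfd m d j e k u v"
  unfolding mfd_def fd_pow_Suc_apply[where d = e] ..

lemma mfd_swap: "mfd m d j e k u v = (fd d ^^ m) (\<lambda>u. (fd e ^^ j) (k u) v) u"
proof (induction m arbitrary: u)
  case 0 show ?case by (simp add: mfd_def)
next
  case (Suc m)
  show ?case unfolding mfd_Suc1 Suc fd_pow_Suc_apply ..
qed

text \<open>With equal steps the mixed difference is an alternating sum over the corners of a box
  that has m edges in the first direction and j in the second.\<close>

lemma mfd_corner:
  "mfd m d j d k u v = (-1) ^ (m + j) * corner_sum k (\<lambda>i. if i \<le> m then d else 0) (\<lambda>i. if i \<le> m then 0 else d) (m + j) u v"
proof (induction j arbitrary: v)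
  case 0
  let ?hx = "\<lambda>i. if i \<le> m then d else 0" and ?hy = "\<lambda>i. if i \<le> m then 0 else d"
  have "n \<le> m \<Longrightarrow> mfd n d 0 d k u v = (-1) ^ n * corner_sum k ?hx ?hy n u v" for n
  proof (induction n arbitrary: u)
    case 0 show ?case by (simp add: mfd_def corner_sum_def)
  next
    case (Suc n)
    then show ?case unfolding mfd_Suc1 corner_sum_Suc by (simp add: algebra_simps)
  qed
  from this[of m] show ?case by simp
next
  case (Suc j)
  show ?case unfolding mfd_Suc2 Suc add_Suc_right corner_sum_Suc by (simp add: algebra_simps)
qed

text \<open>Polarization writes the mixed difference as 2^M differences along lines. Their
  directions have entries at most M d, because each edge is divided by an index i \<ge> 1.\<close>

lemma mfd_equal_bound:
  assumes k: "nice k"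
  shows "\<exists>C. \<forall>u v d. \<bar>u\<bar> \<le> R \<and> \<bar>v\<bar> \<le> R \<and> 0 < d \<and> d \<le> 1 \<longrightarrow> \<bar>mfd m d j d k u v\<bar> \<le> C * d ^ (m + j)"
proof -
  define M where "M = m + j"
  \<comment> \<open>\<open>Suc M\<close> instead of M keeps the admissible size of directions
    positive when M = 0.\<close>
  obtain C where C: "C \<ge> 0" "\<And>u v x y d. \<bar>u\<bar> \<le> R + real M \<Longrightarrow> \<bar>v\<bar> \<le> R + real M \<Longrightarrow> \<bar>x\<bar> \<le> d \<Longrightarrow> \<bar>y\<bar> \<le> d \<Longrightarrow> 0 < d \<Longrightarrow> d \<le> real (Suc M) \<Longrightarrow>
     \<bar>(fd 1 ^^ M) (\<lambda>r. k (u + r * x) (v + r * y)) 0\<bar> \<le> C * d ^ M"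
    using nice_line_fd_bound[OF k, of "R + real M" "real (Suc M)" M] by meson
  have "\<bar>mfd m d j d k u v\<bar> \<le> (2 ^ M * (C * real (Suc M) ^ M)) * d ^ (m + j)"
    if H: "\<bar>u\<bar> \<le> R" "\<bar>v\<bar> \<le> R" "0 < d" "d \<le> 1" for u v d
  proof -
    let ?hx = "\<lambda>i. if i \<le> m then d else 0" and ?hy = "\<lambda>i. if i \<le> m then 0 else d"
    have sm: "\<bar>sum h S\<bar> \<le> real M * d" if "S \<in> Pow {1..M}" "\<And>i. i \<in> S \<Longrightarrow> \<bar>h i\<bar> \<le> d" for h :: "nat \<Rightarrow> real" and S
    proof -
      have "\<bar>sum h S\<bar> \<le> (\<Sum>i\<in>S. d)" by (rule order.trans[OF sum_abs sum_mono]) (use that in auto)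
      also have "\<dots> = real (card S) * d" by simp
      also have "\<dots> \<le> real M * d" using card_mono[of "{1..M}" S] that H by (intro mult_right_mono) auto
      finally show ?thesis .
    qed
    have dv: "\<bar>x / real i\<bar> \<le> d" if "\<bar>x\<bar> \<le> d" "i \<in> S" "S \<in> Pow {1..M}" for x i S
    proof -
      have "real i \<ge> 1" using that by auto
      then have "\<bar>x\<bar> / real i \<le> \<bar>x\<bar> / 1" by (intro frac_le) auto
      then show ?thesis using that by (simp add: abs_divide)
    qed
    have Md: "real M * d \<le> real M" using H by (simp add: mult_left_le)
    have "\<bar>(-1) ^ card S * (fd 1 ^^ M) (\<lambda>r. k (u + sum ?hx S + r * (- (\<Sum>i\<in>S. ?hx i / real i)))
                     (v + sum ?hy S + r * (- (\<Sum>i\<in>S. ?hy i / real i)))) 0\<bar> \<le> C * (real (Suc M) * d) ^ M"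
      if S: "S \<in> Pow {1..M}" for S
    proof -
      have le: "real M * d \<le> real (Suc M) * d" using H by (intro mult_right_mono) auto
      have 1: "\<bar>sum ?hx S\<bar> \<le> real M * d" "\<bar>sum ?hy S\<bar> \<le> real M * d" using H by (auto intro!: sm[OF S])
      have 2: "\<bar>- (\<Sum>i\<in>S. ?hx i / real i)\<bar> \<le> real (Suc M) * d" "\<bar>- (\<Sum>i\<in>S. ?hy i / real i)\<bar> \<le> real (Suc M) * d"
        unfolding abs_minus_cancel
        using H by (auto intro!: order.trans[OF sm[OF S] le] dv[OF _ _ S] simp del: of_nat_Suc)
      have "\<bar>(fd 1 ^^ M) (\<lambda>r. k (u + sum ?hx S + r * (- (\<Sum>i\<in>S. ?hx i / real i)))
                     (v + sum ?hy S + r * (- (\<Sum>i\<in>S. ?hy i / real i)))) 0\<bar> \<le> C * (real (Suc M) * d) ^ M"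
      proof (rule C(2)[OF _ _ 2])
        show "\<bar>u + sum ?hx S\<bar> \<le> R + real M" "\<bar>v + sum ?hy S\<bar> \<le> R + real M" using 1 H Md by linarith+
        show "0 < real (Suc M) * d" using H by simp
        have "real (Suc M) * d \<le> real (Suc M) * 1" by (rule mult_left_mono) (use H in auto)
        then show "real (Suc M) * d \<le> real (Suc M)" by simp
      qed
      then show ?thesis by (simp add: abs_mult)
    qed
    then have "\<bar>\<Sum>S\<in>Pow {1..M}. (-1) ^ card S * (fd 1 ^^ M) (\<lambda>r. k (u + sum ?hx S + r * (- (\<Sum>i\<in>S. ?hx i / real i)))
                     (v + sum ?hy S + r * (- (\<Sum>i\<in>S. ?hy i / real i)))) 0\<bar> \<le> (\<Sum>S\<in>Pow {1..M}. C * (real (Suc M) * d) ^ M)"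
      by (intro order.trans[OF sum_abs sum_mono])
    also have "\<dots> = 2 ^ M * (C * (real (Suc M) * d) ^ M)" by (simp add: card_Pow)
    finally show ?thesis unfolding mfd_corner corner_sum_polarize M_def[symmetric]
      by (simp add: abs_mult power_mult_distrib mult.assoc del: of_nat_Suc)
  qed
  then show ?thesis by blast
qed

lemma mfd_commensurable_bound:
  assumes "\<And>y z. u \<le> y \<Longrightarrow> y \<le> u + real m * (real p * h) \<Longrightarrow> v \<le> z \<Longrightarrow> z \<le> v + real j * (real q * h) \<Longrightarrow> \<bar>mfd m h j h k y z\<bar> \<le> B"
    and h: "h \<ge> 0"
  shows "\<bar>mfd m (real p * h) j (real q * h) k u v\<bar> \<le> real q ^ j * (real p ^ m * B)"
  unfolding mfd_def
proof (rule fd_pow_refine[OF _ h])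
  fix z assume z: "v \<le> z" "z \<le> v + real j * real q * h"
  have "\<bar>(fd (real p * h) ^^ m) (\<lambda>u. (fd h ^^ j) (k u) z) u\<bar> \<le> real p ^ m * B"
  proof (rule fd_pow_refine[OF _ h])
    fix y assume y: "u \<le> y" "y \<le> u + real m * real p * h"
    have "\<bar>mfd m h j h k y z\<bar> \<le> B" by (rule assms) (use y z in \<open>auto simp: mult.assoc\<close>)
    then show "\<bar>(fd h ^^ m) (\<lambda>u. (fd h ^^ j) (k u) z) y\<bar> \<le> B" unfolding mfd_swap .
  qed
  then show "\<bar>(fd h ^^ j) (\<lambda>v. (fd (real p * h) ^^ m) (\<lambda>u. k u v) u) z\<bar> \<le> real p ^ m * B"
    by (subst mfd_swap[unfolded mfd_def])
qed

lemma nice_sec: "nice k \<Longrightarrow> smooth_rr (\<lambda>u. k u v)"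
  unfolding nice_def by (simp add: smooth_id smooth_const)

lemma smooth_fd_sec: "(\<And>v. smooth_rr (\<lambda>u. k u v)) \<Longrightarrow> smooth_rr (\<lambda>u. (fd e ^^ j) (k u) v)"
proof (induction j arbitrary: v)
  case (Suc j)
  show ?case unfolding fd_pow_Suc_apply by (rule smooth_diff[OF Suc.IH[OF Suc.prems] Suc.IH[OF Suc.prems]])
qed simp

text \<open>Both steps are approximated by multiples of h = e / (n + 1): e exactly, d from below.
  The powers of h combine with the numbers of subdivisions, so the constant does not depend on n,
  and continuity in the step d gives the limit.\<close>

lemma mfd_bound:
  assumes k: "nice k"
  shows "\<exists>C. \<forall>u v d e. \<bar>u\<bar> \<le> R \<and> \<bar>v\<bar> \<le> R \<and> 0 < d \<and> d \<le> 1 \<and> 0 < e \<and> e \<le> 1 \<longrightarrow> \<bar>mfd m d j e k u v\<bar> \<le> C * (d ^ m * e ^ j)"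
proof -
  obtain C where C: "\<And>u v d. \<bar>u\<bar> \<le> R + real m + real j \<Longrightarrow> \<bar>v\<bar> \<le> R + real m + real j \<Longrightarrow> 0 < d \<Longrightarrow> d \<le> 1 \<Longrightarrow> \<bar>mfd m d j d k u v\<bar> \<le> C * d ^ (m + j)"
    using mfd_equal_bound[OF k, of "R + real m + real j" m j] by meson
  have "\<bar>mfd m d j e k u v\<bar> \<le> C * (d ^ m * e ^ j)" if H: "\<bar>u\<bar> \<le> R" "\<bar>v\<bar> \<le> R" "0 < d" "d \<le> 1" "0 < e" "e \<le> 1" for u v d e
  proof -
    define h where "h n = e / real (Suc n)" for n
    define p where "p n = nat \<lfloor>d / h n\<rfloor>" for n
    have h: "0 < h n" "h n \<le> 1" "real (Suc n) * h n = e" for n using H by (auto simp: h_def divide_le_eq)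
    have p: "real (p n) * h n \<le> d" "d - h n \<le> real (p n) * h n" for n
    proof -
      have "d / h n \<ge> 0" using h(1)[of n] H by simp
      then have "real (p n) = of_int \<lfloor>d / h n\<rfloor>" by (simp add: p_def)
      then have "real (p n) \<le> d / h n" "d / h n \<le> real (p n) + 1" by linarith+
      then show "real (p n) * h n \<le> d" "d - h n \<le> real (p n) * h n" using h(1)[of n] by (simp_all add: field_simps)
    qed
    have b: "\<bar>mfd m (real (p n) * h n) j e k u v\<bar> \<le> C * ((real (p n) * h n) ^ m * e ^ j)" for n
    proof -
      have "\<bar>mfd m (real (p n) * h n) j (real (Suc n) * h n) k u v\<bar> \<le> real (Suc n) ^ j * (real (p n) ^ m * (C * h n ^ (m + j)))"
      proof (rule mfd_commensurable_bound)
        fix y z assume y: "u \<le> y" "y \<le> u + real m * (real (p n) * h n)" and z: "v \<le> z" "z \<le> v + real j * (real (Suc n) * h n)"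
        have "real m * (real (p n) * h n) \<le> real m * 1" by (rule mult_left_mono) (use p[of n] H in auto)
        moreover have "real j * (real (Suc n) * h n) \<le> real j * 1" by (rule mult_left_mono) (use h(3)[of n] H in auto)
        ultimately show "\<bar>mfd m (h n) j (h n) k y z\<bar> \<le> C * h n ^ (m + j)" using y z H by (intro C h) linarith+
      qed (use h(1)[of n] in simp)
      also have "\<dots> = C * ((real (p n) * h n) ^ m * (real (Suc n) * h n) ^ j)"
        by (simp add: power_mult_distrib power_add algebra_simps del: of_nat_Suc)
      finally show ?thesis unfolding h(3) .
    qed
    have h0: "h \<longlonglongrightarrow> 0"
    proof -
      have "(\<lambda>n. e * (1 / real (Suc n))) \<longlonglongrightarrow> e * 0" by (intro tendsto_intros LIMSEQ_Suc lim_1_over_n)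
      then show ?thesis by (simp add: h_def[abs_def])
    qed
    have lim: "(\<lambda>n. real (p n) * h n) \<longlonglongrightarrow> d"
    proof (rule real_tendsto_sandwich)
      show "(\<lambda>n. d - h n) \<longlonglongrightarrow> d" using tendsto_diff[OF tendsto_const h0] by simp
      show "(\<lambda>n. d) \<longlonglongrightarrow> d" by simp
    qed (use p in auto)
    have g: "isCont (\<lambda>u. (fd e ^^ j) (k u) v) x" for x
      by (rule smooth_cont[OF smooth_fd_sec[OF nice_sec[OF k]]])
    have "isCont (\<lambda>d. mfd m d j e k u v) d"
      unfolding mfd_swap using fd_pow_isCont_step[where c = 0, OF g] by simp
    from isCont_tendsto_compose[OF this lim]
    have "(\<lambda>n. \<bar>mfd m (real (p n) * h n) j e k u v\<bar>) \<longlonglongrightarrow> \<bar>mfd m d j e k u v\<bar>" by (rule tendsto_rabs)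
    moreover have "(\<lambda>n. C * ((real (p n) * h n) ^ m * e ^ j)) \<longlonglongrightarrow> C * (d ^ m * e ^ j)"
      by (intro tendsto_intros lim)
    ultimately show ?thesis using b by (intro LIMSEQ_le) auto
  qed
  then show ?thesis by blast
qed

section \<open>Uniform bounds for weakly smooth curves\<close>

text \<open>The uniform boundedness principle on \<open>\<ell>\<^sup>1\<close>, for functionals given by their coefficients.\<close>
lemma gliding_hump:
  fixes L :: "'i \<Rightarrow> 'j \<Rightarrow> real"
  assumes b: "\<And>i. i \<in> I \<Longrightarrow> \<exists>B. \<forall>j\<in>J. \<bar>L i j\<bar> \<le> B"
    and s: "\<And>a f. summable (\<lambda>n. \<bar>a n\<bar>) \<Longrightarrow> (\<And>n::nat. f n \<in> J) \<Longrightarrow> \<exists>K. \<forall>i\<in>I. \<bar>\<Sum>n. a n * L i (f n)\<bar> \<le> K"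
  shows "\<exists>K. \<forall>i\<in>I. \<forall>j\<in>J. \<bar>L i j\<bar> \<le> K"
proof (rule ccontr)
  assume "\<not> ?thesis"
  then have "\<forall>K. \<exists>p. fst p \<in> I \<and> snd p \<in> J \<and> \<bar>L (fst p) (snd p)\<bar> > K" by (metis fst_conv snd_conv not_le)
  then obtain pick where pick: "\<And>K. fst (pick K) \<in> I" "\<And>K. snd (pick K) \<in> J" "\<And>K. \<bar>L (fst (pick K)) (snd (pick K))\<bar> > K" by metis
  have "\<exists>B. 0 \<le> B \<and> (\<forall>j\<in>J. \<bar>L i j\<bar> \<le> B)" if i: "i \<in> I" for i
  proof -
    obtain B where B: "\<forall>j\<in>J. \<bar>L i j\<bar> \<le> B" using b[OF i] by blast
    then show ?thesis by (intro exI[of _ "max B 0"]) auto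
  qed
  then obtain Bf where Bf: "\<And>i. i \<in> I \<Longrightarrow> 0 \<le> Bf i" "\<And>i j. i \<in> I \<Longrightarrow> j \<in> J \<Longrightarrow> \<bar>L i j\<bar> \<le> Bf i" by metis
  \<comment> \<open>A weight sequence concentrated at 0 turns the hypothesis on sums into
    boundedness at the single coefficient j.\<close>
  have "\<exists>P. \<forall>i\<in>I. \<bar>L i j\<bar> \<le> P" if j: "j \<in> J" for j
  proof -
    define a where "a n = (if n = (0::nat) then 1 else 0 :: real)" for n
    have "summable (\<lambda>n. \<bar>a n\<bar>)" by (rule summable_finite[of "{0}"]) (auto simp: a_def)
    then obtain K where K: "\<forall>i\<in>I. \<bar>\<Sum>n. a n * L i j\<bar> \<le> K" using s[of a "\<lambda>_. j"] j by blast
    have "(\<Sum>n. a n * L i j) = L i j" for i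
      using suminf_finite[of "{0}" "\<lambda>n. a n * L i j"] by (simp add: a_def)
    with K show ?thesis by auto
  qed
  then obtain Pf where Pf: "\<And>i j. i \<in> I \<Longrightarrow> j \<in> J \<Longrightarrow> \<bar>L i j\<bar> \<le> Pf j" by metis
  \<comment> \<open>The state is a pair: a bound, valid for every functional, on the sum of the
    terms chosen so far, and the sum of the norms of the functionals chosen so far. Dividing by the
    second makes every later term, the l-th say, at most 2^-l on those functionals.\<close>
  define cf :: "nat \<Rightarrow> real \<times> real \<Rightarrow> real" where "cf n z = (1/2) ^ n / (1 + snd z)" for n z
  \<comment> \<open>The n-th term is to exceed n + 2 plus the bound on the earlier terms; 2 is the
    sum of all 2^-l and covers what the later terms can cancel.\<close>
  define pf :: "nat \<Rightarrow> real \<times> real \<Rightarrow> 'i \<times> 'j" where "pf n z = pick ((real n + fst z + 2) / cf n z)" for n z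
  define st where "st = rec_nat (0, 0) (\<lambda>n z. (fst z + cf n z * Pf (snd (pf n z)), snd z + Bf (fst (pf n z))))"
  define S where "S n = fst (st n)" for n
  define Bm where "Bm n = snd (st n)" for n
  define c where "c n = (1/2::real) ^ n / (1 + Bm n)" for n
  define ii where "ii n = fst (pick ((real n + S n + 2) / c n))" for n
  define jj where "jj n = snd (pick ((real n + S n + 2) / c n))" for n
  have rec: "S 0 = 0" "Bm 0 = 0" "S (Suc n) = S n + c n * Pf (jj n)" "Bm (Suc n) = Bm n + Bf (ii n)" for n
    by (simp_all add: S_def Bm_def c_def ii_def jj_def st_def cf_def pf_def)
  have I: "ii n \<in> I" "jj n \<in> J" for n by (auto simp: ii_def jj_def pick)
  have big: "\<bar>L (ii n) (jj n)\<bar> > (real n + S n + 2) / c n" for n unfolding ii_def jj_def by (rule pick)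
  have B0: "Bm n \<ge> 0" for n by (induction n) (auto simp: rec intro!: add_nonneg_nonneg Bf I)
  have c0: "c n > 0" for n using B0[of n] by (auto simp: c_def)
  have cm: "c n * (1 + Bm n) = (1/2) ^ n" for n using B0[of n] by (simp add: c_def)
  have c1: "c n \<le> (1/2) ^ n" for n using B0[of n] by (simp add: c_def divide_le_eq mult_le_cancel_left1)
  have sumS: "S n = (\<Sum>l<n. c l * Pf (jj l))" for n by (induction n) (auto simp: rec)
  have Bmono: "Bm n \<le> Bm l" if "n \<le> l" for n l
    using that by (induction l rule: dec_induct) (auto simp: rec intro!: add_increasing2 Bf I)
  have geo: "summable (\<lambda>n. (1/2::real) ^ n)" "(\<Sum>n. (1/2::real) ^ n) = 2"
    using suminf_geometric[of "1/2::real"] by (auto simp: summable_geometric)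
  have sc: "summable (\<lambda>n. \<bar>c n\<bar>)"
  proof (rule summable_comparison_test'[OF geo(1), of 0])
    fix n show "norm \<bar>c n\<bar> \<le> (1/2) ^ n" using c0[of n] c1[of n] by simp
  qed
  obtain K where K: "\<And>i. i \<in> I \<Longrightarrow> \<bar>\<Sum>n. c n * L i (jj n)\<bar> \<le> K" using s[of c jj, OF sc I(2)] by blast
  obtain n where n: "real n > K" using reals_Archimedean2 by blast
  define x where "x l = c l * L (ii n) (jj l)" for l
  have xs: "summable (\<lambda>l. \<bar>x l\<bar>)"
  proof (rule summable_comparison_test'[OF summable_mult2[OF sc, of "Bf (ii n)"], of 0])
    fix l show "norm \<bar>x l\<bar> \<le> \<bar>c l\<bar> * Bf (ii n)" unfolding x_def using Bf(2)[OF I(1) I(2), of n l] by (simp add: abs_mult mult_left_mono)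
  qed
  have xs': "summable x" by (rule summable_rabs_cancel[OF xs])
  have split: "(\<Sum>l. x l) = (\<Sum>l. x (l + Suc n)) + (\<Sum>l<n. x l) + x n"
    using suminf_split_initial_segment[OF xs', of "Suc n"] by simp
  have h1: "\<bar>\<Sum>l<n. x l\<bar> \<le> S n" unfolding sumS x_def
  proof (rule order.trans[OF sum_abs sum_mono])
    fix l show "\<bar>c l * L (ii n) (jj l)\<bar> \<le> c l * Pf (jj l)"
      using Pf[OF I(1) I(2), of n l] c0[of l] by (simp add: abs_mult mult_left_mono)
  qed
  have h2: "\<bar>\<Sum>l. x (l + Suc n)\<bar> \<le> 2"
  proof -
    have t: "\<bar>x (l + Suc n)\<bar> \<le> (1/2) ^ l" for l
    proof -
      have "Bf (ii n) \<le> Bm (Suc n)" using B0[of n] by (simp add: rec)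
      also have "\<dots> \<le> Bm (l + Suc n)" by (rule Bmono) simp
      finally have "\<bar>L (ii n) (jj (l + Suc n))\<bar> \<le> 1 + Bm (l + Suc n)" using Bf(2)[OF I(1) I(2), of n "l + Suc n"] by linarith
      then have "c (l + Suc n) * \<bar>L (ii n) (jj (l + Suc n))\<bar> \<le> c (l + Suc n) * (1 + Bm (l + Suc n))"
        using c0[of "l + Suc n"] by (intro mult_left_mono) auto
      also have "\<dots> = (1/2) ^ (l + Suc n)" by (rule cm)
      also have "\<dots> \<le> (1/2) ^ l" by (rule power_decreasing) auto
      finally show ?thesis using c0[of "l + Suc n"] by (simp add: x_def abs_mult)
    qed
    have s2: "summable (\<lambda>l. \<bar>x (l + Suc n)\<bar>)" using summable_ignore_initial_segment[OF xs, of "Suc n"] .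
    have "\<bar>\<Sum>l. x (l + Suc n)\<bar> \<le> (\<Sum>l. \<bar>x (l + Suc n)\<bar>)" by (rule summable_rabs[OF s2])
    also have "\<dots> \<le> (\<Sum>l. (1/2) ^ l)" by (rule suminf_le[OF t s2 geo(1)])
    finally show ?thesis using geo(2) by simp
  qed
  have "\<bar>x n\<bar> > real n + S n + 2" using big[of n] c0[of n] by (simp add: x_def abs_mult divide_less_eq mult.commute)
  then have "\<bar>\<Sum>l. x l\<bar> > real n" unfolding split using h1 h2 by linarith
  then show False using K[OF I(1), of n] n by (simp add: x_def)
qed

lemma summable_mult_bounded:
  fixes a b :: "nat \<Rightarrow> real"
  assumes "summable (\<lambda>n. \<bar>a n\<bar>)" "\<And>n. \<bar>b n\<bar> \<le> B"
  shows "summable (\<lambda>n. a n * b n)"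
proof (rule summable_comparison_test'[OF summable_mult2[OF assms(1), of B], of 0])
  fix n show "norm (a n * b n) \<le> \<bar>a n\<bar> * B" using assms(2)[of n] by (simp add: abs_mult mult_left_mono)
qed

text \<open>Regard the normalised mixed differences as a matrix with rows (v, e) and columns (u, d).
  A row is bounded because it involves h at finitely many v only. Summing columns with absolutely
  summable weights is a functional in u, smooth on nice families by \<open>mfd_bound\<close>;
  applied to h it gives a smooth function of v whose normalised differences are the weighted row
  sums. \<open>gliding_hump\<close> then bounds all entries at once.\<close>

lemma weakly_smooth_mfd_bound:
  assumes h: "\<And>v. smooth_rr (\<lambda>u. h u v)"
    and Phi: "\<And>\<Phi>. (\<And>k. nice k \<Longrightarrow> smooth_rr (\<lambda>v. \<Phi> (\<lambda>u. k u v))) \<Longrightarrow> smooth_rr (\<lambda>v. \<Phi> (\<lambda>u. h u v))"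
  shows "\<exists>C. \<forall>u v d e. \<bar>u\<bar> \<le> R \<and> \<bar>v\<bar> \<le> R \<and> 0 < d \<and> d \<le> 1 \<and> 0 < e \<and> e \<le> 1 \<longrightarrow> \<bar>mfd m d j e h u v\<bar> \<le> C * (d ^ m * e ^ j)"
proof -
  define J where "J = {(u, d). \<bar>u\<bar> \<le> R \<and> 0 < d \<and> d \<le> (1::real)}"
  define q where "q p x = (1 / snd x ^ m) * (fd (snd x) ^^ m) p (fst x)" for p :: "real \<Rightarrow> real" and x :: "real \<times> real"
  define L where "L i x = (1 / snd i ^ j) * (fd (snd i) ^^ j) (\<lambda>v. q (\<lambda>u. h u v) x) (fst i)" for i x :: "real \<times> real"
  have qb: "\<exists>B. \<forall>x\<in>J. \<bar>q (\<lambda>u. h u v) x\<bar> \<le> B" for v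
  proof -
    obtain B where B: "\<And>u d. \<bar>u\<bar> \<le> R \<Longrightarrow> 0 < d \<Longrightarrow> d \<le> 1 \<Longrightarrow> \<bar>(fd d ^^ m) (\<lambda>u. h u v) u\<bar> \<le> B * d ^ m"
      using smooth_bfd[OF h, unfolded bfd_def, rule_format, of R m] by blast
    have "\<bar>q (\<lambda>u. h u v) x\<bar> \<le> B" if "x \<in> J" for x
      using B[of "fst x" "snd x"] that by (auto simp: J_def q_def abs_mult divide_le_eq)
    then show ?thesis by blast
  qed
  have mq: "(fd e ^^ j') (\<lambda>v. q (\<lambda>u. k u v) x) v = (1 / snd x ^ m) * mfd m (snd x) j' e k (fst x) v" for e j' k x v
    unfolding q_def fd_pow_scale mfd_def ..
  have "\<exists>K. \<forall>i\<in>J. \<forall>x\<in>J. \<bar>L i x\<bar> \<le> K"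
  proof (rule gliding_hump)
    fix i assume "i \<in> J"
    then have d: "snd i > 0" by (auto simp: J_def)
    obtain B where B: "\<forall>x\<in>J. \<bar>(fd (snd i) ^^ j) (\<lambda>v. q (\<lambda>u. h u v) x) (fst i)\<bar> \<le> B"
      using fd_pow_bounded_family[where g = "\<lambda>x v. q (\<lambda>u. h u v) x", OF qb] by blast
    have "\<bar>L i x\<bar> \<le> (1 / snd i ^ j) * B" if "x \<in> J" for x
    proof -
      have "\<bar>L i x\<bar> = (1 / snd i ^ j) * \<bar>(fd (snd i) ^^ j) (\<lambda>v. q (\<lambda>u. h u v) x) (fst i)\<bar>"
        using d by (simp add: L_def abs_mult)
      also have "\<dots> \<le> (1 / snd i ^ j) * B" using B that d by (intro mult_left_mono) auto
      finally show ?thesis .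
    qed
    then show "\<exists>B. \<forall>x\<in>J. \<bar>L i x\<bar> \<le> B" by blast
  next
    fix a :: "nat \<Rightarrow> real" and f :: "nat \<Rightarrow> real \<times> real"
    assume a: "summable (\<lambda>n. \<bar>a n\<bar>)" and f: "\<And>n. f n \<in> J"
    define \<Phi> where "\<Phi> p = (\<Sum>n. a n * q p (f n))" for p
    have "smooth_rr (\<lambda>v. \<Phi> (\<lambda>u. k u v))" if k: "nice k" for k
      unfolding \<Phi>_def
    proof (rule smooth_series(2)[OF a])
      fix j' R'
      obtain C where C: "\<And>u v d e. \<bar>u\<bar> \<le> max R R' \<Longrightarrow> \<bar>v\<bar> \<le> max R R' \<Longrightarrow> 0 < d \<Longrightarrow> d \<le> 1 \<Longrightarrow> 0 < e \<Longrightarrow> e \<le> 1 \<Longrightarrow> \<bar>mfd m d j' e k u v\<bar> \<le> C * (d ^ m * e ^ j')"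
        using mfd_bound[OF k, of "max R R'" m j'] by blast
      have "\<bar>(fd e ^^ j') (\<lambda>v. q (\<lambda>u. k u v) (f n)) v\<bar> \<le> C * e ^ j'" if "\<bar>v\<bar> \<le> R'" "0 < e" "e \<le> 1" for n v e
      proof -
        have d: "\<bar>fst (f n)\<bar> \<le> R" "snd (f n) > 0" "snd (f n) \<le> 1" using f[of n] by (auto simp: J_def)
        have "\<bar>mfd m (snd (f n)) j' e k (fst (f n)) v\<bar> \<le> C * (snd (f n) ^ m * e ^ j')"
          by (rule C) (use that d in auto)
        then show ?thesis unfolding mq using d by (simp add: abs_mult divide_le_eq mult_ac)
      qed
      then show "\<exists>C. \<forall>n v e. \<bar>v\<bar> \<le> R' \<and> 0 < e \<and> e \<le> 1 \<longrightarrow> \<bar>(fd e ^^ j') (\<lambda>v. q (\<lambda>u. k u v) (f n)) v\<bar> \<le> C * e ^ j'" by blast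
    qed
    then have "smooth_rr (\<lambda>v. \<Phi> (\<lambda>u. h u v))" by (rule Phi)
    from smooth_bfd[OF this, unfolded bfd_def, rule_format, of R j]
    obtain K where K: "\<And>v e. \<bar>v\<bar> \<le> R \<Longrightarrow> 0 < e \<Longrightarrow> e \<le> 1 \<Longrightarrow> \<bar>(fd e ^^ j) (\<lambda>v. \<Phi> (\<lambda>u. h u v)) v\<bar> \<le> K * e ^ j" by blast
    \<comment> \<open>For h no bound uniform in v is known yet; here convergence is needed at each v
      separately.\<close>
    have sm: "(\<lambda>n. a n * q (\<lambda>u. h u v) (f n)) sums \<Phi> (\<lambda>u. h u v)" for v
    proof -
      obtain B where "\<forall>x\<in>J. \<bar>q (\<lambda>u. h u v) x\<bar> \<le> B" using qb by blast
      then have "\<bar>q (\<lambda>u. h u v) (f n)\<bar> \<le> B" for n using f by blast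
      from summable_mult_bounded[OF a this] show ?thesis unfolding \<Phi>_def by (rule summable_sums)
    qed
    have "\<bar>\<Sum>n. a n * L i (f n)\<bar> \<le> K" if "i \<in> J" for i
    proof -
      have d: "\<bar>fst i\<bar> \<le> R" "snd i > 0" "snd i \<le> 1" using that by (auto simp: J_def)
      have "(\<lambda>n. (fd (snd i) ^^ j) (\<lambda>v. a n * q (\<lambda>u. h u v) (f n)) (fst i)) sums (fd (snd i) ^^ j) (\<lambda>v. \<Phi> (\<lambda>u. h u v)) (fst i)"
        by (rule fd_pow_sums[OF sm])
      from sums_mult[OF this, of "1 / snd i ^ j"]
      have "(\<Sum>n. a n * L i (f n)) = (1 / snd i ^ j) * (fd (snd i) ^^ j) (\<lambda>v. \<Phi> (\<lambda>u. h u v)) (fst i)"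
        unfolding fd_pow_scale L_def by (simp add: sums_iff mult.left_commute)
      then show ?thesis using K[OF d] d by (simp add: abs_mult divide_le_eq)
    qed
    then show "\<exists>K. \<forall>i\<in>J. \<bar>\<Sum>n. a n * L i (f n)\<bar> \<le> K" by blast
  qed
  then obtain K where K: "\<And>i x. i \<in> J \<Longrightarrow> x \<in> J \<Longrightarrow> \<bar>L i x\<bar> \<le> K" by blast
  have "\<bar>mfd m d j e h u v\<bar> \<le> K * (d ^ m * e ^ j)"
    if H: "\<bar>u\<bar> \<le> R" "\<bar>v\<bar> \<le> R" "0 < d" "d \<le> 1" "0 < e" "e \<le> 1" for u v d e
  proof -
    have "\<bar>L (v, e) (u, d)\<bar> \<le> K" by (rule K) (use H in \<open>auto simp: J_def\<close>)
    moreover have "L (v, e) (u, d) = mfd m d j e h u v / (d ^ m * e ^ j)"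
      unfolding L_def mq by simp
    ultimately show ?thesis using H by (simp add: abs_divide divide_le_eq abs_mult)
  qed
  then show ?thesis by blast
qed

text \<open>A diagonal difference is the sum of a difference in u and one in v, the former taken at
  a v larger by d. These shifts accumulate in the offset c, and n steps produce 2^n mixed
  differences of total order M.\<close>

lemma diagonal_fd_bound:
  assumes C: "\<And>a b u v. a + b = M \<Longrightarrow> \<bar>u\<bar> \<le> R \<Longrightarrow> \<bar>v\<bar> \<le> R \<Longrightarrow> \<bar>mfd a d b d h u v\<bar> \<le> C" and d: "d \<ge> 0"
  shows "n + a + b = M \<Longrightarrow> - R \<le> r \<Longrightarrow> c \<ge> 0 \<Longrightarrow> r + c + real n * d \<le> R
     \<Longrightarrow> \<bar>(fd d ^^ n) (\<lambda>r. mfd a d b d h r (r + c)) r\<bar> \<le> 2 ^ n * C"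
proof (induction n arbitrary: a b r c)
  case 0
  then show ?case using C[of a b r "r + c"] by simp
next
  case (Suc n)
  have nd: "0 \<le> real n * d" using d by simp
  have eq: "fd d (\<lambda>r. mfd a d b d h r (r + c)) = (\<lambda>r. mfd (Suc a) d b d h r (r + (c + d)) + mfd a d (Suc b) d h r (r + c))"
    unfolding mfd_Suc1 mfd_Suc2 by (auto simp: fd_def algebra_simps)
  have "\<bar>(fd d ^^ n) (\<lambda>r. mfd (Suc a) d b d h r (r + (c + d))) r\<bar> \<le> 2 ^ n * C"
    by (rule Suc.IH) (use Suc.prems d in \<open>auto simp: algebra_simps\<close>)
  moreover have "\<bar>(fd d ^^ n) (\<lambda>r. mfd a d (Suc b) d h r (r + c)) r\<bar> \<le> 2 ^ n * C"
    by (rule Suc.IH) (use Suc.prems d in \<open>auto simp: algebra_simps\<close>)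
  ultimately show ?case unfolding fd_pow_Suc eq fd_pow_add by (simp add: abs_le_iff)
qed

text \<open>A curve in \<open>C\<^sup>\<infinity>(\<real>, \<real>)\<close> that is smooth after applying every smooth functional is jointly smooth
  (Lawvere, Schanuel, Zame): this makes Froelicher spaces cartesian closed. Only the diagonal is
  needed, since \<open>h\<close> may be reparametrised in both variables.\<close>
theorem weakly_smooth_diagonal:
  assumes h: "\<And>v. smooth_rr (\<lambda>u. h u v)"
    and Phi: "\<And>\<Phi>. (\<And>k. nice k \<Longrightarrow> smooth_rr (\<lambda>v. \<Phi> (\<lambda>u. k u v))) \<Longrightarrow> smooth_rr (\<lambda>v. \<Phi> (\<lambda>u. h u v))"
  shows "smooth_rr (\<lambda>r. h r r)"
proof (rule bfd_smooth, unfold bfd_def, intro allI)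
  fix M R
  define R' where "R' = \<bar>R\<bar> + real M"
  have "\<exists>C. \<forall>u v d e. \<bar>u\<bar> \<le> R' \<and> \<bar>v\<bar> \<le> R' \<and> 0 < d \<and> d \<le> 1 \<and> 0 < e \<and> e \<le> 1 \<longrightarrow> \<bar>mfd a d b e h u v\<bar> \<le> C * (d ^ a * e ^ b)" for a b
  proof (rule weakly_smooth_mfd_bound)
    fix \<Phi> :: "(real \<Rightarrow> real) \<Rightarrow> real"
    assume "\<And>k. nice k \<Longrightarrow> smooth_rr (\<lambda>v. \<Phi> (\<lambda>u. k u v))"
    then show "smooth_rr (\<lambda>v. \<Phi> (\<lambda>u. h u v))" by (rule Phi)
  qed (rule h)
  then obtain c where c: "\<And>a b u v d e. \<bar>u\<bar> \<le> R' \<Longrightarrow> \<bar>v\<bar> \<le> R' \<Longrightarrow> 0 < d \<Longrightarrow> d \<le> 1 \<Longrightarrow> 0 < e \<Longrightarrow> e \<le> 1 \<Longrightarrow> \<bar>mfd a d b e h u v\<bar> \<le> c a b * (d ^ a * e ^ b)"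
    by metis
  define C where "C = (\<Sum>a\<le>M. \<bar>c a (M - a)\<bar>)"
  have "\<bar>(fd d ^^ M) (\<lambda>r. h r r) x\<bar> \<le> 2 ^ M * C * d ^ M" if H: "\<bar>x\<bar> \<le> R" "0 < d" "d \<le> 1" for x d
  proof -
    have Md: "real M * d \<le> real M" using H by (simp add: mult_left_le)
    have "\<bar>(fd d ^^ M) (\<lambda>r. mfd 0 d 0 d h r (r + 0)) x\<bar> \<le> 2 ^ M * (C * d ^ M)"
    proof (rule diagonal_fd_bound[where R = R' and M = M])
      fix a b u v assume ab: "a + b = M" and uv: "\<bar>u\<bar> \<le> R'" "\<bar>v\<bar> \<le> R'"
      have b: "b = M - a" "a \<in> {..M}" using ab by auto
      have "\<bar>mfd a d b d h u v\<bar> \<le> c a b * (d ^ a * d ^ b)" by (rule c) (use uv H in auto)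
      also have "\<dots> = c a b * d ^ M" using ab by (simp add: power_add[symmetric])
      also have "\<dots> \<le> C * d ^ M"
      proof (rule mult_right_mono)
        have "\<bar>c a (M - a)\<bar> \<le> C" unfolding C_def by (rule member_le_sum[OF b(2)]) auto
        then show "c a b \<le> C" using b(1) by simp
      qed (use H in simp)
      finally show "\<bar>mfd a d b d h u v\<bar> \<le> C * d ^ M" .
    qed (use H Md in \<open>auto simp: R'_def\<close>)
    then show ?thesis by (simp add: mfd_def mult.assoc)
  qed
  then show "\<exists>C. \<forall>x d. \<bar>x\<bar> \<le> R \<and> 0 < d \<and> d \<le> 1 \<longrightarrow> \<bar>(fd d ^^ M) (\<lambda>r. h r r) x\<bar> \<le> C * d ^ M" by blast
qed

section \<open>Froelicher spaces and their curves\<close>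

lemma crv_iff: "frolicher S \<Longrightarrow> c \<in> crv S \<longleftrightarrow> (\<forall>r. c r \<in> carr S) \<and> (\<forall>f\<in>fns S. smooth_rr (\<lambda>r. f (c r)))"
  unfolding frolicher_def o_def by blast

lemma fns_iff: "frolicher S \<Longrightarrow> f \<in> fns S \<longleftrightarrow> (\<forall>c\<in>crv S. smooth_rr (\<lambda>r. f (c r)))"
  unfolding frolicher_def o_def by blast

lemma crv_carr: "frolicher S \<Longrightarrow> c \<in> crv S \<Longrightarrow> c r \<in> carr S"
  by (simp add: crv_iff)

lemma crv_const: "frolicher S \<Longrightarrow> x \<in> carr S \<Longrightarrow> (\<lambda>_. x) \<in> crv S"
  by (simp add: crv_iff smooth_const)

lemma crv_reparam: "frolicher S \<Longrightarrow> c \<in> crv S \<Longrightarrow> smooth_rr s \<Longrightarrow> (\<lambda>r. c (s r)) \<in> crv S"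
proof -
  assume "frolicher S" "c \<in> crv S" "smooth_rr s"
  moreover from this have "smooth_rr (\<lambda>r. f (c (s r)))" if "f \<in> fns S" for f
    using smooth_comp[of "\<lambda>r. f (c r)" s] that by (simp add: crv_iff)
  ultimately show ?thesis by (simp add: crv_iff)
qed

lemma crv_local:
  assumes T: "frolicher T"
    and loc: "\<And>x. \<exists>c d. d > 0 \<and> c \<in> crv T \<and> (\<forall>y. \<bar>y - x\<bar> < d \<longrightarrow> k y = c y)"
  shows "k \<in> crv T"
proof -
  have "k r \<in> carr T" for r
  proof -
    obtain c d where "d > 0" "c \<in> crv T" "\<forall>y. \<bar>y - r\<bar> < d \<longrightarrow> k y = c y" using loc by blast
    then show ?thesis using crv_carr[OF T] by auto
  qed
  moreover have "smooth_rr (\<lambda>r. f (k r))" if "f \<in> fns T" for f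
  proof (rule smooth_local)
    fix x
    obtain c d where c: "d > 0" "c \<in> crv T" "\<forall>y. \<bar>y - x\<bar> < d \<longrightarrow> k y = c y" using loc by blast
    have "smooth_rr (\<lambda>r. f (c r))" using c(2) that by (simp add: crv_iff[OF T])
    with c show "\<exists>g d. 0 < d \<and> smooth_rr g \<and> (\<forall>y. \<bar>y - x\<bar> < d \<longrightarrow> f (k y) = g y)"
      by (intro exI[of _ "\<lambda>r. f (c r)"] exI[of _ d]) simp
  qed
  ultimately show ?thesis by (simp add: crv_iff[OF T])
qed

lemma isCont_real_nbhd:
  fixes f :: "real \<Rightarrow> real"
  assumes "isCont f x" "open U" "f x \<in> U"
  shows "\<exists>d>0. \<forall>y. \<bar>y - x\<bar> < d \<longrightarrow> f y \<in> U"
proof -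
  have "eventually (\<lambda>y. f y \<in> U) (at x)"
    using topological_tendstoD[OF assms(1)[unfolded isCont_def] assms(2,3)] .
  then obtain d where d: "d > 0" "\<And>y. y \<noteq> x \<Longrightarrow> \<bar>y - x\<bar> < d \<Longrightarrow> f y \<in> U"
    unfolding eventually_at dist_real_def by blast
  have "f y \<in> U" if "\<bar>y - x\<bar> < d" for y using d(2) that assms(3) by (cases "y = x") auto
  with d(1) show ?thesis by blast
qed

text \<open>The sets where \<tau> < 1 and where \<tau> > 0 form an open cover of the line. A smooth
  function describes it because some of the coordinates involved are curves in the flattened
  interval, which are accessible through functions flat at the ends.\<close>

lemma crv_glue:
  assumes T: "frolicher T" and \<tau>: "smooth_rr \<tau>" and c: "c1 \<in> crv T" "c2 \<in> crv T"
    and k: "\<And>r. \<tau> r < 1 \<Longrightarrow> k r = c1 r" "\<And>r. \<tau> r > 0 \<Longrightarrow> k r = c2 r"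
  shows "k \<in> crv T"
proof (rule crv_local[OF T])
  fix x
  show "\<exists>c d. d > 0 \<and> c \<in> crv T \<and> (\<forall>y. \<bar>y - x\<bar> < d \<longrightarrow> k y = c y)"
  proof (cases "\<tau> x < 1")
    case True
    then obtain d where "d > 0" "\<forall>y. \<bar>y - x\<bar> < d \<longrightarrow> \<tau> y \<in> {..<1}"
      using isCont_real_nbhd[OF smooth_cont[OF \<tau>], of "{..<1}" x] by auto
    then show ?thesis using k(1) c(1) by (intro exI[of _ c1] exI[of _ d]) auto
  next
    case False
    then obtain d where "d > 0" "\<forall>y. \<bar>y - x\<bar> < d \<longrightarrow> \<tau> y \<in> {0<..}"
      using isCont_real_nbhd[OF smooth_cont[OF \<tau>], of "{0<..}" x] by auto
    then show ?thesis using k(2) c(2) by (intro exI[of _ c2] exI[of _ d]) auto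
  qed
qed

lemma smooth_mapI:
  assumes S: "frolicher S" and T: "frolicher T" and c: "\<And>c. c \<in> crv S \<Longrightarrow> (\<lambda>r. \<phi> (c r)) \<in> crv T"
  shows "smooth_map S T \<phi>"
proof -
  have "\<phi> x \<in> carr T" if "x \<in> carr S" for x
    using crv_carr[OF T c[OF crv_const[OF S that]]] .
  moreover have "g \<circ> \<phi> \<in> fns S" if "g \<in> fns T" for g
    unfolding fns_iff[OF S] using c that by (auto simp: crv_iff[OF T])
  ultimately show ?thesis unfolding smooth_map_def by blast
qed

lemma smooth_mapD:
  assumes S: "frolicher S" and T: "frolicher T" and "smooth_map S T \<phi>" "c \<in> crv S"
  shows "(\<lambda>r. \<phi> (c r)) \<in> crv T"
  unfolding crv_iff[OF T]
proof (intro conjI allI ballI)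
  show "\<phi> (c r) \<in> carr T" for r using assms crv_carr[OF S] by (simp add: smooth_map_def)
  fix g assume "g \<in> fns T"
  then have "g \<circ> \<phi> \<in> fns S" using assms by (simp add: smooth_map_def)
  then show "smooth_rr (\<lambda>r. g (\<phi> (c r)))" using assms(4) by (simp add: fns_iff[OF S])
qed

text \<open>Passing between functions and curves is a Galois connection, so going from functions to
  curves and back already reaches a fixed pair.\<close>

lemma frolicher_closure:
  assumes "C = {c. range c \<subseteq> X \<and> (\<forall>f\<in>F. smooth_rr (f \<circ> c))}"
  shows "frolicher \<lparr>carr = X, crv = C, fns = {f. \<forall>c\<in>C. smooth_rr (f \<circ> c)}\<rparr>"
proof -
  have "c \<in> C" if "range c \<subseteq> X" "\<forall>f\<in>{f. \<forall>c\<in>C. smooth_rr (f \<circ> c)}. smooth_rr (f \<circ> c)" for c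
  proof -
    have "F \<subseteq> {f. \<forall>c\<in>C. smooth_rr (f \<circ> c)}" using assms by auto
    then show ?thesis using that assms by blast
  qed
  then show ?thesis unfolding frolicher_def using assms by auto
qed

lemma frolicher_gen_fns: "frolicher (gen_fns X F)"
  unfolding gen_fns_def Let_def by (rule frolicher_closure[OF refl])

lemma carr_gen_fns [simp]: "carr (gen_fns X F) = X"
  by (simp add: gen_fns_def Let_def)

lemma crv_gen_fns: "c \<in> crv (gen_fns X F) \<longleftrightarrow> (\<forall>r. c r \<in> X) \<and> (\<forall>f\<in>F. smooth_rr (\<lambda>r. f (c r)))"
  by (simp add: gen_fns_def Let_def o_def image_subset_iff)

lemma frolicher_gen_crv: "frolicher (gen_crv X C0)"
  unfolding gen_crv_def Let_def by (rule frolicher_closure[OF refl])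

lemma carr_gen_crv [simp]: "carr (gen_crv X C0) = X"
  by (simp add: gen_crv_def Let_def)

lemma crv_gen_crv:
  "c \<in> crv (gen_crv X C0) \<longleftrightarrow> (\<forall>r. c r \<in> X) \<and>
     (\<forall>f. (\<forall>c\<in>C0. smooth_rr (\<lambda>r. f (c r))) \<longrightarrow> smooth_rr (\<lambda>r. f (c r)))"
  by (simp add: gen_crv_def Let_def o_def image_subset_iff)

lemma crv_gen_crvI: "c \<in> C0 \<Longrightarrow> (\<And>r. c r \<in> X) \<Longrightarrow> c \<in> crv (gen_crv X C0)"
  by (simp add: crv_gen_crv)

text \<open>Products preserve final structures.\<close>
lemma final_param:
  assumes B: "frolicher B" and T: "frolicher T"
    and cover: "\<And>x. x \<in> X \<Longrightarrow> \<exists>c\<in>C0. \<exists>v. c v = x"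
    and K: "\<And>p c t. p \<in> crv B \<Longrightarrow> c \<in> C0 \<Longrightarrow> smooth_rr t \<Longrightarrow> (\<lambda>r. K (p r) (c (t r))) \<in> crv T"
    and p: "p \<in> crv B" and c: "c \<in> crv (gen_crv X C0)"
  shows "(\<lambda>r. K (p r) (c r)) \<in> crv T"
  unfolding crv_iff[OF T]
proof (intro conjI allI ballI)
  fix r
  obtain c0 v where c0: "c0 \<in> C0" "c0 v = c r" using cover c unfolding crv_gen_crv by metis
  show "K (p r) (c r) \<in> carr T"
    using crv_carr[OF T K[OF p c0(1) smooth_const[of v]], of r] c0(2) by simp
next
  fix g assume g: "g \<in> fns T"
  have Kg: "smooth_rr (\<lambda>r. g (K (p (s r)) (c0 (t r))))" if "c0 \<in> C0" "smooth_rr s" "smooth_rr t" for c0 s t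
    using K[OF crv_reparam[OF B p that(2)] that(1,3)] g by (simp add: crv_iff[OF T])
  show "smooth_rr (\<lambda>r. g (K (p r) (c r)))"
  \<comment> \<open>The time u of p is separated from the time v of c, and c becomes a curve of
    functions of u. It need not lift to the generating curves.\<close>
  proof (rule weakly_smooth_diagonal[where h = "\<lambda>u v. g (K (p u) (c v))"])
    fix v
    obtain c0 w where c0: "c0 \<in> C0" "c0 w = c v" using cover c unfolding crv_gen_crv by metis
    show "smooth_rr (\<lambda>u. g (K (p u) (c v)))"
      using Kg[OF c0(1) smooth_id smooth_const[of w]] c0(2) by simp
  next
    fix \<Phi> :: "(real \<Rightarrow> real) \<Rightarrow> real"
    assume \<Phi>: "\<And>k. nice k \<Longrightarrow> smooth_rr (\<lambda>v. \<Phi> (\<lambda>u. k u v))"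
    \<comment> \<open>Along a generating curve the family is nice, so
      \<open>\<lambda>x. \<Phi> (\<lambda>u. g (K (p u) x))\<close> is a test function for the final
      structure and hence smooth along c as well.\<close>
    have "smooth_rr (\<lambda>v. \<Phi> (\<lambda>u. g (K (p u) (c0 v))))" if "c0 \<in> C0" for c0
      by (rule \<Phi>) (use Kg that in \<open>simp add: nice_def\<close>)
    then show "smooth_rr (\<lambda>v. \<Phi> (\<lambda>u. g (K (p u) (c v))))"
      using c[unfolded crv_gen_crv, THEN conjunct2, rule_format, of "\<lambda>x. \<Phi> (\<lambda>u. g (K (p u) x))"] by simp
  qed
qed

lemma frolicher_prodsp: "frolicher (prodsp S T)"
  unfolding prodsp_def by (rule frolicher_gen_fns)

lemma carr_prodsp [simp]: "carr (prodsp S T) = carr S \<times> carr T"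
  by (simp add: prodsp_def)

lemma crv_prodsp:
  assumes "frolicher S" "frolicher T"
  shows "c \<in> crv (prodsp S T) \<longleftrightarrow> (\<lambda>r. fst (c r)) \<in> crv S \<and> (\<lambda>r. snd (c r)) \<in> crv T"
proof -
  have "(\<forall>f\<in>{f \<circ> fst |f. f \<in> fns S} \<union> {g \<circ> snd |g. g \<in> fns T}. smooth_rr (\<lambda>r. f (c r))) \<longleftrightarrow>
      (\<forall>f\<in>fns S. smooth_rr (\<lambda>r. f (fst (c r)))) \<and> (\<forall>g\<in>fns T. smooth_rr (\<lambda>r. g (snd (c r))))"
    by (auto simp: ball_Un o_def)
  then show ?thesis
    unfolding prodsp_def crv_gen_fns crv_iff[OF assms(1)] crv_iff[OF assms(2)] mem_Times_iff by blast
qed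

section \<open>The real line and the two unit intervals\<close>

lemma crv_realsp: "c \<in> crv realsp \<longleftrightarrow> smooth_rr c"
  by (simp add: realsp_def crv_gen_fns)

lemma frolicher_realsp: "frolicher realsp"
  unfolding realsp_def by (rule frolicher_gen_fns)

lemma fns_realsp: "f \<in> fns realsp \<longleftrightarrow> smooth_rr f"
proof
  show "f \<in> fns realsp \<Longrightarrow> smooth_rr f"
    using fns_iff[OF frolicher_realsp, of f] crv_realsp[of "\<lambda>r. r"] smooth_id by auto
  show "smooth_rr f \<Longrightarrow> f \<in> fns realsp"
    by (simp add: fns_iff[OF frolicher_realsp] crv_realsp smooth_comp[of f])
qed

lemma frolicher_Isp: "frolicher Isp"
  unfolding Isp_def Defs.subspace_def by (rule frolicher_gen_fns)

lemma carr_Isp [simp]: "carr Isp = {0..1}"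
  by (simp add: Isp_def Defs.subspace_def)

lemma crv_Isp: "c \<in> crv Isp \<longleftrightarrow> smooth_rr c \<and> (\<forall>r. 0 \<le> c r \<and> c r \<le> 1)"
proof
  assume "c \<in> crv Isp"
  then show "smooth_rr c \<and> (\<forall>r. 0 \<le> c r \<and> c r \<le> 1)"
    unfolding Isp_def Defs.subspace_def crv_gen_fns using smooth_id[folded fns_realsp] by auto
next
  assume "smooth_rr c \<and> (\<forall>r. 0 \<le> c r \<and> c r \<le> 1)"
  then show "c \<in> crv Isp"
    unfolding Isp_def Defs.subspace_def crv_gen_fns by (simp add: fns_realsp smooth_comp)
qed

lemma frolicher_boldI: "frolicher boldI"
  unfolding boldI_def by (rule frolicher_gen_fns)

lemma carr_boldI [simp]: "carr boldI = {0..1}"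
  by (simp add: boldI_def)

lemma boldI_range: "c \<in> crv boldI \<Longrightarrow> 0 \<le> c r \<and> c r \<le> 1"
  using crv_carr[OF frolicher_boldI] by auto

lemma crv_Isp_boldI: "c \<in> crv Isp \<Longrightarrow> c \<in> crv boldI"
  unfolding boldI_def crv_gen_fns using crv_carr[OF frolicher_Isp, of c] by (auto simp: fns_iff[OF frolicher_Isp])

lemma boldI_flat:
  assumes s: "smooth_rr s" and e: "\<epsilon> > 0" "\<And>t. 0 \<le> t \<Longrightarrow> t < \<epsilon> \<Longrightarrow> s t = s 0" "\<And>t. 1 - \<epsilon> < t \<Longrightarrow> t \<le> 1 \<Longrightarrow> s t = s 1"
    and c: "c \<in> crv boldI"
  shows "smooth_rr (\<lambda>r. s (c r))"
proof -
  have "s \<in> fns Isp" unfolding fns_iff[OF frolicher_Isp]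
    by (simp add: crv_Isp smooth_comp[OF s])
  moreover have "\<exists>\<epsilon>. 0 < \<epsilon> \<and> \<epsilon> < 1/4 \<and> (\<forall>t. 0 \<le> t \<and> t < \<epsilon> \<longrightarrow> s t = s 0) \<and> (\<forall>t. 1 - \<epsilon> < t \<and> t \<le> 1 \<longrightarrow> s t = s 1)"
    \<comment> \<open>The generating functions of \<open>boldI\<close> are constant up to some
      \<epsilon> below 1/4.\<close>
    by (intro exI[of _ "min \<epsilon> (1/8)"] conjI allI impI)
       (use e(1) in simp, simp, rule e(2), simp, simp, rule e(3), auto simp: min_def split: if_splits)
  ultimately show ?thesis using c unfolding boldI_def crv_gen_fns by blast
qed

text \<open>A smooth map from the flattened to the ordinary interval that fixes the end points.
  Composing with it allows a homotopy parametrised by I to be used along a flattened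
  coordinate.\<close>

definition mid_step :: "real \<Rightarrow> real" where "mid_step = smooth_step (1/4) (3/4)"

lemma mid_step_range: "0 \<le> mid_step t" "mid_step t \<le> 1"
  by (simp_all add: mid_step_def smooth_step_range)

lemma mid_step_0: "t \<le> 1/4 \<Longrightarrow> mid_step t = 0"
  by (simp add: mid_step_def smooth_step_0)

lemma mid_step_1: "3/4 \<le> t \<Longrightarrow> mid_step t = 1"
  by (simp add: mid_step_def smooth_step_1)

lemma mid_step_ends [simp]: "mid_step 0 = 0" "mid_step 1 = 1"
  by (simp_all add: mid_step_0 mid_step_1)

lemma boldI_smooth_step:
  assumes "0 < a" "a < b" "b < 1" "c \<in> crv boldI"
  shows "smooth_rr (\<lambda>r. smooth_step a b (c r))"
  by (rule boldI_flat[where \<epsilon> = "min a (1 - b)", OF smooth_smooth_step])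
     (use assms in \<open>auto simp: smooth_step_0 smooth_step_1\<close>)

lemma crv_mid_step: "c \<in> crv boldI \<Longrightarrow> (\<lambda>r. mid_step (c r)) \<in> crv Isp"
  using boldI_smooth_step[of "1/4" "3/4" c] by (simp add: crv_Isp mid_step_range flip: mid_step_def)

lemma convex_unit: "0 \<le> r \<Longrightarrow> r \<le> 1 \<Longrightarrow> 0 \<le> a \<Longrightarrow> a \<le> 1 \<Longrightarrow> 0 \<le> b \<Longrightarrow> b \<le> (1::real) \<Longrightarrow> 0 \<le> (1 - r) * a + r * b \<and> (1 - r) * a + r * b \<le> 1"
  using convex_bound_le[of a 1 b "1 - r" r] by (auto intro!: add_nonneg_nonneg mult_nonneg_nonneg)

text \<open>The straight-line homotopy from the identity of the flattened interval to \<open>mid_step\<close>. A curve in the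
  flattened interval need not be smooth while near the end points, but there the test function is
  constant; away from them the curve agrees with a smooth one.\<close>
lemma crv_flatten_homotopy:
  assumes s: "s \<in> crv Isp" and c: "c \<in> crv boldI"
  shows "(\<lambda>r. (1 - s r) * c r + s r * mid_step (c r)) \<in> crv boldI"
proof -
  let ?m = "\<lambda>r. (1 - s r) * c r + s r * mid_step (c r)"
  have s': "smooth_rr s" "\<And>r. 0 \<le> s r" "\<And>r. s r \<le> 1" using s by (auto simp: crv_Isp)
  have "smooth_rr (\<lambda>r. g (?m r))"
    if g: "g \<in> fns Isp" and e: "0 < \<epsilon>" "\<epsilon> < 1/4" "\<And>t. 0 \<le> t \<and> t < \<epsilon> \<Longrightarrow> g t = g 0" "\<And>t. 1 - \<epsilon> < t \<and> t \<le> 1 \<Longrightarrow> g t = g 1" for g \<epsilon>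
  proof (rule smooth_local)
    fix x
    \<comment> \<open>With \<eta> < \<epsilon> the regions near 0, near 1 and in between overlap: g
      is constant along the homotopy for values of c below \<epsilon> or above 1 - \<epsilon>, and
      the middle region reaches down to \<eta> and up to 1 - \<eta>.\<close>
    define \<eta> where "\<eta> = \<epsilon> / 2"
    have \<eta>: "0 < \<eta>" "\<eta> < \<epsilon>" "\<eta> < 1/4" using e by (auto simp: \<eta>_def)
    have b1: "smooth_rr (\<lambda>r. smooth_step \<eta> \<epsilon> (c r))" and b2: "smooth_rr (\<lambda>r. smooth_step (1 - \<epsilon>) (1 - \<eta>) (c r))"
      by (rule boldI_smooth_step[OF _ _ _ c]; use e \<eta> in simp)+
    have b3: "smooth_rr (\<lambda>r. smooth_step (\<eta>/2) \<eta> (c r))" and b4: "smooth_rr (\<lambda>r. smooth_step (1 - \<eta>) (1 - \<eta>/2) (c r))"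
      by (rule boldI_smooth_step[OF _ _ _ c]; use e \<eta> in simp)+
    consider "smooth_step \<eta> \<epsilon> (c x) < 1" | "smooth_step (1 - \<epsilon>) (1 - \<eta>) (c x) > 0"
      | "smooth_step \<eta> \<epsilon> (c x) > 0" "smooth_step (1 - \<epsilon>) (1 - \<eta>) (c x) < 1" by linarith
    then show "\<exists>f d. d > 0 \<and> smooth_rr f \<and> (\<forall>y. \<bar>y - x\<bar> < d \<longrightarrow> g (?m y) = f y)"
    proof cases
      case 1
      then obtain d where d: "d > 0" "\<And>y. \<bar>y - x\<bar> < d \<Longrightarrow> smooth_step \<eta> \<epsilon> (c y) < 1"
        using isCont_real_nbhd[OF smooth_cont[OF b1], of "{..<1}" x] by auto
      have "g (?m y) = g 0" if "\<bar>y - x\<bar> < d" for y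
      proof (rule e(3))
        \<comment> \<open>Below \<epsilon> < 1/4 the target of the homotopy is 0, so it can only
          shrink the value.\<close>
        have "c y < \<epsilon>" using smooth_step_1[OF \<eta>(2), of "c y"] d(2)[OF that] by (cases "c y < \<epsilon>"; cases "1 - \<epsilon> < c y") auto
        moreover have "(1 - s y) * c y \<le> 1 * c y" using s'(2)[of y] boldI_range[OF c, of y] by (intro mult_right_mono) auto
        moreover have "0 \<le> (1 - s y) * c y" using s'(3)[of y] boldI_range[OF c, of y] by simp
        ultimately show "0 \<le> ?m y \<and> ?m y < \<epsilon>" using e(2) mid_step_0[of "c y"] by simp
      qed
      with d(1) show ?thesis using smooth_const[of "g 0"] by blast
    next
      case 2
      then obtain d where d: "d > 0" "\<And>y. \<bar>y - x\<bar> < d \<Longrightarrow> smooth_step (1 - \<epsilon>) (1 - \<eta>) (c y) > 0"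
        using isCont_real_nbhd[OF smooth_cont[OF b2], of "{0<..}" x] by auto
      have "g (?m y) = g 1" if "\<bar>y - x\<bar> < d" for y
      proof (rule e(4))
        have cy: "c y > 1 - \<epsilon>" using smooth_step_0[of "c y" "1 - \<epsilon>" "1 - \<eta>"] d(2)[OF that] by (cases "c y < \<epsilon>"; cases "1 - \<epsilon> < c y") auto
        define z where "z = (1 - s y) * (1 - c y)"
        have "?m y = 1 - z" unfolding z_def using mid_step_1[of "c y"] e(2) cy by (simp add: algebra_simps)
        moreover have "z \<le> 1 * (1 - c y)" unfolding z_def using s'(2)[of y] boldI_range[OF c, of y] by (intro mult_right_mono) auto
        moreover have "0 \<le> z" unfolding z_def using s'(3)[of y] boldI_range[OF c, of y] by simp
        ultimately show "1 - \<epsilon> < ?m y \<and> ?m y \<le> 1" using cy by simp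
      qed
      with d(1) show ?thesis using smooth_const[of "g 1"] by blast
    next
      case 3
      obtain d1 where d1: "d1 > 0" "\<And>y. \<bar>y - x\<bar> < d1 \<Longrightarrow> smooth_step \<eta> \<epsilon> (c y) > 0"
        using isCont_real_nbhd[OF smooth_cont[OF b1], of "{0<..}" x] 3 by auto
      obtain d2 where d2: "d2 > 0" "\<And>y. \<bar>y - x\<bar> < d2 \<Longrightarrow> smooth_step (1 - \<epsilon>) (1 - \<eta>) (c y) < 1"
        using isCont_real_nbhd[OF smooth_cont[OF b2], of "{..<1}" x] 3 by auto
      \<comment> \<open>A self-map of the interval that is constant within \<eta>/2 of each end,
        hence smooth along c, and is the identity between \<eta> and 1 - \<eta>.\<close>
      define \<sigma> where "\<sigma> t = (1 - smooth_step (1 - \<eta>) (1 - \<eta>/2) t) * (t * smooth_step (\<eta>/2) \<eta> t) + smooth_step (1 - \<eta>) (1 - \<eta>/2) t * 1" for t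
      have \<sigma>01: "0 \<le> \<sigma> t \<and> \<sigma> t \<le> 1" if "0 \<le> t" "t \<le> 1" for t
        unfolding \<sigma>_def using that by (intro convex_unit) (auto simp: smooth_step_range mult_le_one)
      have "smooth_rr \<sigma>" unfolding \<sigma>_def using \<eta> by (intro smooth_intros smooth_smooth_step) auto
      then have "smooth_rr (\<lambda>r. \<sigma> (c r))"
        by (rule boldI_flat[where \<epsilon> = "\<eta>/2", OF _ _ _ _ c]) (use \<eta> in \<open>auto simp: \<sigma>_def smooth_step_0 smooth_step_1\<close>)
      moreover have "smooth_rr (\<lambda>r. mid_step (c r))" using crv_mid_step[OF c] by (simp add: crv_Isp)
      ultimately have "smooth_rr (\<lambda>r. (1 - s r) * \<sigma> (c r) + s r * mid_step (c r))"
        by (intro smooth_intros s')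
      moreover have "0 \<le> (1 - s r) * \<sigma> (c r) + s r * mid_step (c r) \<and> (1 - s r) * \<sigma> (c r) + s r * mid_step (c r) \<le> 1" for r
        using s'(2,3)[of r] boldI_range[OF c, of r] \<sigma>01[of "c r"] mid_step_range[of "c r"] by (intro convex_unit) auto
      ultimately have "(\<lambda>r. (1 - s r) * \<sigma> (c r) + s r * mid_step (c r)) \<in> crv Isp" by (simp add: crv_Isp)
      then have sm: "smooth_rr (\<lambda>r. g ((1 - s r) * \<sigma> (c r) + s r * mid_step (c r)))"
        using g by (simp add: fns_iff[OF frolicher_Isp])
      have "\<sigma> (c y) = c y" if "\<bar>y - x\<bar> < min d1 d2" for y
      proof -
        have "c y > \<eta>" using smooth_step_0[of "c y" \<eta> \<epsilon>] d1(2)[of y] that by (cases "\<eta> < c y") auto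
        moreover have "c y < 1 - \<eta>" using smooth_step_1[of "1 - \<epsilon>" "1 - \<eta>" "c y"] \<eta> d2(2)[of y] that by (cases "c y < 1 - \<eta>") auto
        ultimately show ?thesis using \<eta> by (simp add: \<sigma>_def smooth_step_0 smooth_step_1)
      qed
      then show ?thesis using sm d1(1) d2(1)
        by (intro exI[of _ "\<lambda>r. g ((1 - s r) * \<sigma> (c r) + s r * mid_step (c r))"] exI[of _ "min d1 d2"]) auto
    qed
  qed
  moreover have "0 \<le> ?m r \<and> ?m r \<le> 1" for r
    using s'(2,3)[of r] boldI_range[OF c, of r] mid_step_range[of "c r"] by (intro convex_unit) auto
  ultimately show ?thesis unfolding boldI_def crv_gen_fns by auto
qed

section \<open>Copies, products, quotients and coproducts in the universe of points\<close>

lemma crv_copy: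
  assumes S: "frolicher S" and h: "inj h"
  shows "c \<in> crv (gen_crv (h ` carr S) {h \<circ> c | c. c \<in> crv S}) \<longleftrightarrow> (\<exists>b\<in>crv S. c = (\<lambda>r. h (b r)))"
proof
  assume c: "c \<in> crv (gen_crv (h ` carr S) {h \<circ> c | c. c \<in> crv S})"
  define b where "b r = inv h (c r)" for r
  have cb: "c r = h (b r)" and bS: "b r \<in> carr S" for r
    using c h unfolding crv_gen_crv b_def by (auto simp: f_inv_into_f image_iff) (metis inv_f_f)+
  have "smooth_rr (\<lambda>r. f (b r))" if "f \<in> fns S" for f
  proof -
    \<comment> \<open>Structure functions of S become test functions on the copy after composition
      with the inverse of h, so every curve of the copy lifts.\<close>
    have "\<forall>c\<in>{h \<circ> c | c. c \<in> crv S}. smooth_rr (\<lambda>r. f (inv h (c r)))"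
      using that by (auto simp: inv_f_f[OF h] fns_iff[OF S])
    then show ?thesis using c unfolding crv_gen_crv b_def by (auto dest: spec[of _ "\<lambda>x. f (inv h x)"])
  qed
  then have "b \<in> crv S" using bS by (simp add: crv_iff[OF S])
  then show "\<exists>b\<in>crv S. c = (\<lambda>r. h (b r))" using cb by blast
next
  assume "\<exists>b\<in>crv S. c = (\<lambda>r. h (b r))"
  then obtain b where b: "b \<in> crv S" "c = h \<circ> b" unfolding o_def by blast
  show "c \<in> crv (gen_crv (h ` carr S) {h \<circ> c | c. c \<in> crv S})"
    by (rule crv_gen_crvI) (use b crv_carr[OF S] in auto)
qed

lemma frolicher_liftsp: "frolicher (liftsp S)"
  unfolding liftsp_def by (rule frolicher_gen_crv)

lemma carr_liftsp [simp]: "carr (liftsp S) = Pt ` carr S"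
  by (simp add: liftsp_def)

lemma crv_liftsp: "frolicher S \<Longrightarrow> c \<in> crv (liftsp S) \<longleftrightarrow> (\<exists>b\<in>crv S. c = (\<lambda>r. Pt (b r)))"
  unfolding liftsp_def by (rule crv_copy) (auto simp: inj_def)

lemma frolicher_Ifpt: "frolicher Ifpt"
  unfolding Ifpt_def by (rule frolicher_gen_crv)

lemma carr_Ifpt [simp]: "carr Ifpt = Re ` {0..1}"
  by (simp add: Ifpt_def)

lemma crv_Ifpt: "c \<in> crv Ifpt \<longleftrightarrow> (\<exists>b\<in>crv boldI. c = (\<lambda>r. Re (b r)))"
  using crv_copy[OF frolicher_boldI, of Re] by (simp add: Ifpt_def inj_def)

lemma pfst_Pr [simp]: "pfst (Pr a b) = a" and psnd_Pr [simp]: "psnd (Pr a b) = b"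
  by (simp_all add: pfst_def psnd_def)

lemma frolicher_fprod: "frolicher (fprod S T)"
  unfolding fprod_def by (rule frolicher_gen_fns)

lemma carr_fprod [simp]: "carr (fprod S T) = {Pr a b | a b. a \<in> carr S \<and> b \<in> carr T}"
  by (simp add: fprod_def)

lemma crv_fprod:
  assumes "frolicher S" "frolicher T"
  shows "c \<in> crv (fprod S T) \<longleftrightarrow> (\<exists>a\<in>crv S. \<exists>b\<in>crv T. c = (\<lambda>r. Pr (a r) (b r)))"
proof
  assume c: "c \<in> crv (fprod S T)"
  have 1: "\<exists>a b. c r = Pr a b \<and> a \<in> carr S \<and> b \<in> carr T" for r
    using crv_carr[OF frolicher_fprod c, of r] by auto
  have 2: "\<forall>f\<in>fns S. smooth_rr (\<lambda>r. f (pfst (c r)))" "\<forall>f\<in>fns T. smooth_rr (\<lambda>r. f (psnd (c r)))"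
    using c unfolding fprod_def crv_gen_fns by (auto simp: o_def ball_Un)
  have "c r = Pr (pfst (c r)) (psnd (c r)) \<and> pfst (c r) \<in> carr S \<and> psnd (c r) \<in> carr T" for r using 1[of r] by auto
  with 2 show "\<exists>a\<in>crv S. \<exists>b\<in>crv T. c = (\<lambda>r. Pr (a r) (b r))"
    by (intro bexI[of _ "\<lambda>r. pfst (c r)"] bexI[of _ "\<lambda>r. psnd (c r)"]) (auto simp: crv_iff assms)
next
  assume "\<exists>a\<in>crv S. \<exists>b\<in>crv T. c = (\<lambda>r. Pr (a r) (b r))"
  then show "c \<in> crv (fprod S T)" unfolding fprod_def crv_gen_fns
    by (auto simp: crv_iff assms o_def)
qed

lemma qrep_rel: "x \<in> carr S \<Longrightarrow> qrep S R x \<in> carr S \<and> (x, qrep S R x) \<in> (R \<union> R\<inverse>)\<^sup>*"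
  unfolding qrep_def using someI[of "\<lambda>y. y \<in> carr S \<and> (x, y) \<in> (R \<union> R\<inverse>)\<^sup>*" x] by simp

text \<open>f is constant along chains of related pairs, hence on the class from which the
  representative is chosen.\<close>

lemma qrep_invariant:
  assumes f: "\<And>x y. (x, y) \<in> R \<Longrightarrow> f x = f y" and x: "x \<in> carr S"
  shows "f (qrep S R x) = f x"
proof -
  have "f y = f x" if "(x, y) \<in> (R \<union> R\<inverse>)\<^sup>*" for y
    using that
  proof (induction rule: rtrancl_induct)
    case (step y z)
    then have "(y, z) \<in> R \<or> (z, y) \<in> R" by auto
    then have "f z = f y" using f[of y z] f[of z y] by metis
    then show ?case using step.IH by simp
  qed simp
  from this[OF qrep_rel[OF x, THEN conjunct2]] show ?thesis .
qed

lemma qrep_eq: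
  assumes "(x, y) \<in> R" shows "qrep S R x = qrep S R y"
proof -
  have s: "sym ((R \<union> R\<inverse>)\<^sup>*)" by (rule sym_rtrancl[OF sym_Un_converse])
  have xy: "(x, y) \<in> (R \<union> R\<inverse>)\<^sup>*" using assms by (intro r_into_rtrancl UnI1)
  have "(x, z) \<in> (R \<union> R\<inverse>)\<^sup>* \<longleftrightarrow> (y, z) \<in> (R \<union> R\<inverse>)\<^sup>*" for z
    using rtrancl_trans[OF xy, of z] rtrancl_trans[OF symD[OF s xy], of z] by blast
  then show ?thesis unfolding qrep_def by simp
qed

lemma frolicher_quot: "frolicher (quot S R)"
  unfolding quot_def by (rule frolicher_gen_crv)

lemma carr_quot [simp]: "carr (quot S R) = qrep S R ` carr S"
  by (simp add: quot_def)

lemma crv_quotI: "frolicher S \<Longrightarrow> c \<in> crv S \<Longrightarrow> (\<lambda>r. qrep S R (c r)) \<in> crv (quot S R)"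
  unfolding quot_def by (rule crv_gen_crvI) (auto simp: o_def crv_carr)

text \<open>A parametrised map out of a quotient may be checked along curves of S although curves of
  the quotient need not lift; \<open>final_param\<close> applies since projected constant curves
  cover the quotient.\<close>

lemma quot_param:
  assumes B: "frolicher B" and T: "frolicher T" and S: "frolicher S"
    and inv: "\<And>p x. p \<in> carr B \<Longrightarrow> x \<in> carr S \<Longrightarrow> K p (qrep S R x) = K p x"
    and K: "\<And>p c. p \<in> crv B \<Longrightarrow> c \<in> crv S \<Longrightarrow> (\<lambda>r. K (p r) (c r)) \<in> crv T"
    and p: "p \<in> crv B" and c: "c \<in> crv (quot S R)"
  shows "(\<lambda>r. K (p r) (c r)) \<in> crv T"
proof (rule final_param[OF B T _ _ p c[unfolded quot_def]])
  fix x assume "x \<in> qrep S R ` carr S"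
  then obtain y where "y \<in> carr S" "x = qrep S R y" by blast
  then show "\<exists>c\<in>{qrep S R \<circ> c |c. c \<in> crv S}. \<exists>v. c v = x"
    using crv_const[OF S] by (intro bexI[of _ "qrep S R \<circ> (\<lambda>_. y)"]) auto
next
  fix p c t assume p: "p \<in> crv B" and "c \<in> {qrep S R \<circ> c |c. c \<in> crv S}" and t: "smooth_rr t"
  then obtain c0 where c0: "c0 \<in> crv S" "c = qrep S R \<circ> c0" by blast
  have "(\<lambda>r. K (p r) (c0 (t r))) \<in> crv T" by (rule K[OF p crv_reparam[OF S c0(1) t]])
  then show "(\<lambda>r. K (p r) (c (t r))) \<in> crv T"
    using c0 inv crv_carr[OF B p] crv_carr[OF S c0(1)] by simp
qed

lemma quot_map:
  assumes "frolicher S" "frolicher T" and inv: "\<And>x. x \<in> carr S \<Longrightarrow> f (qrep S R x) = f x"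
    and f: "\<And>c. c \<in> crv S \<Longrightarrow> (\<lambda>r. f (c r)) \<in> crv T" and c: "c \<in> crv (quot S R)"
  shows "(\<lambda>r. f (c r)) \<in> crv T"
proof (rule quot_param[where K = "\<lambda>_. f", OF frolicher_realsp assms(2,1) _ _ _ c])
  show "(\<lambda>r. r) \<in> crv realsp" by (simp add: crv_realsp smooth_id)
qed (rule inv f, assumption)+

lemma frolicher_fcoprod: "frolicher (fcoprod S T)"
  unfolding fcoprod_def by (rule frolicher_gen_crv)

lemma carr_fcoprod [simp]: "carr (fcoprod S T) = InL ` carr S \<union> InR ` carr T"
  by (simp add: fcoprod_def)

lemma crv_fcoprodI:
  "frolicher S \<Longrightarrow> c \<in> crv S \<Longrightarrow> (\<lambda>r. InL (c r)) \<in> crv (fcoprod S T)"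
  "frolicher T \<Longrightarrow> c \<in> crv T \<Longrightarrow> (\<lambda>r. InR (c r)) \<in> crv (fcoprod S T)"
  unfolding fcoprod_def by (rule crv_gen_crvI; auto simp: o_def crv_carr)+

lemma fcoprod_param:
  assumes B: "frolicher B" and T: "frolicher T" and S: "frolicher S1" "frolicher S2"
    and K: "\<And>p c. p \<in> crv B \<Longrightarrow> c \<in> crv S1 \<Longrightarrow> (\<lambda>r. K (p r) (InL (c r))) \<in> crv T"
      "\<And>p c. p \<in> crv B \<Longrightarrow> c \<in> crv S2 \<Longrightarrow> (\<lambda>r. K (p r) (InR (c r))) \<in> crv T"
    and p: "p \<in> crv B" and c: "c \<in> crv (fcoprod S1 S2)"
  shows "(\<lambda>r. K (p r) (c r)) \<in> crv T"
proof (rule final_param[OF B T _ _ p c[unfolded fcoprod_def]])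
  fix x assume "x \<in> InL ` carr S1 \<union> InR ` carr S2"
  then consider y where "y \<in> carr S1" "x = InL y" | y where "y \<in> carr S2" "x = InR y" by blast
  then show "\<exists>c\<in>{InL \<circ> c |c. c \<in> crv S1} \<union> {InR \<circ> c |c. c \<in> crv S2}. \<exists>v. c v = x"
  proof cases
    case 1 then show ?thesis using crv_const[OF S(1)] by (intro bexI[of _ "InL \<circ> (\<lambda>_. y)"]) auto
  next
    case 2 then show ?thesis using crv_const[OF S(2)] by (intro bexI[of _ "InR \<circ> (\<lambda>_. y)"]) auto
  qed
next
  fix p c t assume p: "p \<in> crv B" and c: "c \<in> {InL \<circ> c |c. c \<in> crv S1} \<union> {InR \<circ> c |c. c \<in> crv S2}" and t: "smooth_rr t"
  from c consider c0 where "c0 \<in> crv S1" "c = InL \<circ> c0" | c0 where "c0 \<in> crv S2" "c = InR \<circ> c0" by blast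
  then show "(\<lambda>r. K (p r) (c (t r))) \<in> crv T"
  proof cases
    case 1 then show ?thesis using K(1)[OF p crv_reparam[OF S(1) _ t]] by simp
  next
    case 2 then show ?thesis using K(2)[OF p crv_reparam[OF S(2) _ t]] by simp
  qed
qed

section \<open>Pointed homotopy and exactness\<close>

definition pspace :: "'a frol \<times> 'a \<Rightarrow> bool" where
  "pspace S \<longleftrightarrow> frolicher (fst S) \<and> snd S \<in> carr (fst S)"

lemma pspaceD: "pspace S \<Longrightarrow> frolicher (fst S)" "pspace S \<Longrightarrow> snd S \<in> carr (fst S)"
  by (simp_all add: pspace_def)

lemma psmoothI:
  assumes "pspace S" "pspace T" "\<And>c. c \<in> crv (fst S) \<Longrightarrow> (\<lambda>r. f (c r)) \<in> crv (fst T)" "f (snd S) = snd T"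
  shows "psmooth S T f"
  unfolding psmooth_def using smooth_mapI[OF pspaceD(1)[OF assms(1)] pspaceD(1)[OF assms(2)] assms(3)] assms(4) by simp

lemma psmooth_crv:
  assumes "pspace S" "pspace T" "psmooth S T f" "c \<in> crv (fst S)"
  shows "(\<lambda>r. f (c r)) \<in> crv (fst T)"
  using smooth_mapD[OF pspaceD(1)[OF assms(1)] pspaceD(1)[OF assms(2)]] assms(3,4) by (simp add: psmooth_def)

lemma psmooth_carr: "psmooth S T f \<Longrightarrow> x \<in> carr (fst S) \<Longrightarrow> f x \<in> carr (fst T)"
  by (simp add: psmooth_def smooth_map_def)

lemma psmooth_pt: "psmooth S T f \<Longrightarrow> f (snd S) = snd T"
  by (simp add: psmooth_def)

lemma psmooth_comp:
  assumes "pspace S" "pspace T" "pspace U" "psmooth S T f" "psmooth T U g"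
  shows "psmooth S U (g \<circ> f)"
proof (rule psmoothI[OF assms(1,3)])
  fix c assume "c \<in> crv (fst S)"
  then show "(\<lambda>r. (g \<circ> f) (c r)) \<in> crv (fst U)"
    using psmooth_crv[OF assms(2,3,5) psmooth_crv[OF assms(1,2,4)]] by (simp add: o_def)
qed (use assms psmooth_pt in \<open>simp add: psmooth_pt\<close>)

lemma psmooth_const: "pspace S \<Longrightarrow> pspace T \<Longrightarrow> psmooth S T (\<lambda>_. snd T)"
  by (rule psmoothI) (simp_all add: crv_const pspaceD)

lemma phtpyI:
  assumes S: "pspace S" and T: "pspace T"
    and H: "\<And>s c. s \<in> crv Isp \<Longrightarrow> c \<in> crv (fst S) \<Longrightarrow> (\<lambda>r. H (s r) (c r)) \<in> crv (fst T)"
    and e: "\<And>x. x \<in> carr (fst S) \<Longrightarrow> H 0 x = f x" "\<And>x. x \<in> carr (fst S) \<Longrightarrow> H 1 x = g x"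
    and pt: "\<And>t. 0 \<le> t \<Longrightarrow> t \<le> 1 \<Longrightarrow> H t (snd S) = snd T"
  shows "phtpy S T f g"
proof -
  have "smooth_map (prodsp Isp (fst S)) (fst T) (case_prod H)"
    by (rule smooth_mapI[OF frolicher_prodsp pspaceD(1)[OF T]])
       (simp add: crv_prodsp[OF frolicher_Isp pspaceD(1)[OF S]] H case_prod_beta)
  then show ?thesis unfolding phtpy_def by (intro exI[of _ "case_prod H"]) (simp add: e pt)
qed

definition htpy :: "'a frol \<times> 'a \<Rightarrow> 'b frol \<times> 'b \<Rightarrow> ('a \<Rightarrow> 'b) \<Rightarrow> ('a \<Rightarrow> 'b) \<Rightarrow> (real \<Rightarrow> 'a \<Rightarrow> 'b) \<Rightarrow> bool" where
  "htpy S T f g H \<longleftrightarrow> (\<forall>s\<in>crv Isp. \<forall>c\<in>crv (fst S). (\<lambda>r. H (s r) (c r)) \<in> crv (fst T)) \<and>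
    (\<forall>x\<in>carr (fst S). H 0 x = f x \<and> H 1 x = g x) \<and> (\<forall>t\<in>{0..1}. H t (snd S) = snd T)"

lemma htpyD:
  assumes "htpy S T f g H"
  shows "s \<in> crv Isp \<Longrightarrow> c \<in> crv (fst S) \<Longrightarrow> (\<lambda>r. H (s r) (c r)) \<in> crv (fst T)"
    "x \<in> carr (fst S) \<Longrightarrow> H 0 x = f x" "x \<in> carr (fst S) \<Longrightarrow> H 1 x = g x"
    "0 \<le> t \<Longrightarrow> t \<le> 1 \<Longrightarrow> H t (snd S) = snd T"
  using assms by (simp_all add: htpy_def)

lemma phtpyE:
  assumes S: "pspace S" and T: "pspace T" and h: "phtpy S T f g"
  obtains H where "htpy S T f g H"
proof -
  obtain H where H: "smooth_map (prodsp Isp (fst S)) (fst T) H"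
      "\<forall>x\<in>carr (fst S). H (0, x) = f x \<and> H (1, x) = g x" "\<forall>t\<in>{0..1}. H (t, snd S) = snd T"
    using h unfolding phtpy_def by blast
  have "(\<lambda>r. H (s r, c r)) \<in> crv (fst T)" if "s \<in> crv Isp" "c \<in> crv (fst S)" for s c
  proof (rule smooth_mapD[OF frolicher_prodsp pspaceD(1)[OF T] H(1)])
    show "(\<lambda>r. (s r, c r)) \<in> crv (prodsp Isp (fst S))"
      using that by (simp add: crv_prodsp[OF frolicher_Isp pspaceD(1)[OF S]])
  qed
  with H(2,3) show ?thesis by (intro that[of "\<lambda>t x. H (t, x)"]) (simp add: htpy_def)
qed

lemma phtpy_refl: "pspace S \<Longrightarrow> pspace T \<Longrightarrow> psmooth S T f \<Longrightarrow> phtpy S T f f"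
  by (rule phtpyI[where H = "\<lambda>_. f"]) (simp_all add: psmooth_crv psmooth_pt)

lemma phtpy_cong:
  assumes "phtpy S T f g" "\<And>x. x \<in> carr (fst S) \<Longrightarrow> f x = f' x" "\<And>x. x \<in> carr (fst S) \<Longrightarrow> g x = g' x"
  shows "phtpy S T f' g'"
  using assms unfolding phtpy_def by auto

lemma crv_Isp_step: "a < b \<Longrightarrow> s \<in> crv Isp \<Longrightarrow> (\<lambda>r. smooth_step a b (s r)) \<in> crv Isp"
  using smooth_comp[OF smooth_smooth_step, of a b s] by (simp add: crv_Isp smooth_step_range)

lemma crv_Isp_flip: "s \<in> crv Isp \<Longrightarrow> (\<lambda>r. 1 - s r) \<in> crv Isp"
  by (simp add: crv_Isp smooth_diff smooth_const)

lemma crv_Isp_mult: "s \<in> crv Isp \<Longrightarrow> t \<in> crv Isp \<Longrightarrow> (\<lambda>r. s r * t r) \<in> crv Isp"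
  by (simp add: crv_Isp smooth_mult mult_le_one)

lemma phtpy_sym:
  assumes S: "pspace S" and T: "pspace T" and h: "phtpy S T f g"
  shows "phtpy S T g f"
proof -
  obtain H where "htpy S T f g H"
    by (rule phtpyE[OF S T h])
  note H = htpyD[OF this]
  show ?thesis by (rule phtpyI[OF S T, where H = "\<lambda>t. H (1 - t)"]) (simp_all add: H crv_Isp_flip)
qed

lemma phtpy_trans:
  assumes S: "pspace S" and T: "pspace T" and 1: "phtpy S T f g" and 2: "phtpy S T g h"
  shows "phtpy S T f h"
proof -
  obtain H1 where "htpy S T f g H1"
    by (rule phtpyE[OF S T 1])
  note H1 = htpyD[OF this]
  obtain H2 where "htpy S T g h H2"
    by (rule phtpyE[OF S T 2])
  note H2 = htpyD[OF this]
  \<comment> \<open>H1 runs until 1/3 and H2 starts at 2/3. On the middle third both formulas give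
    g, which is the overlap for gluing.\<close>
  define K where "K t x = (if t \<le> 1/2 then H1 (smooth_step 0 (1/3) t) x else H2 (smooth_step (2/3) 1 t) x)" for t x
  show ?thesis
  proof (rule phtpyI[OF S T, where H = K])
    fix s c assume s: "s \<in> crv Isp" and c: "c \<in> crv (fst S)"
    have cS: "c r \<in> carr (fst S)" for r using crv_carr[OF pspaceD(1)[OF S] c] .
    show "(\<lambda>r. K (s r) (c r)) \<in> crv (fst T)"
    proof (rule crv_glue[OF pspaceD(1)[OF T], where \<tau> = "\<lambda>r. smooth_step (1/3) (2/3) (s r)"])
      show "smooth_rr (\<lambda>r. smooth_step (1/3) (2/3) (s r))" using crv_Isp_step[OF _ s, of "1/3" "2/3"] by (simp add: crv_Isp)
      show "(\<lambda>r. H1 (smooth_step 0 (1/3) (s r)) (c r)) \<in> crv (fst T)" by (intro H1(1) crv_Isp_step s c) simp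
      show "(\<lambda>r. H2 (smooth_step (2/3) 1 (s r)) (c r)) \<in> crv (fst T)" by (intro H2(1) crv_Isp_step s c) simp
    next
      fix r assume "smooth_step (1/3) (2/3) (s r) < 1"
      then have "s r < 2/3" using smooth_step_1[of "1/3" "2/3" "s r"] by (cases "s r < 2/3") auto
      then show "K (s r) (c r) = H1 (smooth_step 0 (1/3) (s r)) (c r)"
        using H1(3)[OF cS[of r]] H2(2)[OF cS[of r]] by (simp add: K_def smooth_step_0 smooth_step_1)
    next
      fix r assume "smooth_step (1/3) (2/3) (s r) > 0"
      then have "s r > 1/3" using smooth_step_0[of "s r" "1/3" "2/3"] by (cases "s r > 1/3") auto
      then show "K (s r) (c r) = H2 (smooth_step (2/3) 1 (s r)) (c r)"
        using H1(3)[OF cS[of r]] H2(2)[OF cS[of r]] by (simp add: K_def smooth_step_0 smooth_step_1)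
    qed
  qed (simp_all add: K_def smooth_step_0 smooth_step_1 smooth_step_range H1 H2)
qed

text \<open>Reversal and concatenation compress a chain of homotopies to a single one.\<close>

lemma hrel_iff:
  assumes S: "pspace S" and T: "pspace T"
  shows "(f, g) \<in> hrel S T \<longleftrightarrow> psmooth S T f \<and> psmooth S T g \<and> phtpy S T f g"
proof
  let ?R = "{(f, g). f \<in> {f. psmooth S T f} \<and> g \<in> {f. psmooth S T f} \<and> phtpy S T f g}"
  assume "(f, g) \<in> hrel S T"
  then have fg: "(f, g) \<in> (?R \<union> ?R\<inverse>)\<^sup>*" "psmooth S T f" "psmooth S T g" unfolding hrel_def Let_def by auto
  from fg(1) have "phtpy S T f g"
  proof (induction rule: rtrancl_induct)
    case base show ?case by (rule phtpy_refl[OF S T fg(2)])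
  next
    case (step y z)
    then have "phtpy S T y z" using phtpy_sym[OF S T, of z y] by auto
    with step.IH show ?case by (rule phtpy_trans[OF S T])
  qed
  with fg show "psmooth S T f \<and> psmooth S T g \<and> phtpy S T f g" by simp
next
  assume "psmooth S T f \<and> psmooth S T g \<and> phtpy S T f g"
  then show "(f, g) \<in> hrel S T" unfolding hrel_def Let_def by (intro IntI r_into_rtrancl) auto
qed

lemma equiv_hrel:
  assumes S: "pspace S" and T: "pspace T"
  shows "equiv {f. psmooth S T f} (hrel S T)"
proof (rule equivI)
  show "hrel S T \<subseteq> {f. psmooth S T f} \<times> {f. psmooth S T f}" using hrel_iff[OF S T] by auto
  show "refl_on {f. psmooth S T f} (hrel S T)"
    by (rule refl_onI) (simp add: hrel_iff[OF S T] phtpy_refl[OF S T])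
  show "sym (hrel S T)"
  proof (rule symI)
    fix f g assume "(f, g) \<in> hrel S T"
    then show "(g, f) \<in> hrel S T" using phtpy_sym[OF S T, of f g] by (simp add: hrel_iff[OF S T])
  qed
  show "trans (hrel S T)"
  proof (rule transI)
    fix f g h assume "(f, g) \<in> hrel S T" "(g, h) \<in> hrel S T"
    then show "(f, h) \<in> hrel S T" using phtpy_trans[OF S T, of f g h] by (simp add: hrel_iff[OF S T])
  qed
qed

lemma hrel_refl: "pspace S \<Longrightarrow> pspace T \<Longrightarrow> psmooth S T f \<Longrightarrow> (f, f) \<in> hrel S T"
  by (simp add: hrel_iff phtpy_refl)

lemma hrel_sym: "pspace S \<Longrightarrow> pspace T \<Longrightarrow> (f, g) \<in> hrel S T \<Longrightarrow> (g, f) \<in> hrel S T"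
  using equiv_hrel[of S T] by (meson equivE symD)

lemma hrel_trans:
  "pspace S \<Longrightarrow> pspace T \<Longrightarrow> (f, g) \<in> hrel S T \<Longrightarrow> (g, h) \<in> hrel S T \<Longrightarrow> (f, h) \<in> hrel S T"
  using equiv_hrel[of S T] by (meson equivE transD)

text \<open>The members of a homotopy class are functions on the whole type; this disposes of their
  values off the carrier.\<close>

lemma hrel_agree:
  assumes "pspace S" "pspace T" "psmooth S T f" "psmooth S T g" "\<And>x. x \<in> carr (fst S) \<Longrightarrow> f x = g x"
  shows "(f, g) \<in> hrel S T"
  using phtpy_cong[OF phtpy_refl[OF assms(1-3)] refl assms(5)] assms(1-4) by (simp add: hrel_iff)

lemma hrel_precomp:
  assumes S: "pspace S" and T: "pspace T" and U: "pspace U" and h: "psmooth S T h" and fg: "(f, g) \<in> hrel T U"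
  shows "(f \<circ> h, g \<circ> h) \<in> hrel S U"
proof -
  have f: "psmooth T U f" and g: "psmooth T U g" and ph: "phtpy T U f g" using fg by (simp_all add: hrel_iff[OF T U])
  obtain H where "htpy T U f g H"
    by (rule phtpyE[OF T U ph])
  note H = htpyD[OF this]
  have "phtpy S U (f \<circ> h) (g \<circ> h)"
    by (rule phtpyI[OF S U, where H = "\<lambda>t x. H t (h x)"])
       (simp_all add: H psmooth_crv[OF S T h] psmooth_carr[OF h] psmooth_pt[OF h])
  then show ?thesis by (simp add: hrel_iff[OF S U] psmooth_comp[OF S T U h] f g)
qed

lemma hrel_postcomp:
  assumes S: "pspace S" and T: "pspace T" and U: "pspace U" and h: "psmooth T U h" and fg: "(f, g) \<in> hrel S T"
  shows "(h \<circ> f, h \<circ> g) \<in> hrel S U"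
proof -
  have f: "psmooth S T f" and g: "psmooth S T g" and ph: "phtpy S T f g" using fg by (simp_all add: hrel_iff[OF S T])
  obtain H where "htpy S T f g H"
    by (rule phtpyE[OF S T ph])
  note H = htpyD[OF this]
  have "phtpy S U (h \<circ> f) (h \<circ> g)"
    by (rule phtpyI[OF S U, where H = "\<lambda>t x. h (H t x)"])
       (simp_all add: H psmooth_crv[OF T U h] psmooth_pt[OF h])
  then show ?thesis by (simp add: hrel_iff[OF S U] psmooth_comp[OF S T U _ h] f g)
qed

section \<open>Homotopy sets and exactness\<close>

lemma pull_class:
  assumes S: "pspace S" and T: "pspace T" and W: "pspace W" and g: "psmooth S T g" and f: "psmooth T W f"
  shows "pull W S g (hrel T W `` {f}) = hrel S W `` {f \<circ> g}"
proof -
  have "f \<in> hrel T W `` {f}" using hrel_refl[OF T W f] by simp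
  then have "(f, SOME f'. f' \<in> hrel T W `` {f}) \<in> hrel T W" using someI[of "\<lambda>f'. f' \<in> hrel T W `` {f}" f] by simp
  from hrel_precomp[OF S T W g this] show ?thesis unfolding pull_def
    using equiv_class_eq[OF equiv_hrel[OF S W]] by metis
qed

text \<open>Both sides are stable under homotopy of f, so an equation between sets of classes can be
  tested on single maps.\<close>

lemma exact_at_iff:
  assumes W: "pspace W" and V: "pspace V" and X: "pspace X" and Y: "pspace Y"
    and h: "psmooth V X h" and g: "psmooth X Y g"
  shows "exact_at W V X Y h g \<longleftrightarrow> (\<forall>f. psmooth X W f \<longrightarrow>
    ((\<exists>f'. psmooth Y W f' \<and> (f' \<circ> g, f) \<in> hrel X W) \<longleftrightarrow> (f \<circ> h, \<lambda>_. snd W) \<in> hrel V W))"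
proof -
  let ?cl = "\<lambda>f. hrel X W `` {f}"
  have cl: "?cl f = ?cl f' \<longleftrightarrow> (f, f') \<in> hrel X W" if "psmooth X W f" "psmooth X W f'" for f f'
    using eq_equiv_class_iff[OF equiv_hrel[OF X W]] that by simp
  have img: "pull W X g ` hset Y W = {?cl (f' \<circ> g) | f'. psmooth Y W f'}"
    unfolding hset_def quotient_def using pull_class[OF X Y W g] by (auto simp: image_iff)
  have ker: "{C \<in> hset X W. pull W V h C = hbase V W} = {?cl f | f. psmooth X W f \<and> (f \<circ> h, \<lambda>_. snd W) \<in> hrel V W}"
  proof -
    have "pull W V h (?cl f) = hbase V W \<longleftrightarrow> (f \<circ> h, \<lambda>_. snd W) \<in> hrel V W" if "psmooth X W f" for f
      unfolding pull_class[OF V X W h that] hbase_def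
      using eq_equiv_class_iff[OF equiv_hrel[OF V W]] psmooth_comp[OF V X W h that] psmooth_const[OF V W] by simp
    then show ?thesis unfolding hset_def quotient_def by auto
  qed
  have comp: "psmooth X W (f' \<circ> g)" if "psmooth Y W f'" for f' using psmooth_comp[OF X Y W g that] .
  show ?thesis unfolding exact_at_def img ker
  proof (rule iffI, (rule allI, rule impI))
    fix f assume eq: "{?cl (f' \<circ> g) |f'. psmooth Y W f'} = {?cl f |f. psmooth X W f \<and> (f \<circ> h, \<lambda>_. snd W) \<in> hrel V W}"
      and f: "psmooth X W f"
    show "(\<exists>f'. psmooth Y W f' \<and> (f' \<circ> g, f) \<in> hrel X W) \<longleftrightarrow> (f \<circ> h, \<lambda>_. snd W) \<in> hrel V W"
    proof
      assume "\<exists>f'. psmooth Y W f' \<and> (f' \<circ> g, f) \<in> hrel X W"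
      then obtain f' where f': "psmooth Y W f'" "(f' \<circ> g, f) \<in> hrel X W" by blast
      then have "?cl (f' \<circ> g) \<in> {?cl f |f. psmooth X W f \<and> (f \<circ> h, \<lambda>_. snd W) \<in> hrel V W}"
        unfolding eq[symmetric] by blast
      then obtain f2 where f2: "?cl (f' \<circ> g) = ?cl f2" "psmooth X W f2" "(f2 \<circ> h, \<lambda>_. snd W) \<in> hrel V W" by blast
      have "(f' \<circ> g, f2) \<in> hrel X W" using f2(1) cl[OF comp[OF f'(1)] f2(2)] by simp
      then have "(f, f2) \<in> hrel X W" using hrel_trans[OF X W hrel_sym[OF X W f'(2)]] by simp
      from hrel_trans[OF V W hrel_precomp[OF V X W h this] f2(3)]
      show "(f \<circ> h, \<lambda>_. snd W) \<in> hrel V W" .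
    next
      assume "(f \<circ> h, \<lambda>_. snd W) \<in> hrel V W"
      then have "?cl f \<in> {?cl (f' \<circ> g) |f'. psmooth Y W f'}" unfolding eq using f by blast
      then obtain f' where f': "?cl f = ?cl (f' \<circ> g)" "psmooth Y W f'" by blast
      have "(f, f' \<circ> g) \<in> hrel X W" using f'(1) cl[OF f comp[OF f'(2)]] by simp
      then show "\<exists>f'. psmooth Y W f' \<and> (f' \<circ> g, f) \<in> hrel X W" using hrel_sym[OF X W] f'(2) by blast
    qed
  next
    assume R: "\<forall>f. psmooth X W f \<longrightarrow> (\<exists>f'. psmooth Y W f' \<and> (f' \<circ> g, f) \<in> hrel X W) = ((f \<circ> h, \<lambda>_. snd W) \<in> hrel V W)"
    show "{?cl (f' \<circ> g) |f'. psmooth Y W f'} = {?cl f |f. psmooth X W f \<and> (f \<circ> h, \<lambda>_. snd W) \<in> hrel V W}"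
    proof (intro set_eqI iffI)
      fix C assume "C \<in> {?cl (f' \<circ> g) |f'. psmooth Y W f'}"
      then obtain f' where f': "C = ?cl (f' \<circ> g)" "psmooth Y W f'" by blast
      have "(f' \<circ> g \<circ> h, \<lambda>_. snd W) \<in> hrel V W"
        using R[rule_format, OF comp[OF f'(2)]] f'(2) hrel_refl[OF X W comp[OF f'(2)]] by blast
      then show "C \<in> {?cl f |f. psmooth X W f \<and> (f \<circ> h, \<lambda>_. snd W) \<in> hrel V W}"
        using f' comp[OF f'(2)] by blast
    next
      fix C assume "C \<in> {?cl f |f. psmooth X W f \<and> (f \<circ> h, \<lambda>_. snd W) \<in> hrel V W}"
      then obtain f where f: "C = ?cl f" "psmooth X W f" "(f \<circ> h, \<lambda>_. snd W) \<in> hrel V W" by blast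
      then obtain f' where f': "psmooth Y W f'" "(f' \<circ> g, f) \<in> hrel X W" using R by blast
      have "?cl (f' \<circ> g) = C" using cl[OF comp[OF f'(1)] f(2)] f'(2) f(1) by simp
      then show "C \<in> {?cl (f' \<circ> g) |f'. psmooth Y W f'}" using f'(1) by blast
    qed
  qed
qed

section \<open>Reduced suspensions\<close>

lemma crv_fprodI:
  "frolicher S \<Longrightarrow> frolicher T \<Longrightarrow> a \<in> crv S \<Longrightarrow> b \<in> crv T \<Longrightarrow> (\<lambda>r. Pr (a r) (b r)) \<in> crv (fprod S T)"
  by (subst crv_fprod) auto

lemma frolicher_circsp: "frolicher circsp"
  unfolding circsp_def by (rule frolicher_quot)

lemma carr_circsp: "carr circsp = circ_q ` Re ` {0..1}"
  by (simp add: circsp_def circ_q_def)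

lemma circ_q_1: "circ_q (Re 1) = circ_pt"
  unfolding circ_pt_def circ_q_def by (rule qrep_eq[symmetric]) (simp add: circ_rel_def)

lemma circ_pt_carr: "circ_pt \<in> carr circsp"
  unfolding carr_circsp circ_pt_def by auto

lemma circ_q_invariant: "f (Re 0) = f (Re 1) \<Longrightarrow> 0 \<le> t \<Longrightarrow> t \<le> 1 \<Longrightarrow> f (circ_q (Re t)) = f (Re t)"
  unfolding circ_q_def by (rule qrep_invariant) (auto simp: circ_rel_def)

lemma crv_circ_q: "t \<in> crv boldI \<Longrightarrow> (\<lambda>r. circ_q (Re (t r))) \<in> crv circsp"
  unfolding circsp_def circ_q_def using crv_quotI[OF frolicher_Ifpt, of "\<lambda>r. Re (t r)"] by (auto simp: crv_Ifpt)

definition susp_pt :: "'a fpt frol \<times> 'a fpt \<Rightarrow> real \<Rightarrow> 'a fpt \<Rightarrow> 'a fpt" where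
  "susp_pt B t b = susp_q B (Pr (circ_q (Re t)) b)"

lemma wedge_rel_mem:
  "(x, y) \<in> wedge_rel B \<longleftrightarrow>
    (\<forall>z\<in>{x, y}. (\<exists>b\<in>carr (fst B). z = Pr circ_pt b) \<or> (\<exists>p\<in>carr circsp. z = Pr p (snd B)))"
  unfolding wedge_rel_def Let_def by auto

lemma susp_q_collapse:
  assumes "pspace B" "\<And>b. b \<in> carr (fst B) \<Longrightarrow> K (Pr circ_pt b) = w" "\<And>p. p \<in> carr circsp \<Longrightarrow> K (Pr p (snd B)) = w"
    and "p \<in> carr circsp" "b \<in> carr (fst B)"
  shows "K (susp_q B (Pr p b)) = K (Pr p b)"
  unfolding susp_q_def
proof (rule qrep_invariant)
  fix x y assume "(x, y) \<in> wedge_rel B"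
  then have "K x = w" "K y = w" unfolding wedge_rel_mem using assms(2,3) by auto
  then show "K x = K y" by simp
qed (use assms in auto)

lemma susp_q_wedge:
  assumes B: "pspace B"
  shows "b \<in> carr (fst B) \<Longrightarrow> susp_q B (Pr circ_pt b) = snd (susp B)"
    "p \<in> carr circsp \<Longrightarrow> susp_q B (Pr p (snd B)) = snd (susp B)"
  unfolding susp_def snd_conv susp_q_def
  by (rule qrep_eq; use pspaceD[OF B] circ_pt_carr in \<open>auto simp: wedge_rel_mem\<close>)+

lemma frolicher_susp: "frolicher (fst (susp B))"
  by (simp add: susp_def frolicher_quot)

lemma susp_pt_collapse:
  assumes B: "pspace B"
  shows "b \<in> carr (fst B) \<Longrightarrow> susp_pt B 0 b = snd (susp B)" "b \<in> carr (fst B) \<Longrightarrow> susp_pt B 1 b = snd (susp B)"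
    "0 \<le> t \<Longrightarrow> t \<le> 1 \<Longrightarrow> susp_pt B t (snd B) = snd (susp B)"
  unfolding susp_pt_def circ_q_1 circ_pt_def[symmetric]
  by (simp_all add: susp_q_wedge[OF B] carr_circsp)

lemma carr_susp: "carr (fst (susp B)) = {susp_pt B t b | t b. 0 \<le> t \<and> t \<le> 1 \<and> b \<in> carr (fst B)}"
proof -
  have "carr (fprod circsp (fst B)) = {Pr (circ_q (Re t)) b | t b. 0 \<le> t \<and> t \<le> 1 \<and> b \<in> carr (fst B)}"
    unfolding carr_fprod carr_circsp by fastforce
  moreover have "carr (fst (susp B)) = susp_q B ` carr (fprod circsp (fst B))" by (simp add: susp_def susp_q_def)
  ultimately show ?thesis unfolding susp_pt_def by auto
qed

lemma pspace_susp:
  assumes B: "pspace B" shows "pspace (susp B)"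
proof -
  have "snd (susp B) \<in> carr (fst (susp B))"
    unfolding carr_susp using susp_pt_collapse(1)[OF B pspaceD(2)[OF B]] pspaceD(2)[OF B]
    by (intro CollectI exI[of _ 0] exI[of _ "snd B"]) simp
  then show ?thesis by (simp add: pspace_def frolicher_susp)
qed

lemma crv_susp_pt:
  assumes B: "pspace B" and t: "t \<in> crv boldI" and b: "b \<in> crv (fst B)"
  shows "(\<lambda>r. susp_pt B (t r) (b r)) \<in> crv (fst (susp B))"
proof -
  have "(\<lambda>r. Pr (circ_q (Re (t r))) (b r)) \<in> crv (fprod circsp (fst B))"
    by (rule crv_fprodI[OF frolicher_circsp pspaceD(1)[OF B] crv_circ_q[OF t] b])
  from crv_quotI[OF frolicher_fprod this] show ?thesis
    by (simp add: susp_def susp_pt_def susp_q_def)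
qed

text \<open>Maps out of a suspension are given on representatives: since the quotient map picks
  representatives in the same type, such a map is its own factorisation.\<close>
lemma susp_pt_apply:
  assumes B: "pspace B" and K: "\<And>b. b \<in> carr (fst B) \<Longrightarrow> K (Pr (Re 0) b) = w" "\<And>b. b \<in> carr (fst B) \<Longrightarrow> K (Pr (Re 1) b) = w"
      "\<And>t. 0 \<le> t \<Longrightarrow> t \<le> 1 \<Longrightarrow> K (Pr (Re t) (snd B)) = w"
    and t: "0 \<le> t" "t \<le> 1" and b: "b \<in> carr (fst B)"
  shows "K (susp_pt B t b) = K (Pr (Re t) b)"
proof -
  have c: "K (Pr (circ_q (Re s)) b) = K (Pr (Re s) b)" if "0 \<le> s" "s \<le> 1" "b \<in> carr (fst B)" for s b
    using circ_q_invariant[of "\<lambda>p. K (Pr p b)" s] that K(1,2) by simp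
  have "K (susp_q B (Pr (circ_q (Re t)) b)) = K (Pr (circ_q (Re t)) b)"
  proof (rule susp_q_collapse[OF B, where w = w])
    show "K (Pr circ_pt b) = w" if "b \<in> carr (fst B)" for b using c[of 0 b] that K(1) by (simp add: circ_pt_def)
    show "K (Pr p (snd B)) = w" if p: "p \<in> carr circsp" for p
    proof -
      obtain s where "0 \<le> s" "s \<le> 1" "p = circ_q (Re s)" using p unfolding carr_circsp by auto
      then show ?thesis using c[of s "snd B"] K(3) pspaceD(2)[OF B] by simp
    qed
  qed (use t b in \<open>auto simp: carr_circsp\<close>)
  then show ?thesis using c[OF t b] by (simp add: susp_pt_def)
qed

lemma susp_param:
  assumes P: "frolicher P" and T: "frolicher T" and B: "pspace B"
    and K0: "\<And>p b. p \<in> carr P \<Longrightarrow> b \<in> carr (fst B) \<Longrightarrow> K p (Pr (Re 0) b) = w"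
      "\<And>p b. p \<in> carr P \<Longrightarrow> b \<in> carr (fst B) \<Longrightarrow> K p (Pr (Re 1) b) = w"
      "\<And>p t. p \<in> carr P \<Longrightarrow> 0 \<le> t \<Longrightarrow> t \<le> 1 \<Longrightarrow> K p (Pr (Re t) (snd B)) = w"
    and K: "\<And>p t b. p \<in> crv P \<Longrightarrow> t \<in> crv boldI \<Longrightarrow> b \<in> crv (fst B) \<Longrightarrow> (\<lambda>r. K (p r) (Pr (Re (t r)) (b r))) \<in> crv T"
    and p: "p \<in> crv P" and c: "c \<in> crv (fst (susp B))"
  shows "(\<lambda>r. K (p r) (c r)) \<in> crv T"
proof (rule quot_param[OF P T frolicher_fprod[of circsp "fst B"] _ _ p c[unfolded susp_def fst_conv]])
  have BF: "frolicher (fst B)" using pspaceD(1)[OF B] .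
  have c': "K p (Pr (circ_q (Re s)) b) = K p (Pr (Re s) b)" if "p \<in> carr P" "0 \<le> s" "s \<le> 1" "b \<in> carr (fst B)" for p s b
    using circ_q_invariant[of "\<lambda>q. K p (Pr q b)" s] that K0(1,2) by simp
  {
    fix p x assume p: "p \<in> carr P" and "x \<in> carr (fprod circsp (fst B))"
    then obtain q b where x: "x = Pr q b" "q \<in> carr circsp" "b \<in> carr (fst B)" by auto
    have "K p (susp_q B (Pr q b)) = K p (Pr q b)"
    proof (rule susp_q_collapse[OF B, where w = w])
      show "K p (Pr circ_pt b) = w" if "b \<in> carr (fst B)" for b using c'[of p 0 b] that K0(1) p by (simp add: circ_pt_def)
      show "K p (Pr q (snd B)) = w" if q: "q \<in> carr circsp" for q
      proof -
        obtain s where "0 \<le> s" "s \<le> 1" "q = circ_q (Re s)" using q unfolding carr_circsp by auto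
        then show ?thesis using c'[of p s "snd B"] K0(3) pspaceD(2)[OF B] p by simp
      qed
    qed (use x in auto)
    then show "K p (qrep (fprod circsp (fst B)) (wedge_rel B) x) = K p x" using x by (simp add: susp_q_def)
  }
  {
    fix p c assume p: "p \<in> crv P" and "c \<in> crv (fprod circsp (fst B))"
    then obtain a b where ab: "a \<in> crv circsp" "b \<in> crv (fst B)" "c = (\<lambda>r. Pr (a r) (b r))"
      unfolding crv_fprod[OF frolicher_circsp BF] by blast
    \<comment> \<open>The collapse of the wedge has been dealt with; now b joins the parameter and
      the circle is the remaining quotient.\<close>
    have "(\<lambda>r. K (fst (p r, b r)) (Pr (a r) (snd (p r, b r)))) \<in> crv T"
    proof (rule quot_param[where K = "\<lambda>z q. K (fst z) (Pr q (snd z))" and B = "prodsp P (fst B)" and S = Ifpt and R = circ_rel,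
          OF frolicher_prodsp T frolicher_Ifpt])
      show "a \<in> crv (quot Ifpt circ_rel)" using ab(1) by (simp add: circsp_def)
      show "(\<lambda>r. (p r, b r)) \<in> crv (prodsp P (fst B))" using p ab(2) by (simp add: crv_prodsp[OF P BF])
    next
      fix z and x :: "'c fpt" assume "z \<in> carr (prodsp P (fst B))" "x \<in> carr Ifpt"
      then show "K (fst z) (Pr (qrep Ifpt circ_rel x) (snd z)) = K (fst z) (Pr x (snd z))"
        using c'[of "fst z" _ "snd z"] by (auto simp: circ_q_def)
    next
      fix z and c :: "real \<Rightarrow> 'c fpt" assume z: "z \<in> crv (prodsp P (fst B))" and "c \<in> crv Ifpt"
      then obtain t where "t \<in> crv boldI" "c = (\<lambda>r. Re (t r))" by (auto simp: crv_Ifpt)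
      then show "(\<lambda>r. K (fst (z r)) (Pr (c r) (snd (z r)))) \<in> crv T"
        using K z by (simp add: crv_prodsp[OF P BF])
    qed
    then show "(\<lambda>r. K (p r) (c r)) \<in> crv T" using ab(3) by simp
  }
qed

definition un_Re :: "'a fpt \<Rightarrow> real" where "un_Re z = (case z of Re t \<Rightarrow> t | _ \<Rightarrow> undefined)"
definition un_Pt :: "'a fpt \<Rightarrow> 'a" where "un_Pt z = (case z of Pt a \<Rightarrow> a | _ \<Rightarrow> undefined)"

lemma un_simps [simp]: "un_Re (Re t) = t" "un_Pt (Pt a) = a"
  by (simp_all add: un_Re_def un_Pt_def)

definition susp_fun :: "(real \<Rightarrow> 'a fpt \<Rightarrow> 'b) \<Rightarrow> 'a fpt \<Rightarrow> 'b" where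
  "susp_fun G z = G (un_Re (pfst z)) (psnd z)"

lemma susp_fun_Pr [simp]: "susp_fun G (Pr (Re t) b) = G t b"
  by (simp add: susp_fun_def)

lemma susp_fun_apply:
  assumes B: "pspace B" and G: "\<And>b. b \<in> carr (fst B) \<Longrightarrow> G 0 b = w" "\<And>b. b \<in> carr (fst B) \<Longrightarrow> G 1 b = w"
      "\<And>t. 0 \<le> t \<Longrightarrow> t \<le> 1 \<Longrightarrow> G t (snd B) = w"
    and "0 \<le> t" "t \<le> 1" "b \<in> carr (fst B)"
  shows "susp_fun G (susp_pt B t b) = G t b"
  using susp_pt_apply[OF B, of "susp_fun G" w t b] assms by simp

lemma psmooth_susp_fun:
  assumes B: "pspace B" and W: "pspace W"
    and G0: "\<And>b. b \<in> carr (fst B) \<Longrightarrow> G 0 b = snd W" "\<And>b. b \<in> carr (fst B) \<Longrightarrow> G 1 b = snd W"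
      "\<And>t. 0 \<le> t \<Longrightarrow> t \<le> 1 \<Longrightarrow> G t (snd B) = snd W"
    and G: "\<And>t b. t \<in> crv boldI \<Longrightarrow> b \<in> crv (fst B) \<Longrightarrow> (\<lambda>r. G (t r) (b r)) \<in> crv (fst W)"
  shows "psmooth (susp B) W (susp_fun G)"
proof (rule psmoothI[OF pspace_susp[OF B] W])
  fix c assume c: "c \<in> crv (fst (susp B))"
  show "(\<lambda>r. susp_fun G (c r)) \<in> crv (fst W)"
    by (rule susp_param[where K = "\<lambda>_. susp_fun G" and P = realsp and p = "\<lambda>r. r" and w = "snd W", OF frolicher_realsp pspaceD(1)[OF W] B _ _ _ _ _ c])
       (simp_all add: G0 G crv_realsp smooth_id)
next
  show "susp_fun G (snd (susp B)) = snd W"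
    using susp_fun_apply[OF B, of G "snd W" 0 "snd B"] G0 pspaceD(2)[OF B] susp_pt_collapse(1)[OF B] by simp
qed

lemma susp_htpyI:
  assumes B: "pspace B" and W: "pspace W" and f: "psmooth (susp B) W f" "psmooth (susp B) W f'"
    and G0: "\<And>s b. 0 \<le> s \<Longrightarrow> s \<le> 1 \<Longrightarrow> b \<in> carr (fst B) \<Longrightarrow> G s 0 b = snd W"
      "\<And>s b. 0 \<le> s \<Longrightarrow> s \<le> 1 \<Longrightarrow> b \<in> carr (fst B) \<Longrightarrow> G s 1 b = snd W"
      "\<And>s t. 0 \<le> s \<Longrightarrow> s \<le> 1 \<Longrightarrow> 0 \<le> t \<Longrightarrow> t \<le> 1 \<Longrightarrow> G s t (snd B) = snd W"
    and G: "\<And>s t b. s \<in> crv Isp \<Longrightarrow> t \<in> crv boldI \<Longrightarrow> b \<in> crv (fst B) \<Longrightarrow> (\<lambda>r. G (s r) (t r) (b r)) \<in> crv (fst W)"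
    and e: "\<And>t b. 0 \<le> t \<Longrightarrow> t \<le> 1 \<Longrightarrow> b \<in> carr (fst B) \<Longrightarrow> G 0 t b = f (susp_pt B t b)"
      "\<And>t b. 0 \<le> t \<Longrightarrow> t \<le> 1 \<Longrightarrow> b \<in> carr (fst B) \<Longrightarrow> G 1 t b = f' (susp_pt B t b)"
  shows "(f, f') \<in> hrel (susp B) W"
proof -
  have ap: "susp_fun (G s) (susp_pt B t b) = G s t b" if "0 \<le> s" "s \<le> 1" "0 \<le> t" "t \<le> 1" "b \<in> carr (fst B)" for s t b
    using susp_fun_apply[OF B, of "G s" "snd W" t b] that G0 by simp
  have "phtpy (susp B) W f f'"
  proof (rule phtpyI[OF pspace_susp[OF B] W, where H = "\<lambda>s. susp_fun (G s)"])
    fix s c assume s: "s \<in> crv Isp" and c: "c \<in> crv (fst (susp B))"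
    show "(\<lambda>r. susp_fun (G (s r)) (c r)) \<in> crv (fst W)"
      by (rule susp_param[where K = "\<lambda>s. susp_fun (G s)" and w = "snd W", OF frolicher_Isp pspaceD(1)[OF W] B _ _ _ _ s c])
         (simp_all add: G0 G)
  next
    show "susp_fun (G 0) x = f x" "susp_fun (G 1) x = f' x" if "x \<in> carr (fst (susp B))" for x
      using that ap[of 0] ap[of 1] e by (auto simp: carr_susp)
    show "susp_fun (G t) (snd (susp B)) = snd W" if "0 \<le> t" "t \<le> 1" for t
      using ap[of t 0 "snd B"] that susp_pt_collapse(1)[OF B pspaceD(2)[OF B]] pspaceD(2)[OF B] G0(1)[of t "snd B"] by simp
  qed
  with f show ?thesis by (simp add: hrel_iff[OF pspace_susp[OF B] W])
qed

lemma susp_map_pt: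
  assumes B: "pspace B" and C: "pspace C" and g: "psmooth B C g" and t: "0 \<le> t" "t \<le> 1" and b: "b \<in> carr (fst B)"
  shows "susp_map C g (susp_pt B t b) = susp_pt C t (g b)"
proof -
  have "susp_map C g (susp_q B (Pr (circ_q (Re t)) b)) = susp_map C g (Pr (circ_q (Re t)) b)"
    by (rule susp_q_collapse[OF B, where w = "snd (susp C)"])
       (use t b in \<open>auto simp: susp_map_def susp_q_wedge[OF C] psmooth_carr[OF g] psmooth_pt[OF g] carr_circsp\<close>)
  then show ?thesis by (simp add: susp_pt_def susp_map_def)
qed

lemma psmooth_susp_map:
  assumes B: "pspace B" and C: "pspace C" and g: "psmooth B C g"
  shows "psmooth (susp B) (susp C) (susp_map C g)"
proof (rule psmoothI[OF pspace_susp[OF B] pspace_susp[OF C]])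
  fix c assume c: "c \<in> crv (fst (susp B))"
  show "(\<lambda>r. susp_map C g (c r)) \<in> crv (fst (susp C))"
  proof (rule quot_map[OF frolicher_fprod[of circsp "fst B"] frolicher_susp _ _ c[unfolded susp_def fst_conv]])
    fix x assume "x \<in> carr (fprod circsp (fst B))"
    then obtain q b where x: "x = Pr q b" "q \<in> carr circsp" "b \<in> carr (fst B)" by auto
    have "susp_map C g (susp_q B (Pr q b)) = susp_map C g (Pr q b)"
      by (rule susp_q_collapse[OF B, where w = "snd (susp C)"])
         (use x in \<open>auto simp: susp_map_def susp_q_wedge[OF C] psmooth_carr[OF g] psmooth_pt[OF g]\<close>)
    then show "susp_map C g (qrep (fprod circsp (fst B)) (wedge_rel B) x) = susp_map C g x"
      using x by (simp add: susp_q_def)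
  next
    fix c assume "c \<in> crv (fprod circsp (fst B))"
    then obtain a b where ab: "a \<in> crv circsp" "b \<in> crv (fst B)" "c = (\<lambda>r. Pr (a r) (b r))"
      unfolding crv_fprod[OF frolicher_circsp pspaceD(1)[OF B]] by blast
    have "(\<lambda>r. Pr (a r) (g (b r))) \<in> crv (fprod circsp (fst C))"
      by (rule crv_fprodI[OF frolicher_circsp pspaceD(1)[OF C] ab(1) psmooth_crv[OF B C g ab(2)]])
    from crv_quotI[OF frolicher_fprod this]
    show "(\<lambda>r. susp_map C g (c r)) \<in> crv (fst (susp C))"
      using ab by (simp add: susp_map_def susp_def susp_q_def)
  qed
next
  show "susp_map C g (snd (susp B)) = snd (susp C)"
    using susp_map_pt[OF B C g, of 0 "snd B"] susp_pt_collapse(1)[OF B] susp_pt_collapse(1)[OF C] pspaceD(2)[OF B] pspaceD(2)[OF C]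
      psmooth_pt[OF g] by simp
qed

section \<open>The mapping cone\<close>

locale pointed_inclusion =
  fixes A X :: "'a frol" and x0 :: 'a
  assumes A: "frolicher A" and X: "frolicher X" and sub: "carr A \<subseteq> carr X" and x0: "x0 \<in> carr A"
    and incl: "smooth_map A X id"
begin

abbreviation "LA \<equiv> (liftsp A, Pt x0)"
abbreviation "LX \<equiv> (liftsp X, Pt x0)"
abbreviation "T \<equiv> cone A X x0"

lemma pspace_LA: "pspace LA" and pspace_LX: "pspace LX"
  using x0 sub by (auto simp: pspace_def frolicher_liftsp)

lemma crv_A_X: "c \<in> crv A \<Longrightarrow> c \<in> crv X"
  using smooth_mapD[OF A X incl, of c] by simp

lemma crv_LA: "a \<in> crv A \<Longrightarrow> (\<lambda>r. Pt (a r)) \<in> crv (liftsp A)"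
  and crv_LX: "x \<in> crv X \<Longrightarrow> (\<lambda>r. Pt (x r)) \<in> crv (liftsp X)"
  by (auto simp: crv_liftsp A X)

lemma crv_LA_E: "c \<in> crv (liftsp A) \<Longrightarrow> (\<And>a. a \<in> crv A \<Longrightarrow> c = (\<lambda>r. Pt (a r)) \<Longrightarrow> thesis) \<Longrightarrow> thesis"
  and crv_LX_E: "c \<in> crv (liftsp X) \<Longrightarrow> (\<And>x. x \<in> crv X \<Longrightarrow> c = (\<lambda>r. Pt (x r)) \<Longrightarrow> thesis) \<Longrightarrow> thesis"
  by (auto simp: crv_liftsp A X)

lemma psmooth_incl: "psmooth LA LX id"
  by (rule psmoothI[OF pspace_LA pspace_LX]) (auto elim!: crv_LA_E intro!: crv_LX crv_A_X)

text \<open>\<open>cone1 t a\<close> is the class [t, a] and \<open>cone2 x\<close> the class [x]: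
  the tip is at t = 0, and X is glued on at t = 1.\<close>

definition cone1 :: "real \<Rightarrow> 'a \<Rightarrow> 'a fpt" where
  "cone1 t a = cone_q A X x0 (cyl_q A X (InL (Pr (Re t) (Pt a))))"

definition cone2 :: "'a \<Rightarrow> 'a fpt" where
  "cone2 x = cone_q A X x0 (cyl_q A X (InR (Pt x)))"

lemma cone_j_Pt: "cone_j A X x0 (Pt x) = cone2 x"
  by (simp add: cone_j_def cone2_def)

lemma frolicher_cyl_pre: "frolicher (cyl_pre A X)"
  unfolding cyl_pre_def by (rule frolicher_fcoprod)

lemma frolicher_cyl: "frolicher (cyl A X)"
  unfolding cyl_def by (rule frolicher_quot)

lemma carr_cyl_pre: "carr (cyl_pre A X) = {InL (Pr (Re t) (Pt a)) | t a. 0 \<le> t \<and> t \<le> 1 \<and> a \<in> carr A} \<union> {InR (Pt x) | x. x \<in> carr X}"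
  unfolding cyl_pre_def carr_fcoprod carr_fprod carr_liftsp carr_Ifpt by fastforce

lemma carr_cyl: "carr (cyl A X) = cyl_q A X ` carr (cyl_pre A X)"
  by (simp add: cyl_def cyl_q_def)

lemma carr_cone: "carr (fst T) = {cone1 t a | t a. 0 \<le> t \<and> t \<le> 1 \<and> a \<in> carr A} \<union> {cone2 x | x. x \<in> carr X}"
proof -
  have "carr (fst T) = cone_q A X x0 ` cyl_q A X ` carr (cyl_pre A X)"
    by (simp add: cone_def cone_q_def carr_cyl)
  then show ?thesis unfolding carr_cyl_pre cone1_def cone2_def by auto
qed

lemma snd_cone: "snd T = cone1 0 x0"
  by (simp add: cone_def cone1_def)

lemma pspace_cone: "pspace T"
proof -
  have "frolicher (fst T)" by (simp add: cone_def frolicher_quot)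
  moreover have "snd T \<in> carr (fst T)" unfolding carr_cone snd_cone using x0 by (intro UnI1 CollectI exI[of _ 0] exI[of _ x0]) simp
  ultimately show ?thesis by (simp add: pspace_def)
qed

lemma cone1_1: "a \<in> carr A \<Longrightarrow> cone1 1 a = cone2 a"
  unfolding cone1_def cone2_def cyl_q_def by (rule arg_cong[where f = "cone_q A X x0"], rule qrep_eq) (auto simp: cyl_rel_def)

lemma cone_collapse: "a \<in> carr A \<Longrightarrow> cone1 0 a = snd T" "0 \<le> t \<Longrightarrow> t \<le> 1 \<Longrightarrow> cone1 t x0 = snd T"
  unfolding snd_cone cone1_def cone_q_def
  by (rule qrep_eq; use x0 in \<open>force simp: cone_coll_def\<close>)+

lemma cone2_x0: "cone2 x0 = snd T"
  using cone1_1[OF x0] cone_collapse(2)[of 1] by simp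

lemma crv_cone1:
  assumes "t \<in> crv boldI" "a \<in> crv A" shows "(\<lambda>r. cone1 (t r) (a r)) \<in> crv (fst T)"
proof -
  have "(\<lambda>r. Re (t r)) \<in> crv Ifpt" using assms by (auto simp: crv_Ifpt)
  from crv_fprodI[OF frolicher_Ifpt frolicher_liftsp this crv_LA[OF assms(2)]]
  have "(\<lambda>r. InL (Pr (Re (t r)) (Pt (a r)))) \<in> crv (cyl_pre A X)"
    unfolding cyl_pre_def by (rule crv_fcoprodI(1)[OF frolicher_fprod])
  from crv_quotI[OF frolicher_cyl crv_quotI[OF frolicher_cyl_pre this, of "cyl_rel A", folded cyl_def cyl_q_def]]
  show ?thesis unfolding cone_def cone1_def fst_conv cone_q_def .
qed

lemma crv_cone2:
  assumes "x \<in> crv X" shows "(\<lambda>r. cone2 (x r)) \<in> crv (fst T)"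
proof -
  have "(\<lambda>r. InR (Pt (x r))) \<in> crv (cyl_pre A X)"
    unfolding cyl_pre_def by (rule crv_fcoprodI(2)[OF frolicher_liftsp crv_LX[OF assms]])
  from crv_quotI[OF frolicher_cyl crv_quotI[OF frolicher_cyl_pre this, of "cyl_rel A", folded cyl_def cyl_q_def]]
  show ?thesis unfolding cone_def cone2_def fst_conv cone_q_def .
qed

text \<open>K, given on representatives, respects the generating pairs of both quotients; w is its
  value on the part collapsed to the base point. This is what a map or a stage of a homotopy on the
  cone has to satisfy besides smoothness.\<close>

definition compatible :: "('a fpt \<Rightarrow> 'b) \<Rightarrow> 'b \<Rightarrow> bool" where
  "compatible K w \<longleftrightarrow> (\<forall>a\<in>carr A. K (InL (Pr (Re 1) (Pt a))) = K (InR (Pt a)) \<and> K (InL (Pr (Re 0) (Pt a))) = w) \<and>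
     (\<forall>t\<in>{0..1}. K (InL (Pr (Re t) (Pt x0))) = w)"

lemma cyl_q_invariant:
  assumes "compatible K w" "z \<in> carr (cyl_pre A X)" shows "K (cyl_q A X z) = K z"
  unfolding cyl_q_def
proof (rule qrep_invariant[OF _ assms(2)])
  fix x y assume "(x, y) \<in> cyl_rel A"
  then show "K x = K y" using assms(1) unfolding cyl_rel_def compatible_def by auto
qed

lemma cone_q_invariant:
  assumes K: "compatible K w" and z: "z \<in> carr (cyl A X)" shows "K (cone_q A X x0 z) = K z"
  unfolding cone_q_def
proof (rule qrep_invariant[OF _ z])
  have w: "K y = w" if "y \<in> cone_coll A X x0" for y
  proof -
    from that consider a where "y = cyl_q A X (InL (Pr (Re 0) (Pt a)))" "a \<in> carr A"
      | t where "y = cyl_q A X (InL (Pr (Re t) (Pt x0)))" "0 \<le> t" "t \<le> 1" unfolding cone_coll_def by auto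
    then show ?thesis
    proof cases
      case 1
      have "InL (Pr (Re 0) (Pt a)) \<in> carr (cyl_pre A X)" unfolding carr_cyl_pre using 1(2) by force
      from cyl_q_invariant[OF K this] show ?thesis using 1 K by (simp add: compatible_def)
    next
      case 2
      have "InL (Pr (Re t) (Pt x0)) \<in> carr (cyl_pre A X)" unfolding carr_cyl_pre using 2 x0 by force
      from cyl_q_invariant[OF K this] show ?thesis using 2 K by (simp add: compatible_def)
    qed
  qed
  fix x y assume "(x, y) \<in> cone_coll A X x0 \<times> cone_coll A X x0"
  then show "K x = K y" using w by auto
qed

lemma compatible_apply:
  assumes K: "compatible K w"
  shows "0 \<le> t \<Longrightarrow> t \<le> 1 \<Longrightarrow> a \<in> carr A \<Longrightarrow> K (cone1 t a) = K (InL (Pr (Re t) (Pt a)))"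
    "x \<in> carr X \<Longrightarrow> K (cone2 x) = K (InR (Pt x))"
proof -
  have *: "K (cone_q A X x0 (cyl_q A X z)) = K z" if "z \<in> carr (cyl_pre A X)" for z
    using cyl_q_invariant[OF K that] cone_q_invariant[OF K, of "cyl_q A X z"] that by (simp add: carr_cyl)
  show "0 \<le> t \<Longrightarrow> t \<le> 1 \<Longrightarrow> a \<in> carr A \<Longrightarrow> K (cone1 t a) = K (InL (Pr (Re t) (Pt a)))"
    unfolding cone1_def by (rule *) (force simp: carr_cyl_pre)
  show "x \<in> carr X \<Longrightarrow> K (cone2 x) = K (InR (Pt x))"
    unfolding cone2_def by (rule *) (force simp: carr_cyl_pre)
qed

text \<open>The collapse, the gluing and the coproduct are undone in turn, each with the parameter
  present.\<close>

lemma cone_param: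
  assumes P: "frolicher P" and W: "frolicher W" and comp: "\<And>p. p \<in> carr P \<Longrightarrow> compatible (K p) w"
    and K1: "\<And>p t a. p \<in> crv P \<Longrightarrow> t \<in> crv boldI \<Longrightarrow> a \<in> crv A \<Longrightarrow> (\<lambda>r. K (p r) (InL (Pr (Re (t r)) (Pt (a r))))) \<in> crv W"
    and K2: "\<And>p x. p \<in> crv P \<Longrightarrow> x \<in> crv X \<Longrightarrow> (\<lambda>r. K (p r) (InR (Pt (x r)))) \<in> crv W"
    and p: "p \<in> crv P" and c: "c \<in> crv (fst T)"
  shows "(\<lambda>r. K (p r) (c r)) \<in> crv W"
proof (rule quot_param[OF P W frolicher_cyl _ _ p c[unfolded cone_def fst_conv]])
  show "K p (qrep (cyl A X) (cone_coll A X x0 \<times> cone_coll A X x0) z) = K p z" if "p \<in> carr P" "z \<in> carr (cyl A X)" for p z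
    using cone_q_invariant[OF comp[OF that(1)] that(2)] by (simp add: cone_q_def)
  fix p c assume p: "p \<in> crv P" and c: "c \<in> crv (cyl A X)"
  show "(\<lambda>r. K (p r) (c r)) \<in> crv W"
  proof (rule quot_param[OF P W frolicher_cyl_pre _ _ p c[unfolded cyl_def]])
    show "K p (qrep (cyl_pre A X) (cyl_rel A) z) = K p z" if "p \<in> carr P" "z \<in> carr (cyl_pre A X)" for p z
      using cyl_q_invariant[OF comp[OF that(1)] that(2)] by (simp add: cyl_q_def)
    fix p c assume p: "p \<in> crv P" and c: "c \<in> crv (cyl_pre A X)"
    show "(\<lambda>r. K (p r) (c r)) \<in> crv W"
    proof (rule fcoprod_param[OF P W frolicher_fprod frolicher_liftsp _ _ p c[unfolded cyl_pre_def]])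
      fix p c assume p: "p \<in> crv P" and "c \<in> crv (fprod Ifpt (liftsp A))"
      then obtain t a where "t \<in> crv boldI" "a \<in> crv A" "c = (\<lambda>r. Pr (Re (t r)) (Pt (a r)))"
        unfolding crv_fprod[OF frolicher_Ifpt frolicher_liftsp] by (auto simp: crv_Ifpt crv_liftsp[OF A])
      then show "(\<lambda>r. K (p r) (InL (c r))) \<in> crv W" using K1[OF p] by simp
    next
      fix p c assume p: "p \<in> crv P" and "c \<in> crv (liftsp X)"
      then show "(\<lambda>r. K (p r) (InR (c r))) \<in> crv W" using K2[OF p] by (auto elim!: crv_LX_E)
    qed
  qed
qed

definition cone_fun :: "(real \<Rightarrow> 'a \<Rightarrow> 'b) \<Rightarrow> ('a \<Rightarrow> 'b) \<Rightarrow> 'a fpt \<Rightarrow> 'b" where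
  "cone_fun G f z = (case z of InL y \<Rightarrow> G (un_Re (pfst y)) (un_Pt (psnd y)) | InR y \<Rightarrow> f (un_Pt y) | _ \<Rightarrow> undefined)"

lemma cone_fun_simps [simp]: "cone_fun G f (InL (Pr (Re t) (Pt a))) = G t a" "cone_fun G f (InR (Pt x)) = f x"
  by (simp_all add: cone_fun_def)

lemma compatible_cone_fun:
  assumes "\<And>a. a \<in> carr A \<Longrightarrow> G 1 a = f a" "\<And>a. a \<in> carr A \<Longrightarrow> G 0 a = w" "\<And>t. 0 \<le> t \<Longrightarrow> t \<le> 1 \<Longrightarrow> G t x0 = w"
  shows "compatible (cone_fun G f) w"
  using assms by (simp add: compatible_def)

lemma psmooth_compatible:
  assumes W: "pspace W" and K: "compatible K (snd W)"
    and K1: "\<And>t a. t \<in> crv boldI \<Longrightarrow> a \<in> crv A \<Longrightarrow> (\<lambda>r. K (InL (Pr (Re (t r)) (Pt (a r))))) \<in> crv (fst W)"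
    and K2: "\<And>x. x \<in> crv X \<Longrightarrow> (\<lambda>r. K (InR (Pt (x r)))) \<in> crv (fst W)"
  shows "psmooth T W K"
proof (rule psmoothI[OF pspace_cone W])
  fix c assume c: "c \<in> crv (fst T)"
  show "(\<lambda>r. K (c r)) \<in> crv (fst W)"
    by (rule cone_param[where K = "\<lambda>_. K" and P = realsp and p = "\<lambda>r. r", OF frolicher_realsp pspaceD(1)[OF W] K _ _ _ c])
       (simp_all add: K1 K2 crv_realsp smooth_id)
next
  show "K (snd T) = snd W" using compatible_apply(1)[OF K, of 0 x0] x0 K by (simp add: snd_cone compatible_def)
qed

lemma psmooth_cone_fun:
  assumes W: "pspace W"
    and G0: "\<And>a. a \<in> carr A \<Longrightarrow> G 1 a = f a" "\<And>a. a \<in> carr A \<Longrightarrow> G 0 a = snd W" "\<And>t. 0 \<le> t \<Longrightarrow> t \<le> 1 \<Longrightarrow> G t x0 = snd W"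
    and G: "\<And>t a. t \<in> crv boldI \<Longrightarrow> a \<in> crv A \<Longrightarrow> (\<lambda>r. G (t r) (a r)) \<in> crv (fst W)"
    and f: "\<And>x. x \<in> crv X \<Longrightarrow> (\<lambda>r. f (x r)) \<in> crv (fst W)"
  shows "psmooth T W (cone_fun G f)"
    "0 \<le> t \<Longrightarrow> t \<le> 1 \<Longrightarrow> a \<in> carr A \<Longrightarrow> cone_fun G f (cone1 t a) = G t a"
    "x \<in> carr X \<Longrightarrow> cone_fun G f (cone2 x) = f x"
  using psmooth_compatible[OF W compatible_cone_fun[of G f "snd W", OF G0]] compatible_apply[OF compatible_cone_fun[of G f "snd W", OF G0]] G f by simp_all

lemma cone_htpyI:
  assumes W: "pspace W" and g: "psmooth T W g" "psmooth T W g'"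
    and G0: "\<And>s a. 0 \<le> s \<Longrightarrow> s \<le> 1 \<Longrightarrow> a \<in> carr A \<Longrightarrow> G s 1 a = f s a" "\<And>s a. 0 \<le> s \<Longrightarrow> s \<le> 1 \<Longrightarrow> a \<in> carr A \<Longrightarrow> G s 0 a = snd W"
      "\<And>s t. 0 \<le> s \<Longrightarrow> s \<le> 1 \<Longrightarrow> 0 \<le> t \<Longrightarrow> t \<le> 1 \<Longrightarrow> G s t x0 = snd W"
    and G: "\<And>s t a. s \<in> crv Isp \<Longrightarrow> t \<in> crv boldI \<Longrightarrow> a \<in> crv A \<Longrightarrow> (\<lambda>r. G (s r) (t r) (a r)) \<in> crv (fst W)"
    and f: "\<And>s x. s \<in> crv Isp \<Longrightarrow> x \<in> crv X \<Longrightarrow> (\<lambda>r. f (s r) (x r)) \<in> crv (fst W)"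
    and e: "\<And>t a. 0 \<le> t \<Longrightarrow> t \<le> 1 \<Longrightarrow> a \<in> carr A \<Longrightarrow> G 0 t a = g (cone1 t a)"
      "\<And>t a. 0 \<le> t \<Longrightarrow> t \<le> 1 \<Longrightarrow> a \<in> carr A \<Longrightarrow> G 1 t a = g' (cone1 t a)"
      "\<And>x. x \<in> carr X \<Longrightarrow> f 0 x = g (cone2 x)" "\<And>x. x \<in> carr X \<Longrightarrow> f 1 x = g' (cone2 x)"
  shows "(g, g') \<in> hrel T W"
proof -
  have comp: "compatible (cone_fun (G s) (f s)) (snd W)" if "0 \<le> s" "s \<le> 1" for s
    by (rule compatible_cone_fun) (use G0 that in auto)
  have "phtpy T W g g'"
  proof (rule phtpyI[OF pspace_cone W, where H = "\<lambda>s. cone_fun (G s) (f s)"])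
    fix s c assume s: "s \<in> crv Isp" and c: "c \<in> crv (fst T)"
    show "(\<lambda>r. cone_fun (G (s r)) (f (s r)) (c r)) \<in> crv (fst W)"
      by (rule cone_param[where K = "\<lambda>s. cone_fun (G s) (f s)" and w = "snd W", OF frolicher_Isp pspaceD(1)[OF W] _ _ _ s c])
         (simp_all add: comp G f)
  next
    show "cone_fun (G 0) (f 0) x = g x" "cone_fun (G 1) (f 1) x = g' x" if "x \<in> carr (fst T)" for x
      using that compatible_apply[OF comp[of 0]] compatible_apply[OF comp[of 1]] e by (auto simp: carr_cone)
    show "cone_fun (G s) (f s) (snd T) = snd W" if "0 \<le> s" "s \<le> 1" for s
      using compatible_apply(1)[OF comp[OF that], of 0 x0] that x0 G0(2) by (simp add: snd_cone)
  qed
  with g show ?thesis by (simp add: hrel_iff[OF pspace_cone W])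
qed

lemma psmooth_j: "psmooth LX T (cone_j A X x0)"
  by (rule psmoothI[OF pspace_LX pspace_cone]) (auto elim!: crv_LX_E simp: cone_j_Pt crv_cone2 cone2_x0)

lemma cone_k_rep:
  "cone_k A x0 (InL (Pr (Re t) (Pt a))) = susp_pt LA t (Pt a)" "cone_k A x0 (InR z) = snd (susp LA)"
  by (simp_all add: cone_k_def susp_pt_def)

lemma compatible_k: "compatible (cone_k A x0) (snd (susp LA))"
  unfolding compatible_def cone_k_rep using susp_pt_collapse[OF pspace_LA] by simp

lemma cone_k_apply:
  "0 \<le> t \<Longrightarrow> t \<le> 1 \<Longrightarrow> a \<in> carr A \<Longrightarrow> cone_k A x0 (cone1 t a) = susp_pt LA t (Pt a)"
  "x \<in> carr X \<Longrightarrow> cone_k A x0 (cone2 x) = snd (susp LA)"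
  using compatible_apply[OF compatible_k] by (simp_all add: cone_k_rep)

lemma psmooth_k: "psmooth T (susp LA) (cone_k A x0)"
  by (rule psmooth_compatible[OF pspace_susp[OF pspace_LA] compatible_k])
     (simp_all add: cone_k_rep crv_susp_pt[OF pspace_LA] crv_LA crv_const[OF frolicher_susp] pspaceD(2)[OF pspace_susp[OF pspace_LA]])

text \<open>The straight line from the flattened coordinate to its image under
  \<open>mid_step\<close> fixes 0 and 1, so it respects the gluing and the collapse. Up to homotopy
  a map on the cone is therefore constant in t near both ends.\<close>

lemma cone_reparam:
  assumes W: "pspace W" and f: "psmooth T W f" and f': "psmooth T W f'"
    and e: "\<And>t a. 0 \<le> t \<Longrightarrow> t \<le> 1 \<Longrightarrow> a \<in> carr A \<Longrightarrow> f' (cone1 t a) = f (cone1 (mid_step t) a)"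
      "\<And>x. x \<in> carr X \<Longrightarrow> f' (cone2 x) = f (cone2 x)"
  shows "(f, f') \<in> hrel T W"
proof (rule cone_htpyI[OF W f f', where G = "\<lambda>s t a. f (cone1 ((1 - s) * t + s * mid_step t) a)" and f = "\<lambda>s x. f (cone2 x)"])
  show "f (cone1 ((1 - s) * t + s * mid_step t) x0) = snd W" if "0 \<le> s" "s \<le> 1" "0 \<le> t" "t \<le> 1" for s t
    using convex_unit[of s t "mid_step t"] that mid_step_range[of t] cone_collapse(2) psmooth_pt[OF f] by simp
qed (simp_all add: cone1_1 cone_collapse psmooth_pt[OF f] e
      psmooth_crv[OF pspace_cone W f crv_cone1[OF crv_flatten_homotopy]] psmooth_crv[OF pspace_cone W f crv_cone2])


section \<open>Exactness at the unsuspended terms\<close>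

lemma crv_Isp_const: "0 \<le> t \<Longrightarrow> t \<le> 1 \<Longrightarrow> (\<lambda>_. t) \<in> crv Isp"
  by (simp add: crv_Isp smooth_const)

text \<open>On A the map j contracts by sliding down the cone from t = 1 to the tip. Conversely a
  null-homotopy of f on A, run backwards and flattened by \<open>mid_step\<close>, extends f over
  the cone.\<close>

lemma exact_at_X:
  assumes W: "pspace W"
  shows "exact_at W LA LX T id (cone_j A X x0)"
  unfolding exact_at_iff[OF W pspace_LA pspace_LX pspace_cone psmooth_incl psmooth_j]
proof (intro allI impI iffI)
  fix f assume f: "psmooth LX W f" and "\<exists>f'. psmooth T W f' \<and> (f' \<circ> cone_j A X x0, f) \<in> hrel LX W"
  then obtain f' where f': "psmooth T W f'" "(f' \<circ> cone_j A X x0, f) \<in> hrel LX W" by blast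
  have "phtpy LA W (f' \<circ> cone_j A X x0 \<circ> id) (\<lambda>_. snd W)"
  proof (rule phtpyI[OF pspace_LA W, where H = "\<lambda>s z. f' (cone1 (1 - s) (un_Pt z))"])
    fix s c assume "s \<in> crv Isp" "c \<in> crv (fst LA)"
    then show "(\<lambda>r. f' (cone1 (1 - s r) (un_Pt (c r)))) \<in> crv (fst W)"
      by (auto elim!: crv_LA_E intro!: psmooth_crv[OF pspace_cone W f'(1)] crv_cone1 crv_Isp_boldI crv_Isp_flip)
  qed (auto simp: cone_j_Pt cone1_1 cone_collapse psmooth_pt[OF f'(1)])
  then have "(f' \<circ> cone_j A X x0 \<circ> id, \<lambda>_. snd W) \<in> hrel LA W"
    using psmooth_comp[OF pspace_LA pspace_LX W psmooth_incl psmooth_comp[OF pspace_LX pspace_cone W psmooth_j f'(1)]]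
      psmooth_const[OF pspace_LA W] by (simp add: hrel_iff[OF pspace_LA W])
  with hrel_sym[OF pspace_LA W hrel_precomp[OF pspace_LA pspace_LX W psmooth_incl f'(2)]]
  show "(f \<circ> id, \<lambda>_. snd W) \<in> hrel LA W" by (rule hrel_trans[OF pspace_LA W])
next
  fix f assume f: "psmooth LX W f" and "(f \<circ> id, \<lambda>_. snd W) \<in> hrel LA W"
  then have ph: "phtpy LA W f (\<lambda>_. snd W)" by (simp add: hrel_iff[OF pspace_LA W])
  obtain H where "htpy LA W f (\<lambda>_. snd W) H"
    by (rule phtpyE[OF pspace_LA W ph])
  note H = htpyD[OF this]
  define G where "G t a = H (1 - mid_step t) (Pt a)" for t a
  have G: "\<And>a. a \<in> carr A \<Longrightarrow> G 1 a = f (Pt a)" "\<And>a. a \<in> carr A \<Longrightarrow> G 0 a = snd W"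
     "\<And>t. 0 \<le> t \<Longrightarrow> t \<le> 1 \<Longrightarrow> G t x0 = snd W"
     "\<And>t a. t \<in> crv boldI \<Longrightarrow> a \<in> crv A \<Longrightarrow> (\<lambda>r. G (t r) (a r)) \<in> crv (fst W)"
     "\<And>x. x \<in> crv X \<Longrightarrow> (\<lambda>r. f (Pt (x r))) \<in> crv (fst W)"
    using H(4)[of "1 - mid_step t" for t] mid_step_range
    by (simp_all add: G_def H crv_Isp_flip crv_mid_step crv_LA psmooth_crv[OF pspace_LX W f] crv_LX)
  note F = psmooth_cone_fun[of W G "\<lambda>x. f (Pt x)", OF W G]
  have "(cone_fun G (\<lambda>x. f (Pt x)) \<circ> cone_j A X x0, f) \<in> hrel LX W"
    by (rule hrel_agree[OF pspace_LX W psmooth_comp[OF pspace_LX pspace_cone W psmooth_j F(1)] f])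
       (auto simp: cone_j_Pt F(3))
  with F(1) show "\<exists>f'. psmooth T W f' \<and> (f' \<circ> cone_j A X x0, f) \<in> hrel LX W" by blast
qed

text \<open>The null-homotopy H on X has to be extended to the whole cone. After reparametrisation f
  is constant in t on a collar of X, and there H may run with a time that fades out away from X. At
  the end of the homotopy X goes to the base point, so the map factors through k.\<close>

lemma exact_at_cone:
  assumes W: "pspace W"
  shows "exact_at W LX T (susp LA) (cone_j A X x0) (cone_k A x0)"
  unfolding exact_at_iff[OF W pspace_LX pspace_cone pspace_susp[OF pspace_LA] psmooth_j psmooth_k]
proof (intro allI impI iffI)
  fix f assume f: "psmooth T W f" and "\<exists>f'. psmooth (susp LA) W f' \<and> (f' \<circ> cone_k A x0, f) \<in> hrel T W"
  then obtain f' where f': "psmooth (susp LA) W f'" "(f' \<circ> cone_k A x0, f) \<in> hrel T W" by blast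
  have "(f' \<circ> cone_k A x0 \<circ> cone_j A X x0, \<lambda>_. snd W) \<in> hrel LX W"
    by (rule hrel_agree[OF pspace_LX W psmooth_comp[OF pspace_LX pspace_cone W psmooth_j
          psmooth_comp[OF pspace_cone pspace_susp[OF pspace_LA] W psmooth_k f'(1)]] psmooth_const[OF pspace_LX W]])
       (auto simp: cone_j_Pt cone_k_apply psmooth_pt[OF f'(1)])
  with hrel_sym[OF pspace_LX W hrel_precomp[OF pspace_LX pspace_cone W psmooth_j f'(2)]]
  show "(f \<circ> cone_j A X x0, \<lambda>_. snd W) \<in> hrel LX W" by (rule hrel_trans[OF pspace_LX W])
next
  fix f assume f: "psmooth T W f" and "(f \<circ> cone_j A X x0, \<lambda>_. snd W) \<in> hrel LX W"
  then have ph: "phtpy LX W (f \<circ> cone_j A X x0) (\<lambda>_. snd W)" by (simp add: hrel_iff[OF pspace_LX W])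
  obtain H where "htpy LX W (f \<circ> cone_j A X x0) (\<lambda>_. snd W) H"
    by (rule phtpyE[OF pspace_LX W ph])
  note H = htpyD[OF this]
  have H0: "H 0 (Pt x) = f (cone2 x)" if "x \<in> carr X" for x using H(2)[of "Pt x"] that by (simp add: cone_j_Pt)
  have H1: "H 1 (Pt x) = snd W" if "x \<in> carr X" for x using H(3)[of "Pt x"] that by simp
  \<comment> \<open>\<open>mid_step\<close> is 1 from 3/4 on and \<open>st\<close> is 0 up to 7/8,
    so the two formulas for G agree in between; 27/32 is the midpoint of the band from 13/16 to 7/8
    in which they are glued. \<open>st\<close> reaches 1 already at 15/16, which makes it flat at
    the end and so smooth along flattened coordinates.\<close>
  define st where "st = smooth_step (7/8) (15/16)"
  define G where "G s t a = (if t \<le> 27/32 then f (cone1 (mid_step t) a) else H (s * st t) (Pt a))" for s t a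
  have st: "st t = 0" if "t \<le> 7/8" for t using that by (simp add: st_def smooth_step_0)
  have st1: "st 1 = 1" by (simp add: st_def smooth_step_1)
  have st01: "0 \<le> st t" "st t \<le> 1" for t by (simp_all add: st_def smooth_step_range)
  have fm: "(\<lambda>r. f (cone1 (mid_step (t r)) (a r))) \<in> crv (fst W)" if "t \<in> crv boldI" "a \<in> crv A" for t a
    by (intro psmooth_crv[OF pspace_cone W f] crv_cone1 crv_Isp_boldI crv_mid_step that)
  have G1: "G s 1 a = H s (Pt a)" and G0: "a \<in> carr A \<Longrightarrow> G s 0 a = snd W" for s a
    by (simp_all add: G_def st1 cone_collapse psmooth_pt[OF f])
  have Gx: "G s t x0 = snd W" if "0 \<le> s" "s \<le> 1" for s t
    using that st01[of t] mid_step_range[of t] H(4)[of "s * st t"] by (simp add: G_def cone_collapse psmooth_pt[OF f] mult_le_one)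
  have Gs: "(\<lambda>r. G (s r) (t r) (a r)) \<in> crv (fst W)" if s: "s \<in> crv Isp" and t: "t \<in> crv boldI" and a: "a \<in> crv A" for s t a
  proof (rule crv_glue[OF pspaceD(1)[OF W], where \<tau> = "\<lambda>r. smooth_step (13/16) (7/8) (t r)"])
    have aX: "a r \<in> carr X" for r using crv_carr[OF X crv_A_X[OF a]] .
    have aA: "a r \<in> carr A" for r using crv_carr[OF A a] .
    show "smooth_rr (\<lambda>r. smooth_step (13/16) (7/8) (t r))" by (rule boldI_smooth_step[OF _ _ _ t]) simp_all
    show "(\<lambda>r. f (cone1 (mid_step (t r)) (a r))) \<in> crv (fst W)" by (rule fm[OF t a])
    have "(\<lambda>r. st (t r)) \<in> crv Isp" unfolding st_def using boldI_smooth_step[OF _ _ _ t, of "7/8" "15/16"]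
      by (simp add: crv_Isp smooth_step_range)
    then show "(\<lambda>r. H (s r * st (t r)) (Pt (a r))) \<in> crv (fst W)"
      by (intro H(1) crv_Isp_mult s) (simp_all add: crv_LX crv_A_X a)
    show "G (s r) (t r) (a r) = f (cone1 (mid_step (t r)) (a r))" if "smooth_step (13/16) (7/8) (t r) < 1" for r
    proof -
      have "t r < 7/8" using that smooth_step_1[of "13/16" "7/8" "t r"] by (cases "t r < 7/8") auto
      then show ?thesis by (simp add: G_def st H0[OF aX] mid_step_1 cone1_1[OF aA])
    qed
    show "G (s r) (t r) (a r) = H (s r * st (t r)) (Pt (a r))" if "smooth_step (13/16) (7/8) (t r) > 0" for r
    proof -
      have "t r > 13/16" using that smooth_step_0[of "t r" "13/16" "7/8"] by (cases "t r > 13/16") auto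
      then show ?thesis by (simp add: G_def st H0[OF aX] mid_step_1 cone1_1[OF aA])
    qed
  qed
  have G00: "G 0 t a = f (cone1 (mid_step t) a)" if "a \<in> carr A" for t a
    using that sub by (auto simp: G_def H0 mid_step_1 cone1_1)
  have HX: "(\<lambda>r. H (s r) (Pt (x r))) \<in> crv (fst W)" if "s \<in> crv Isp" "x \<in> crv X" for s x
    using H(1)[OF that(1), of "\<lambda>r. Pt (x r)"] crv_LX[OF that(2)] by simp
  have F: "psmooth T W (cone_fun (G s) (\<lambda>x. H s (Pt x)))"
      "0 \<le> t \<Longrightarrow> t \<le> 1 \<Longrightarrow> a \<in> carr A \<Longrightarrow> cone_fun (G s) (\<lambda>x. H s (Pt x)) (cone1 t a) = G s t a"
      "x \<in> carr X \<Longrightarrow> cone_fun (G s) (\<lambda>x. H s (Pt x)) (cone2 x) = H s (Pt x)" if "0 \<le> s" "s \<le> 1" for s t a x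
    using psmooth_cone_fun[of W "G s" "\<lambda>x. H s (Pt x)", OF W G1 G0 Gx[OF that]
        Gs[OF crv_Isp_const[OF that]] HX[OF crv_Isp_const[OF that]]] by simp_all
  let ?F0 = "cone_fun (G 0) (\<lambda>x. H 0 (Pt x))" and ?F1 = "cone_fun (G 1) (\<lambda>x. H 1 (Pt x))"
  have "(f, ?F0) \<in> hrel T W"
    by (rule cone_reparam[OF W f F(1)]) (simp_all add: F G00 H0)
  moreover have "(?F0, ?F1) \<in> hrel T W"
    by (rule cone_htpyI[OF W F(1) F(1), where G = G and f = "\<lambda>s x. H s (Pt x)"])
       (simp_all add: F G1 G0 Gx Gs HX)
  ultimately have 1: "(f, ?F1) \<in> hrel T W" by (rule hrel_trans[OF pspace_cone W])
  define E where "E t z = G 1 t (un_Pt z)" for t z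
  have E: "b \<in> carr (fst LA) \<Longrightarrow> E 0 b = snd W" "b \<in> carr (fst LA) \<Longrightarrow> E 1 b = snd W" "E t (Pt x0) = snd W" for b t
    using sub by (auto simp: E_def G0 G1 H1 Gx)
  have Es: "(\<lambda>r. E (t r) (b r)) \<in> crv (fst W)" if "t \<in> crv boldI" "b \<in> crv (fst LA)" for t b
    using that(2) by (auto elim!: crv_LA_E simp: E_def intro!: Gs[OF crv_Isp_const[of 1] that(1)])
  have f': "psmooth (susp LA) W (susp_fun E)" by (rule psmooth_susp_fun[OF pspace_LA W]) (simp_all add: E Es)
  have "susp_fun E (susp_pt LA t (Pt a)) = G 1 t a" if "0 \<le> t" "t \<le> 1" "a \<in> carr A" for t a
    using susp_fun_apply[of LA E "snd W" t "Pt a", OF pspace_LA] E that by (simp add: E_def)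
  then have "(susp_fun E \<circ> cone_k A x0, ?F1) \<in> hrel T W"
    by (intro hrel_agree[OF pspace_cone W psmooth_comp[OF pspace_cone pspace_susp[OF pspace_LA] W psmooth_k f'] F(1)])
       (auto simp: carr_cone cone_k_apply F H1 psmooth_pt[OF f'])
  with f' 1 show "\<exists>f'. psmooth (susp LA) W f' \<and> (f' \<circ> cone_k A x0, f) \<in> hrel T W"
    using hrel_trans[OF pspace_cone W _ hrel_sym[OF pspace_cone W 1]] by blast
qed

text \<open>Given h on \<Sigma>X, the map h \<circ> \<Sigma>i \<circ> k contracts because the
  suspension coordinate can be pushed from 1 down to 0 over all of X, not only over A. Conversely, a
  null-homotopy of g \<circ> k restricted to X gives a loop for each point of X, that is a map from
  \<Sigma>X.\<close>

lemma exact_at_susp: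
  assumes W: "pspace W"
  shows "exact_at W T (susp LA) (susp LX) (cone_k A x0) (susp_map LX id)"
  unfolding exact_at_iff[OF W pspace_cone pspace_susp[OF pspace_LA] pspace_susp[OF pspace_LX] psmooth_k psmooth_susp_map[OF pspace_LA pspace_LX psmooth_incl]]
proof (intro allI impI iffI)
  note PA = pspace_susp[OF pspace_LA] and PX = pspace_susp[OF pspace_LX]
  note Si = psmooth_susp_map[OF pspace_LA pspace_LX psmooth_incl]
  have Si_pt: "susp_map LX id (susp_pt LA t (Pt a)) = susp_pt LX t (Pt a)" if "0 \<le> t" "t \<le> 1" "a \<in> carr A" for t a
    using susp_map_pt[OF pspace_LA pspace_LX psmooth_incl, of t "Pt a"] that by simp
  {
    fix g assume g: "psmooth (susp LA) W g" and "\<exists>h. psmooth (susp LX) W h \<and> (h \<circ> susp_map LX id, g) \<in> hrel (susp LA) W"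
    then obtain h where h: "psmooth (susp LX) W h" "(h \<circ> susp_map LX id, g) \<in> hrel (susp LA) W" by blast
    define p where "p = h \<circ> susp_map LX id \<circ> cone_k A x0"
    have p: "psmooth T W p" unfolding p_def
      by (rule psmooth_comp[OF pspace_cone PA W psmooth_k psmooth_comp[OF PA PX W Si h(1)]])
    have pv: "0 \<le> t \<Longrightarrow> t \<le> 1 \<Longrightarrow> a \<in> carr A \<Longrightarrow> p (cone1 t a) = h (susp_pt LX t (Pt a))" "x \<in> carr X \<Longrightarrow> p (cone2 x) = snd W" for t a x
      by (simp_all add: p_def cone_k_apply Si_pt psmooth_pt[OF Si] psmooth_pt[OF h(1)])
    have hc: "x \<in> carr X \<Longrightarrow> h (susp_pt LX 0 (Pt x)) = snd W" "x \<in> carr X \<Longrightarrow> h (susp_pt LX 1 (Pt x)) = snd W"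
        "0 \<le> t \<Longrightarrow> t \<le> 1 \<Longrightarrow> h (susp_pt LX t (Pt x0)) = snd W" for x t
      using susp_pt_collapse[OF pspace_LX] psmooth_pt[OF h(1)] by simp_all
    have hs: "(\<lambda>r. h (susp_pt LX (t r) (Pt (x r)))) \<in> crv (fst W)" if "t \<in> crv Isp" "x \<in> crv X" for t x
      by (rule psmooth_crv[OF PX W h(1) crv_susp_pt[OF pspace_LX crv_Isp_boldI[OF that(1)]]]) (simp add: crv_LX that)
    \<comment> \<open>At time s the cone is mapped to the part of the suspension up to level 1 - s,
      with X at the level 1 - s itself.\<close>
    define G where "G s t a = h (susp_pt LX ((1 - s) * mid_step t) (Pt a))" for s t a
    define e where "e s x = h (susp_pt LX (1 - s) (Pt x))" for s x
    have G: "G s 1 a = e s a" "a \<in> carr A \<Longrightarrow> G s 0 a = snd W" "0 \<le> s \<Longrightarrow> s \<le> 1 \<Longrightarrow> G s t x0 = snd W"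
        "a \<in> carr A \<Longrightarrow> G 1 t a = snd W" for s t a
      using sub mid_step_range[of t] by (auto simp: G_def e_def hc mult_le_one subsetD)
    have Gs: "(\<lambda>r. G (s r) (t r) (a r)) \<in> crv (fst W)" if "s \<in> crv Isp" "t \<in> crv boldI" "a \<in> crv A" for s t a
      unfolding G_def by (intro hs crv_Isp_mult crv_Isp_flip crv_mid_step crv_A_X that)
    have es: "(\<lambda>r. e (s r) (x r)) \<in> crv (fst W)" if "s \<in> crv Isp" "x \<in> crv X" for s x
      unfolding e_def by (intro hs crv_Isp_flip that)
    have F: "psmooth T W (cone_fun (G 0) (e 0))"
      "0 \<le> t \<Longrightarrow> t \<le> 1 \<Longrightarrow> a \<in> carr A \<Longrightarrow> cone_fun (G 0) (e 0) (cone1 t a) = G 0 t a"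
      "x \<in> carr X \<Longrightarrow> cone_fun (G 0) (e 0) (cone2 x) = e 0 x" for t a x
      using psmooth_cone_fun[of W "G 0" "e 0", OF W] G Gs[OF crv_Isp_const[of 0]] es[OF crv_Isp_const[of 0]] by simp_all
    have "(p, cone_fun (G 0) (e 0)) \<in> hrel T W"
      by (rule cone_reparam[OF W p F(1)]) (simp_all add: F pv G_def e_def hc mid_step_range)
    moreover have "(cone_fun (G 0) (e 0), \<lambda>_. snd W) \<in> hrel T W"
      by (rule cone_htpyI[OF W F(1) psmooth_const[OF pspace_cone W], where G = G and f = e])
         (simp_all add: G Gs es F, simp add: e_def hc)
    ultimately have "(p, \<lambda>_. snd W) \<in> hrel T W" by (rule hrel_trans[OF pspace_cone W])
    with hrel_sym[OF pspace_cone W hrel_precomp[OF pspace_cone PA W psmooth_k h(2)]]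
    show "(g \<circ> cone_k A x0, \<lambda>_. snd W) \<in> hrel T W" unfolding p_def by (rule hrel_trans[OF pspace_cone W])
  }
  {
    fix g assume g: "psmooth (susp LA) W g" and "(g \<circ> cone_k A x0, \<lambda>_. snd W) \<in> hrel T W"
    then have ph: "phtpy T W (g \<circ> cone_k A x0) (\<lambda>_. snd W)" by (simp add: hrel_iff[OF pspace_cone W])
    obtain H where "htpy T W (g \<circ> cone_k A x0) (\<lambda>_. snd W) H"
      by (rule phtpyE[OF pspace_cone W ph])
    note H = htpyD[OF this]
    have c1: "0 \<le> t \<Longrightarrow> t \<le> 1 \<Longrightarrow> a \<in> carr A \<Longrightarrow> cone1 t a \<in> carr (fst T)" "x \<in> carr X \<Longrightarrow> cone2 x \<in> carr (fst T)" for t a x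
      by (auto simp: carr_cone)
    have H01: "0 \<le> t \<Longrightarrow> t \<le> 1 \<Longrightarrow> a \<in> carr A \<Longrightarrow> H 0 (cone1 t a) = g (susp_pt LA t (Pt a))"
      "x \<in> carr X \<Longrightarrow> H 0 (cone2 x) = snd W" for t a x
      using H(2)[OF c1(1)] H(2)[OF c1(2)] by (simp_all add: cone_k_apply psmooth_pt[OF g])
    have H1: "0 \<le> t \<Longrightarrow> t \<le> 1 \<Longrightarrow> a \<in> carr A \<Longrightarrow> H 1 (cone1 t a) = snd W" "x \<in> carr X \<Longrightarrow> H 1 (cone2 x) = snd W" for t a x
      using H(3)[OF c1(1)] H(3)[OF c1(2)] by simp_all
    \<comment> \<open>On X the homotopy H starts at the base point because k collapses X, and it
      ends there as well. Running it backwards gives it the direction of g.\<close>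
    define K where "K s z = H (1 - mid_step s) (cone2 (un_Pt z))" for s z
    have h: "psmooth (susp LX) W (susp_fun K)"
    proof (rule psmooth_susp_fun[OF pspace_LX W])
      fix t b assume t: "t \<in> crv boldI" and "b \<in> crv (fst LX)"
      then show "(\<lambda>r. K (t r) (b r)) \<in> crv (fst W)" unfolding K_def
        by (auto elim!: crv_LX_E intro!: H(1) crv_Isp_flip crv_mid_step crv_cone2)
    qed (use mid_step_range in \<open>auto simp: K_def H1 H01 H(4) cone2_x0\<close>)
    have hv: "susp_fun K (susp_pt LX t (Pt x)) = H (1 - mid_step t) (cone2 x)" if "0 \<le> t" "t \<le> 1" "x \<in> carr X" for t x
    proof -
      have "susp_fun K (susp_pt LX t (Pt x)) = K t (Pt x)"
        by (rule susp_fun_apply[OF pspace_LX, where w = "snd W"])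
           (use that mid_step_range in \<open>auto simp: K_def H1 H01 H(4) cone2_x0\<close>)
      then show ?thesis by (simp add: K_def)
    qed
    (* On the square of the cone parameter t and the homotopy parameter s, H is the base point along
       t = 0 and s = 1. The loop along s = 0 is g; turning its path to the diagonal (G1) and on to the
       edge t = 1 (G2) deforms it into the reversed loop given by H on X. *)
    define G1 where "G1 s t z = H (s * (1 - mid_step t)) (cone1 ((1 - s) * t + s * mid_step t) (un_Pt z))" for s t z
    define G2 where "G2 s t z = H (1 - mid_step t) (cone1 ((1 - s) * mid_step t + s * 1) (un_Pt z))" for s t z
    have m: "0 \<le> (1 - s) * t + s * mid_step t \<and> (1 - s) * t + s * mid_step t \<le> 1"
        "0 \<le> (1 - s) * mid_step t + s * 1 \<and> (1 - s) * mid_step t + s * 1 \<le> 1"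
        "0 \<le> s * (1 - mid_step t)" "s * (1 - mid_step t) \<le> 1"
      if "0 \<le> s" "s \<le> 1" "0 \<le> t" "t \<le> 1" for s t
      using that mid_step_range[of t] by (simp_all only: convex_unit order_refl zero_le_one) (simp_all add: mult_le_one)
    have G1b: "0 \<le> s \<Longrightarrow> s \<le> 1 \<Longrightarrow> b \<in> carr (fst LA) \<Longrightarrow> G1 s 0 b = snd W"
        "0 \<le> s \<Longrightarrow> s \<le> 1 \<Longrightarrow> b \<in> carr (fst LA) \<Longrightarrow> G1 s 1 b = snd W"
        "0 \<le> s \<Longrightarrow> s \<le> 1 \<Longrightarrow> 0 \<le> t \<Longrightarrow> t \<le> 1 \<Longrightarrow> G1 s t (Pt x0) = snd W" for s t b
      using sub m by (auto simp: G1_def cone_collapse cone1_1 H(4) H01)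
    have G2b: "0 \<le> s \<Longrightarrow> s \<le> 1 \<Longrightarrow> b \<in> carr (fst LA) \<Longrightarrow> G2 s 0 b = snd W"
        "0 \<le> s \<Longrightarrow> s \<le> 1 \<Longrightarrow> b \<in> carr (fst LA) \<Longrightarrow> G2 s 1 b = snd W"
        "0 \<le> s \<Longrightarrow> s \<le> 1 \<Longrightarrow> 0 \<le> t \<Longrightarrow> t \<le> 1 \<Longrightarrow> G2 s t (Pt x0) = snd W" for s t b
      using sub m mid_step_range by (auto simp: G2_def cone_collapse cone1_1 H(4) H01 H1)
    have G1s: "(\<lambda>r. G1 (s r) (t r) (b r)) \<in> crv (fst W)" if "s \<in> crv Isp" "t \<in> crv boldI" "b \<in> crv (fst LA)" for s t b
      using that unfolding G1_def
      by (auto elim!: crv_LA_E intro!: H(1) crv_Isp_flip crv_Isp_mult crv_mid_step crv_cone1 crv_flatten_homotopy)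
    have conv: "(\<lambda>r. (1 - s r) * mid_step (t r) + s r * 1) \<in> crv boldI" if s: "s \<in> crv Isp" and t: "t \<in> crv boldI" for s t
    proof (rule crv_Isp_boldI)
      have "smooth_rr (\<lambda>r. (1 - s r) * mid_step (t r) + s r * 1)"
        using s crv_mid_step[OF t] by (intro smooth_intros) (simp_all add: crv_Isp)
      then show "(\<lambda>r. (1 - s r) * mid_step (t r) + s r * 1) \<in> crv Isp"
        unfolding crv_Isp using m(2) s boldI_range[OF t] by (simp add: crv_Isp)
    qed
    have G2s: "(\<lambda>r. G2 (s r) (t r) (b r)) \<in> crv (fst W)" if "s \<in> crv Isp" "t \<in> crv boldI" "b \<in> crv (fst LA)" for s t b
      using that conv unfolding G2_def
      by (auto elim!: crv_LA_E intro!: H(1) crv_Isp_flip crv_mid_step crv_cone1)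
    have P: "psmooth (susp LA) W (susp_fun (G1 1))"
      by (rule psmooth_susp_fun[OF pspace_LA W]) (simp_all add: G1b G1s[OF crv_Isp_const[of 1]])
    have Pv: "susp_fun (G1 1) (susp_pt LA t b) = G1 1 t b" if "0 \<le> t" "t \<le> 1" "b \<in> carr (fst LA)" for t b
      by (rule susp_fun_apply[OF pspace_LA, where w = "snd W"]) (use that in \<open>simp_all add: G1b\<close>)
    have "(g, susp_fun (G1 1)) \<in> hrel (susp LA) W"
      by (rule susp_htpyI[OF pspace_LA W g P, where G = G1]) (use Pv in \<open>auto simp: G1b G1s, auto simp: G1_def H01\<close>)
    moreover have "(susp_fun (G1 1), susp_fun K \<circ> susp_map LX id) \<in> hrel (susp LA) W"
      by (rule susp_htpyI[OF pspace_LA W P psmooth_comp[OF PA PX W Si h], where G = G2])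
         (use Pv sub in \<open>auto simp: G2b G2s Si_pt hv, auto simp: G1_def G2_def cone1_1 Si_pt hv subsetD\<close>)
    ultimately show "\<exists>h. psmooth (susp LX) W h \<and> (h \<circ> susp_map LX id, g) \<in> hrel (susp LA) W"
      using h hrel_sym[OF PA W hrel_trans[OF PA W]] by blast
  }
qed

end

section \<open>Loop spaces and the Puppe sequence\<close>

text \<open>Loops are encoded in the type \<open>real list \<Rightarrow> 'w\<close>, so that iterated loop spaces stay in the same
  type: the first entry of the list is the loop parameter. The values at lists that do not start with
  a parameter in the unit interval are normalised, which makes the adjunction bijective.\<close>
definition enc :: "(real \<Rightarrow> real list \<Rightarrow> 'w) \<Rightarrow> real list \<Rightarrow> 'w" where
  "enc p l = (case l of [] \<Rightarrow> undefined | t # l' \<Rightarrow> if 0 \<le> t \<and> t \<le> 1 then p t l' else undefined)"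

definition dec :: "(real list \<Rightarrow> 'w) \<Rightarrow> real \<Rightarrow> real list \<Rightarrow> 'w" where
  "dec \<gamma> t l = \<gamma> (t # l)"

lemma dec_enc: "0 \<le> t \<Longrightarrow> t \<le> 1 \<Longrightarrow> dec (enc p) t = p t"
  by (simp add: dec_def[abs_def] enc_def)

lemma enc_cong: "(\<And>t. 0 \<le> t \<Longrightarrow> t \<le> 1 \<Longrightarrow> p t = q t) \<Longrightarrow> enc p = enc q"
  by (auto simp: enc_def split: list.split)

definition loop_carr :: "(real list \<Rightarrow> 'w) frol \<times> (real list \<Rightarrow> 'w) \<Rightarrow> (real list \<Rightarrow> 'w) set" where
  "loop_carr V = {enc p | p. (\<forall>t\<in>crv boldI. (\<lambda>r. p (t r)) \<in> crv (fst V)) \<and> p 0 = snd V \<and> p 1 = snd V}"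

text \<open>The reparametrisation s and the loop parameter t vary along one line and so test joint
  smoothness on the product of the line with the flattened interval. \<open>gen_crv\<close>
  completes these curves to a structure, and \<open>crv_loopsp_dec\<close> shows that evaluation
  stays smooth.\<close>

definition loop_crvs :: "(real list \<Rightarrow> 'w) frol \<times> (real list \<Rightarrow> 'w) \<Rightarrow> (real \<Rightarrow> real list \<Rightarrow> 'w) set" where
  "loop_crvs V = {c. (\<forall>r. c r \<in> loop_carr V) \<and>
     (\<forall>s t. smooth_rr s \<longrightarrow> t \<in> crv boldI \<longrightarrow> (\<lambda>r. dec (c (s r)) (t r)) \<in> crv (fst V))}"

definition loopsp :: "(real list \<Rightarrow> 'w) frol \<times> (real list \<Rightarrow> 'w) \<Rightarrow> (real list \<Rightarrow> 'w) frol \<times> (real list \<Rightarrow> 'w)" where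
  "loopsp V = (gen_crv (loop_carr V) (loop_crvs V), enc (\<lambda>_. snd V))"

lemma frolicher_loopsp: "frolicher (fst (loopsp V))"
  by (simp add: loopsp_def frolicher_gen_crv)

lemma carr_loopsp: "carr (fst (loopsp V)) = loop_carr V"
  by (simp add: loopsp_def)

lemma loop_carrI:
  "(\<And>t. t \<in> crv boldI \<Longrightarrow> (\<lambda>r. p (t r)) \<in> crv (fst V)) \<Longrightarrow> p 0 = snd V \<Longrightarrow> p 1 = snd V \<Longrightarrow> enc p \<in> loop_carr V"
  unfolding loop_carr_def by (intro CollectI exI[of _ p]) simp

lemma loop_carrD:
  assumes "\<gamma> \<in> loop_carr V"
  shows "t \<in> crv boldI \<Longrightarrow> (\<lambda>r. dec \<gamma> (t r)) \<in> crv (fst V)" "dec \<gamma> 0 = snd V" "dec \<gamma> 1 = snd V" "enc (dec \<gamma>) = \<gamma>"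
proof -
  obtain p where p: "\<gamma> = enc p" "\<forall>t\<in>crv boldI. (\<lambda>r. p (t r)) \<in> crv (fst V)" "p 0 = snd V" "p 1 = snd V"
    using assms unfolding loop_carr_def by blast
  show "(\<lambda>r. dec \<gamma> (t r)) \<in> crv (fst V)" if "t \<in> crv boldI" using p that boldI_range[OF that] by (simp add: dec_enc)
  show "dec \<gamma> 0 = snd V" "dec \<gamma> 1 = snd V" using p by (simp_all add: dec_enc)
  show "enc (dec \<gamma>) = \<gamma>" unfolding p(1) by (rule enc_cong) (simp add: dec_enc)
qed

lemma pspace_loopsp: "pspace V \<Longrightarrow> pspace (loopsp V)"
  unfolding pspace_def[of "loopsp V"] carr_loopsp using frolicher_loopsp[of V]
  by (simp add: loopsp_def loop_carrI crv_const pspaceD)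

text \<open>An instance of \<open>final_param\<close>, with the loop as the final variable and t as
  the parameter; here cartesian closedness enters the loop space.\<close>

lemma crv_loopsp_dec:
  assumes V: "pspace V" and c: "c \<in> crv (fst (loopsp V))" and t: "t \<in> crv boldI"
  shows "(\<lambda>r. dec (c r) (t r)) \<in> crv (fst V)"
proof (rule final_param[where K = "\<lambda>t \<gamma>. dec \<gamma> t", OF frolicher_boldI pspaceD(1)[OF V] _ _ t c[unfolded loopsp_def fst_conv]])
  fix \<gamma> assume "\<gamma> \<in> loop_carr V"
  then have "(\<lambda>_. \<gamma>) \<in> loop_crvs V" by (simp add: loop_crvs_def loop_carrD)
  then show "\<exists>c\<in>loop_crvs V. \<exists>v. c v = \<gamma>" by (intro bexI exI) simp_all
qed (simp add: loop_crvs_def)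

lemma crv_loopspI:
  assumes "\<And>r. c r \<in> loop_carr V" "\<And>s t. smooth_rr s \<Longrightarrow> t \<in> crv boldI \<Longrightarrow> (\<lambda>r. dec (c (s r)) (t r)) \<in> crv (fst V)"
  shows "c \<in> crv (fst (loopsp V))"
  unfolding loopsp_def fst_conv by (rule crv_gen_crvI) (use assms in \<open>simp_all add: loop_crvs_def\<close>)

definition adj :: "'a fpt frol \<times> 'a fpt \<Rightarrow> ('a fpt \<Rightarrow> real list \<Rightarrow> 'w) \<Rightarrow> 'a fpt \<Rightarrow> real list \<Rightarrow> 'w" where
  "adj Q f y = enc (\<lambda>t. f (susp_pt Q t y))"

definition coadj :: "('a fpt \<Rightarrow> real list \<Rightarrow> 'w) \<Rightarrow> 'a fpt \<Rightarrow> real list \<Rightarrow> 'w" where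
  "coadj \<phi> = susp_fun (\<lambda>t y. dec (\<phi> y) t)"

text \<open>The parameter p lets one proof serve maps and homotopies: a constant family over the
  line for the former, a family over I for the latter.\<close>

lemma adj_family:
  assumes Q: "pspace Q" and V: "pspace V" and B: "frolicher B"
    and f: "\<And>p c. p \<in> crv B \<Longrightarrow> c \<in> crv (fst (susp Q)) \<Longrightarrow> (\<lambda>r. F (p r) (c r)) \<in> crv (fst V)"
      "\<And>p. p \<in> carr B \<Longrightarrow> F p (snd (susp Q)) = snd V"
    and p: "p \<in> crv B" and b: "b \<in> crv (fst Q)"
  shows "(\<lambda>r. adj Q (F (p r)) (b r)) \<in> crv (fst (loopsp V))"
proof (rule crv_loopspI)
  have bQ: "b r \<in> carr (fst Q)" and pB: "p r \<in> carr B" for r using crv_carr[OF pspaceD(1)[OF Q] b] crv_carr[OF B p] .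
  show "adj Q (F (p r)) (b r) \<in> loop_carr V" for r unfolding adj_def
  proof (rule loop_carrI)
    fix t assume t: "t \<in> crv boldI"
    show "(\<lambda>ra. F (p r) (susp_pt Q (t ra) (b r))) \<in> crv (fst V)"
      by (rule f(1)[OF crv_const[OF B pB] crv_susp_pt[OF Q t crv_const[OF pspaceD(1)[OF Q] bQ]]])
  qed (simp_all add: susp_pt_collapse(1,2)[OF Q bQ] f(2)[OF pB])
  fix s t assume s: "smooth_rr s" and t: "t \<in> crv boldI"
  have "(\<lambda>r. F (p (s r)) (susp_pt Q (t r) (b (s r)))) \<in> crv (fst V)"
    by (rule f(1)[OF crv_reparam[OF B p s] crv_susp_pt[OF Q t crv_reparam[OF pspaceD(1)[OF Q] b s]]])
  then show "(\<lambda>r. dec (adj Q (F (p (s r))) (b (s r))) (t r)) \<in> crv (fst V)"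
    using boldI_range[OF t] by (simp add: adj_def dec_enc)
qed

lemma adj_pt: "pspace Q \<Longrightarrow> f (snd (susp Q)) = snd V \<Longrightarrow> adj Q f (snd Q) = snd (loopsp V)"
  unfolding adj_def loopsp_def snd_conv by (rule enc_cong) (simp add: susp_pt_collapse)

lemma psmooth_adj:
  assumes Q: "pspace Q" and V: "pspace V" and f: "psmooth (susp Q) V f"
  shows "psmooth Q (loopsp V) (adj Q f)"
proof (rule psmoothI[OF Q pspace_loopsp[OF V]])
  fix c assume c: "c \<in> crv (fst Q)"
  show "(\<lambda>r. adj Q f (c r)) \<in> crv (fst (loopsp V))"
    by (rule adj_family[where F = "\<lambda>_. f" and p = "\<lambda>r. r", OF Q V frolicher_realsp _ _ _ c])
       (simp_all add: psmooth_crv[OF pspace_susp[OF Q] V f] psmooth_pt[OF f] crv_realsp smooth_id)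
qed (rule adj_pt[of Q f V, OF Q psmooth_pt[OF f]])

lemma loop_family:
  assumes Q: "pspace Q" and V: "pspace V" and \<phi>: "psmooth Q (loopsp V) \<phi>"
  shows "b \<in> carr (fst Q) \<Longrightarrow> \<phi> b \<in> loop_carr V"
  using psmooth_carr[OF \<phi>] by (simp add: carr_loopsp)

lemma dec_pt: "0 \<le> t \<Longrightarrow> t \<le> 1 \<Longrightarrow> dec (snd (loopsp V)) t = snd V"
  by (simp add: loopsp_def dec_enc)

lemma psmooth_coadj:
  assumes Q: "pspace Q" and V: "pspace V" and \<phi>: "psmooth Q (loopsp V) \<phi>"
  shows "psmooth (susp Q) V (coadj \<phi>)" "b \<in> carr (fst Q) \<Longrightarrow> adj Q (coadj \<phi>) b = \<phi> b"
proof -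
  note lc = loop_family[OF Q V \<phi>]
  have z: "b \<in> carr (fst Q) \<Longrightarrow> dec (\<phi> b) 0 = snd V" "b \<in> carr (fst Q) \<Longrightarrow> dec (\<phi> b) 1 = snd V"
    "0 \<le> t \<Longrightarrow> t \<le> 1 \<Longrightarrow> dec (\<phi> (snd Q)) t = snd V" for b t
    using loop_carrD(2,3)[OF lc] by (simp_all add: psmooth_pt[OF \<phi>] dec_pt)
  show "psmooth (susp Q) V (coadj \<phi>)" unfolding coadj_def
    by (rule psmooth_susp_fun[of Q V "\<lambda>t y. dec (\<phi> y) t", OF Q V z]) (simp_all add: crv_loopsp_dec[OF V psmooth_crv[OF Q pspace_loopsp[OF V] \<phi>]])
  show "adj Q (coadj \<phi>) b = \<phi> b" if b: "b \<in> carr (fst Q)"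
  proof -
    have "adj Q (coadj \<phi>) b = enc (dec (\<phi> b))" unfolding adj_def coadj_def
      by (rule enc_cong) (rule susp_fun_apply[of Q "\<lambda>t y. dec (\<phi> y) t" "snd V", OF Q z], use b in simp_all)
    then show ?thesis using loop_carrD(4)[OF lc[OF b]] by simp
  qed
qed

lemma adj_hrel_iff:
  assumes Q: "pspace Q" and V: "pspace V" and f: "psmooth (susp Q) V f" and f': "psmooth (susp Q) V f'"
  shows "(f, f') \<in> hrel (susp Q) V \<longleftrightarrow> (adj Q f, adj Q f') \<in> hrel Q (loopsp V)"
proof
  assume "(f, f') \<in> hrel (susp Q) V"
  then have ph: "phtpy (susp Q) V f f'" by (simp add: hrel_iff[OF pspace_susp[OF Q] V])
  obtain H where "htpy (susp Q) V f f' H"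
    by (rule phtpyE[OF pspace_susp[OF Q] V ph])
  note H = htpyD[OF this]
  have "phtpy Q (loopsp V) (adj Q f) (adj Q f')"
  proof (rule phtpyI[OF Q pspace_loopsp[OF V], where H = "\<lambda>s. adj Q (H s)"])
    fix s c assume s: "s \<in> crv Isp" and c: "c \<in> crv (fst Q)"
    show "(\<lambda>r. adj Q (H (s r)) (c r)) \<in> crv (fst (loopsp V))"
      by (rule adj_family[OF Q V frolicher_Isp _ _ s c]) (simp_all add: H)
  next
    fix x assume x: "x \<in> carr (fst Q)"
    have "susp_pt Q t x \<in> carr (fst (susp Q))" if "0 \<le> t" "t \<le> 1" for t
      using x that unfolding carr_susp by blast
    then show "adj Q (H 0) x = adj Q f x" "adj Q (H 1) x = adj Q f' x"
      unfolding adj_def using H by (auto intro!: enc_cong)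
  next
    show "adj Q (H t) (snd Q) = snd (loopsp V)" if "0 \<le> t" "t \<le> 1" for t
      by (rule adj_pt[of Q "H t" V, OF Q H(4)[OF that]])
  qed
  then show "(adj Q f, adj Q f') \<in> hrel Q (loopsp V)"
    by (simp add: hrel_iff[OF Q pspace_loopsp[OF V]] psmooth_adj[OF Q V] f f')
next
  assume "(adj Q f, adj Q f') \<in> hrel Q (loopsp V)"
  then have ph: "phtpy Q (loopsp V) (adj Q f) (adj Q f')" by (simp add: hrel_iff[OF Q pspace_loopsp[OF V]])
  obtain K where "htpy Q (loopsp V) (adj Q f) (adj Q f') K"
    by (rule phtpyE[OF Q pspace_loopsp[OF V] ph])
  note K = htpyD[OF this]
  have lc: "K s b \<in> loop_carr V" if "0 \<le> s" "s \<le> 1" "b \<in> carr (fst Q)" for s b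
    using crv_carr[OF frolicher_loopsp K(1)[of "\<lambda>_. s" "\<lambda>_. b"]] that
    by (simp add: carr_loopsp crv_Isp smooth_const crv_const pspaceD[OF Q])
  show "(f, f') \<in> hrel (susp Q) V"
  proof (rule susp_htpyI[OF Q V f f', where G = "\<lambda>s t b. dec (K s b) t"])
    show "(\<lambda>r. dec (K (s r) (b r)) (t r)) \<in> crv (fst V)" if "s \<in> crv Isp" "t \<in> crv boldI" "b \<in> crv (fst Q)" for s t b
      by (rule crv_loopsp_dec[OF V K(1)]) (use that in simp_all)
  qed (simp_all add: loop_carrD(2,3)[OF lc] K dec_pt adj_def dec_enc)
qed

lemma adj_natural:
  assumes P: "pspace P" and Q: "pspace Q" and h: "psmooth P Q h" and y: "y \<in> carr (fst P)"
  shows "adj P (f \<circ> susp_map Q h) y = adj Q f (h y)"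
  unfolding adj_def by (rule enc_cong) (simp add: susp_map_pt[OF P Q h _ _ y])

text \<open>Maps from \<Sigma>Q to V and from Q to \<Omega>V correspond naturally in Q, compatibly
  with homotopies and constant maps. So the criterion \<open>exact_at_iff\<close> for the suspended
  maps becomes the one for the original maps with target \<Omega>V.\<close>

lemma exact_at_susp_adjoint:
  assumes V: "pspace V" and P: "pspace P" and Q: "pspace Q" and R: "pspace R"
    and h: "psmooth P Q h" and g: "psmooth Q R g" and ex: "exact_at (loopsp V) P Q R h g"
  shows "exact_at V (susp P) (susp Q) (susp R) (susp_map Q h) (susp_map R g)"
proof -
  note LV = pspace_loopsp[OF V] and sP = pspace_susp[OF P] and sQ = pspace_susp[OF Q] and sR = pspace_susp[OF R]
  note sh = psmooth_susp_map[OF P Q h] and sg = psmooth_susp_map[OF Q R g]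
  have "(\<exists>f'. psmooth (susp R) V f' \<and> (f' \<circ> susp_map R g, f) \<in> hrel (susp Q) V) \<longleftrightarrow> (f \<circ> susp_map Q h, \<lambda>_. snd V) \<in> hrel (susp P) V"
    if f: "psmooth (susp Q) V f" for f
  proof -
    have fh: "psmooth (susp P) V (f \<circ> susp_map Q h)" by (rule psmooth_comp[OF sP sQ V sh f])
    have nat: "(adj Q (f' \<circ> susp_map R g), adj R f' \<circ> g) \<in> hrel Q (loopsp V)" if "psmooth (susp R) V f'" for f'
      by (rule hrel_agree[OF Q LV psmooth_adj[OF Q V psmooth_comp[OF sQ sR V sg that]] psmooth_comp[OF Q R LV g psmooth_adj[OF R V that]]])
         (simp add: adj_natural[OF Q R g])
    have 1: "(\<exists>f'. psmooth (susp R) V f' \<and> (f' \<circ> susp_map R g, f) \<in> hrel (susp Q) V) \<longleftrightarrow>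
        (\<exists>\<phi>. psmooth R (loopsp V) \<phi> \<and> (\<phi> \<circ> g, adj Q f) \<in> hrel Q (loopsp V))"
    proof
      assume "\<exists>f'. psmooth (susp R) V f' \<and> (f' \<circ> susp_map R g, f) \<in> hrel (susp Q) V"
      then obtain f' where f': "psmooth (susp R) V f'" "(f' \<circ> susp_map R g, f) \<in> hrel (susp Q) V" by blast
      have "(adj Q (f' \<circ> susp_map R g), adj Q f) \<in> hrel Q (loopsp V)"
        using f'(2) adj_hrel_iff[OF Q V psmooth_comp[OF sQ sR V sg f'(1)] f] by simp
      from hrel_trans[OF Q LV hrel_sym[OF Q LV nat[OF f'(1)]] this]
      show "\<exists>\<phi>. psmooth R (loopsp V) \<phi> \<and> (\<phi> \<circ> g, adj Q f) \<in> hrel Q (loopsp V)"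
        using psmooth_adj[OF R V f'(1)] by blast
    next
      assume "\<exists>\<phi>. psmooth R (loopsp V) \<phi> \<and> (\<phi> \<circ> g, adj Q f) \<in> hrel Q (loopsp V)"
      then obtain \<phi> where \<phi>: "psmooth R (loopsp V) \<phi>" "(\<phi> \<circ> g, adj Q f) \<in> hrel Q (loopsp V)" by blast
      note c = psmooth_coadj[OF R V \<phi>(1)]
      have "(adj R (coadj \<phi>) \<circ> g, \<phi> \<circ> g) \<in> hrel Q (loopsp V)"
        by (rule hrel_agree[OF Q LV psmooth_comp[OF Q R LV g psmooth_adj[OF R V c(1)]] psmooth_comp[OF Q R LV g \<phi>(1)]])
           (simp add: c(2) psmooth_carr[OF g])
      from hrel_trans[OF Q LV hrel_trans[OF Q LV nat[OF c(1)] this] \<phi>(2)]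
      have "(coadj \<phi> \<circ> susp_map R g, f) \<in> hrel (susp Q) V"
        using adj_hrel_iff[OF Q V psmooth_comp[OF sQ sR V sg c(1)] f] by simp
      then show "\<exists>f'. psmooth (susp R) V f' \<and> (f' \<circ> susp_map R g, f) \<in> hrel (susp Q) V" using c(1) by blast
    qed
    have 2: "(f \<circ> susp_map Q h, \<lambda>_. snd V) \<in> hrel (susp P) V \<longleftrightarrow> (adj Q f \<circ> h, \<lambda>_. snd (loopsp V)) \<in> hrel P (loopsp V)"
    proof -
      have a: "(adj P (f \<circ> susp_map Q h), adj Q f \<circ> h) \<in> hrel P (loopsp V)"
        by (rule hrel_agree[OF P LV psmooth_adj[OF P V fh] psmooth_comp[OF P Q LV h psmooth_adj[OF Q V f]]])
           (simp add: adj_natural[OF P Q h])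
      have b: "adj P (\<lambda>_. snd V) = (\<lambda>_. snd (loopsp V))" by (simp add: adj_def[abs_def] loopsp_def)
      show ?thesis unfolding adj_hrel_iff[OF P V fh psmooth_const[OF sP V]] b
        using hrel_trans[OF P LV a] hrel_trans[OF P LV hrel_sym[OF P LV a]] by blast
    qed
    show ?thesis unfolding 1 2
      using ex[unfolded exact_at_iff[OF LV P Q R h g], rule_format, OF psmooth_adj[OF Q V f]] .
  qed
  then show ?thesis unfolding exact_at_iff[OF V sP sQ sR sh sg] by blast
qed

section \<open>Iterated suspensions\<close>

lemma susp_n_0 [simp]: "susp_n 0 B = B" and susp_n_Suc: "susp_n (Suc n) B = susp (susp_n n B)"
  by (simp_all add: susp_n_def)

lemma pspace_susp_n: "pspace B \<Longrightarrow> pspace (susp_n n B)"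
  by (induction n) (simp_all add: susp_n_Suc pspace_susp)

lemma psmooth_susp_map_n: "pspace B \<Longrightarrow> pspace C \<Longrightarrow> psmooth B C g \<Longrightarrow> psmooth (susp_n n B) (susp_n n C) (susp_map_n n C g)"
  by (induction n) (simp_all add: susp_n_Suc psmooth_susp_map pspace_susp_n)

lemma susp_n_susp: "susp_n n (susp B) = susp_n (Suc n) B"
  by (simp add: susp_n_def funpow_swap1)

lemma susp_map_n_susp: "susp_map_n n (susp C) (susp_map C g) = susp_map_n (Suc n) C g"
  by (induction n) (simp_all add: susp_n_susp)

text \<open>The target is generalised in the induction: each suspension removed is paid for by a
  loop space, which stays in the type \<open>real list \<Rightarrow> 'w\<close>.\<close>

lemma exact_at_susp_n:
  fixes V :: "(real list \<Rightarrow> 'w) frol \<times> (real list \<Rightarrow> 'w)"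
  assumes P: "pspace P" and Q: "pspace Q" and R: "pspace R" and h: "psmooth P Q h" and g: "psmooth Q R g"
    and ex: "\<And>V :: (real list \<Rightarrow> 'w) frol \<times> (real list \<Rightarrow> 'w). pspace V \<Longrightarrow> exact_at V P Q R h g"
    and V: "pspace V"
  shows "exact_at V (susp_n n P) (susp_n n Q) (susp_n n R) (susp_map_n n Q h) (susp_map_n n R g)"
  using V
proof (induction n arbitrary: V)
  case 0
  then show ?case by (simp add: ex)
next
  case (Suc n)
  from exact_at_susp_adjoint[OF Suc.prems pspace_susp_n[OF P] pspace_susp_n[OF Q] pspace_susp_n[OF R]
      psmooth_susp_map_n[OF P Q h] psmooth_susp_map_n[OF Q R g] Suc.IH[OF pspace_loopsp[OF Suc.prems]]]
  show ?case by (simp add: susp_n_Suc)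
qed

text \<open>Composing with i transfers the problem to V, composing with d brings the solution back.
  This leads from W itself to a target of the type in which loop spaces live.\<close>

lemma exact_at_retract:
  assumes W: "pspace W" and V: "pspace V" and P: "pspace P" and Q: "pspace Q" and R: "pspace R"
    and h: "psmooth P Q h" and g: "psmooth Q R g"
    and i: "psmooth W V i" and d: "psmooth V W d" and di: "\<And>w. d (i w) = w" and ex: "exact_at V P Q R h g"
  shows "exact_at W P Q R h g"
  unfolding exact_at_iff[OF W P Q R h g]
proof (intro allI impI)
  fix f assume f: "psmooth Q W f"
  have e: "(\<exists>\<phi>. psmooth R V \<phi> \<and> (\<phi> \<circ> g, i \<circ> f) \<in> hrel Q V) \<longleftrightarrow> (i \<circ> f \<circ> h, \<lambda>_. snd V) \<in> hrel P V"
    using ex[unfolded exact_at_iff[OF V P Q R h g], rule_format, OF psmooth_comp[OF Q W V f i]] .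
  have dif: "d \<circ> (i \<circ> f) = f" using di by auto
  show "(\<exists>f'. psmooth R W f' \<and> (f' \<circ> g, f) \<in> hrel Q W) \<longleftrightarrow> (f \<circ> h, \<lambda>_. snd W) \<in> hrel P W"
  proof
    assume "\<exists>f'. psmooth R W f' \<and> (f' \<circ> g, f) \<in> hrel Q W"
    then obtain f' where f': "psmooth R W f'" "(f' \<circ> g, f) \<in> hrel Q W" by blast
    have "(i \<circ> f' \<circ> g, i \<circ> f) \<in> hrel Q V" using hrel_postcomp[OF Q W V i f'(2)] by (simp add: o_assoc)
    then have "(i \<circ> f \<circ> h, \<lambda>_. snd V) \<in> hrel P V" using e psmooth_comp[OF R W V f'(1) i] by blast
    from hrel_postcomp[OF P V W d this] show "(f \<circ> h, \<lambda>_. snd W) \<in> hrel P W"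
      by (simp add: o_def di psmooth_pt[OF d])
  next
    assume "(f \<circ> h, \<lambda>_. snd W) \<in> hrel P W"
    from hrel_postcomp[OF P W V i this] have "(i \<circ> f \<circ> h, \<lambda>_. snd V) \<in> hrel P V"
      by (simp add: o_def psmooth_pt[OF i])
    then obtain \<phi> where \<phi>: "psmooth R V \<phi>" "(\<phi> \<circ> g, i \<circ> f) \<in> hrel Q V" using e by blast
    have "(d \<circ> \<phi> \<circ> g, f) \<in> hrel Q W" using hrel_postcomp[OF Q V W d \<phi>(2)] unfolding dif by (simp add: o_assoc)
    then show "\<exists>f'. psmooth R W f' \<and> (f' \<circ> g, f) \<in> hrel Q W" using psmooth_comp[OF R V W \<phi>(1) d] by blast
  qed
qed

lemma exact_at_susp_n':
  fixes W :: "'w frol \<times> 'w"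
  assumes P: "pspace P" and Q: "pspace Q" and R: "pspace R" and h: "psmooth P Q h" and g: "psmooth Q R g"
    and ex: "\<And>V :: (real list \<Rightarrow> 'w) frol \<times> (real list \<Rightarrow> 'w). pspace V \<Longrightarrow> exact_at V P Q R h g"
    and W: "pspace W"
  shows "exact_at W (susp_n n P) (susp_n n Q) (susp_n n R) (susp_map_n n Q h) (susp_map_n n R g)"
proof -
  \<comment> \<open>W is copied as the constant functions of the list; evaluation at the empty list
    undoes this.\<close>
  define i where "i w l = w" for w :: 'w and l :: "real list"
  have inj: "inj i" by (auto simp: inj_def i_def fun_eq_iff)
  define V where "V = (gen_crv (i ` carr (fst W)) {i \<circ> c | c. c \<in> crv (fst W)}, i (snd W))"
  have V: "pspace V" using pspaceD[OF W] by (simp add: V_def pspace_def frolicher_gen_crv)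
  have cV: "c \<in> crv (fst V) \<longleftrightarrow> (\<exists>b\<in>crv (fst W). c = (\<lambda>r. i (b r)))" for c
    unfolding V_def fst_conv by (rule crv_copy[OF pspaceD(1)[OF W] inj])
  have pi: "psmooth W V i" by (rule psmoothI[OF W V], auto simp: cV) (simp add: V_def)
  have pd: "psmooth V W (\<lambda>\<gamma>. \<gamma> [])" by (rule psmoothI[OF V W], auto simp: cV i_def) (simp add: V_def i_def)
  show ?thesis
    by (rule exact_at_retract[OF W V pspace_susp_n[OF P] pspace_susp_n[OF Q] pspace_susp_n[OF R]
        psmooth_susp_map_n[OF P Q h] psmooth_susp_map_n[OF Q R g] pi pd _ exact_at_susp_n[OF P Q R h g ex V]])
       (simp add: i_def)
qed

text \<open>For each n the three statements are exactness at \<Sigma>^n X, \<Sigma>^n T_i and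
  \<Sigma>^(n+1) A. The last one involves \<Sigma>^(n+1) i, the map with which the next n begins, so
  together they cover the whole sequence.\<close>

theorem theorem6:
  fixes A X :: "'a frol" and x0 :: 'a and W :: "'w frol" and w0 :: 'w
  assumes "frolicher A" and "frolicher X" and "frolicher W"
    and "carr A \<subseteq> carr X" and "x0 \<in> carr A" and "w0 \<in> carr W"
    and "smooth_map A X id"
    and "\<forall>(Z :: 'a fpt frol) z0. frolicher Z \<and> z0 \<in> carr Z \<longrightarrow> pcofib_wrt A X x0 Z z0"
    and "\<forall>(Z :: 'w frol) z0. frolicher Z \<and> z0 \<in> carr Z \<longrightarrow> pcofib_wrt A X x0 Z z0"
  shows "\<forall>n.
      exact_at (W, w0) (susp_n n (liftsp A, Pt x0)) (susp_n n (liftsp X, Pt x0))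
        (susp_n n (cone A X x0))
        (susp_map_n n (liftsp X, Pt x0) id) (susp_map_n n (cone A X x0) (cone_j A X x0)) \<and>
      exact_at (W, w0) (susp_n n (liftsp X, Pt x0)) (susp_n n (cone A X x0))
        (susp_n (Suc n) (liftsp A, Pt x0))
        (susp_map_n n (cone A X x0) (cone_j A X x0))
        (susp_map_n n (susp (liftsp A, Pt x0)) (cone_k A x0)) \<and>
      exact_at (W, w0) (susp_n n (cone A X x0)) (susp_n (Suc n) (liftsp A, Pt x0))
        (susp_n (Suc n) (liftsp X, Pt x0))
        (susp_map_n n (susp (liftsp A, Pt x0)) (cone_k A x0))
        (susp_map_n (Suc n) (liftsp X, Pt x0) id)"
proof -
  interpret pointed_inclusion A X x0 by (rule pointed_inclusion.intro) (rule assms)+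
  have W: "pspace (W, w0)" using assms by (simp add: pspace_def)
  note sA = pspace_susp[OF pspace_LA] and sX = pspace_susp[OF pspace_LX]
  show ?thesis
  proof (intro allI conjI)
    fix n
    show "exact_at (W, w0) (susp_n n LA) (susp_n n LX) (susp_n n T) (susp_map_n n LX id) (susp_map_n n T (cone_j A X x0))"
      by (rule exact_at_susp_n'[OF pspace_LA pspace_LX pspace_cone psmooth_incl psmooth_j exact_at_X W])
    show "exact_at (W, w0) (susp_n n LX) (susp_n n T) (susp_n (Suc n) LA) (susp_map_n n T (cone_j A X x0)) (susp_map_n n (susp LA) (cone_k A x0))"
      unfolding susp_n_susp[symmetric]
      by (rule exact_at_susp_n'[OF pspace_LX pspace_cone sA psmooth_j psmooth_k exact_at_cone W])
    show "exact_at (W, w0) (susp_n n T) (susp_n (Suc n) LA) (susp_n (Suc n) LX) (susp_map_n n (susp LA) (cone_k A x0)) (susp_map_n (Suc n) LX id)"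
      unfolding susp_n_susp[symmetric] susp_map_n_susp[symmetric]
      by (rule exact_at_susp_n'[OF pspace_cone sA sX psmooth_k psmooth_susp_map[OF pspace_LA pspace_LX psmooth_incl] exact_at_susp W])
  qed
qed

end
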